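(* Suppose that for every subset $J\subseteq[n]$ we are given a set $\mathcal{B}_n(J)\subseteq\mathbb{C}[x_1,\dots,x_n]$ of polynomials, and let $\mathcal{B}_n=\bigsqcup_{J\subseteq[n]}\mathcal{B}_n(J)\cdot\theta_J$. The following are equivalent: (1) for all $J\subseteq[n]$, $\mathcal{B}_n(J)$ descends to a basis of $\mathbb{C}[x_1,\dots,x_n]/(I_n:f_J)$; (2) the set $\bigsqcup_{J\subseteq[n]}\{(b_J\cdot\theta_J\odot\mathfrak{D}_J(\delta_n))\odot\mathfrak{D}_J(\delta_n): b_J\in\mathcal{B}_n(J)\}$ is a basis of the superharmonic space $SH_n$. Moreover, either of (1) or (2) implies: (3) $\mathcal{B}_n$ descends to a basis of $SR_n=\Omega_n/SI_n$.
   Context: $\Omega_n=\mathbb{C}[x_1,\dots,x_n]\otimes\wedge\{\theta_1,\dots,\theta_n\}$ with diagonal $\mathfrak{S}_n$-action ($w\cdot x_i=x_{w(i)}$, $w\cdot\theta_i=\theta_{w(i)}$); $SI_n$ is the ideal generated by $\mathfrak{S}_n$-invariants with zero constant term and $SR_n=\Omega_n/SI_n$. For $K\subseteq[n]$, $\theta_K$ is the product of $\theta_k$, $k\in K$, in increasing order. $I_n\subseteq\mathbb{C}[x_1,\dots,x_n]$ is the ideal generated by symmetric polynomials with zero constant term; $(I_n:f)=\{g:gf\in I_n\}$; $f_J=\prod_{j\in J}x_j\prod_{i=j+1}^n(x_j-x_i)$. The $\odot$-action: for $f,g\in\Omega_n$, $f\odot g$ applies to $g$ the operator obtained from $f$ by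 replacing $x_i$ by $\partial/\partial x_i$ and $\theta_i$ by the contraction $\partial^\theta_i$, where $\partial^\theta_i(\theta_{j_1}\cdots\theta_{j_r})=(-1)^{s-1}\theta_{j_1}\cdots\widehat{\theta_{j_s}}\cdots\theta_{j_r}$ if $j_s=i$, and $0$ if $i\notin\{j_1,\dots,j_r\}$. $SH_n=\{g\in\Omega_n:f\odot g=0\ \forall f\in SI_n\}$. $\delta_n=\prod_{i<j}(x_j-x_i)$. For $j\ge1$, $d_j(f)=\sum_{i=1}^n(\partial^j f/\partial x_i^j)\theta_i$, and $d_I=d_{i_1}\circ\cdots\circ d_{i_r}$ for $I=\{i_1<\cdots<i_r\}$. Let $\mathcal{H}$ be the $n\times n$ matrix with $(i,j)$ entry $h_{i-j}(x_i,x_{i+1},\dots,x_n)$ (complete homogeneous symmetric polynomial, with $h_0=1$ and $h_m=0$ for $m<0$). For $K\subseteq[n]$ let $K^*=\{n-k+1:k\in K\}$. For $J\subseteq[n]$ define the operator $\mathfrak{D}_J(f)=\sum_{I\subseteq[n],|I|=|J|}(-1)^{\sum_{i\in I}i}\,\Delta_{[n]-J,([n]-I)^*}(\mathcal{H})\odot d_I(f)$, where $\Delta_{R,C}(\mathcal{H})$ is the minor of $\mathcal{H}$ with row set $R$ and column set $C$ (indices in increasing order). *)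

theory Defs
  imports
    Complex_Main
    "HOL-Library.Poly_Mapping"
    "HOL-Combinatorics.Permutations"
    "Jordan_Normal_Form.Determinant"
    "Jordan_Normal_Form.DL_Submatrix"
begin

section \<open>Polynomials\<close>

text \<open>
  A monomial is a finitely supported exponent vector, and the product on \<open>cpoly\<close> is the
  convolution product of \<open>Poly_Mapping\<close>.  The type has a variable \<open>x i\<close> for every \<open>i :: nat\<close>;
  the ring \<open>\<complex>[x\<^sub>1, \<dots>, x\<^sub>n]\<close> is the subset \<open>polys n\<close>.
\<close>

type_synonym cpoly = "(nat \<Rightarrow>\<^sub>0 nat) \<Rightarrow>\<^sub>0 complex"

definition polys :: "nat \<Rightarrow> cpoly set" where
  "polys n = {p. \<forall>m \<in> Poly_Mapping.keys p. Poly_Mapping.keys m \<subseteq> {1..n}}"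

definition X :: "nat \<Rightarrow> cpoly" where
  "X i = Poly_Mapping.single (Poly_Mapping.single i 1) 1"

definition pscale :: "complex \<Rightarrow> cpoly \<Rightarrow> cpoly" where
  "pscale c p = Poly_Mapping.single 0 c * p"

definition pperm :: "(nat \<Rightarrow> nat) \<Rightarrow> cpoly \<Rightarrow> cpoly" where
  "pperm w p = (\<Sum>m \<in> Poly_Mapping.keys p.
      pscale (Poly_Mapping.lookup p m)
        (\<Prod>i \<in> Poly_Mapping.keys m. X (w i) ^ Poly_Mapping.lookup m i))"

definition is_poly_ideal :: "nat \<Rightarrow> cpoly set \<Rightarrow> bool" where
  "is_poly_ideal n T \<longleftrightarrow> T \<subseteq> polys n \<and> 0 \<in> T \<and>
     (\<forall>s \<in> T. \<forall>t \<in> T. s + t \<in> T) \<and> (\<forall>a \<in> polys n. \<forall>t \<in> T. a * t \<in> T)"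

definition coinv_ideal :: "nat \<Rightarrow> cpoly set" where
  "coinv_ideal n = is_poly_ideal n hull
     {p \<in> polys n. (\<forall>w. w permutes {1..n} \<longrightarrow> pperm w p = p) \<and> Poly_Mapping.lookup p 0 = 0}"

definition colon :: "nat \<Rightarrow> cpoly set \<Rightarrow> cpoly \<Rightarrow> cpoly set" where
  "colon n T f = {g \<in> polys n. g * f \<in> T}"

definition fJ :: "nat \<Rightarrow> nat set \<Rightarrow> cpoly" where
  "fJ n J = (\<Prod>j \<in> J. X j * (\<Prod>i = j + 1..n. X j - X i))"

definition vandermonde :: "nat \<Rightarrow> cpoly" where
  "vandermonde n = (\<Prod>j = 1..n. \<Prod>i = 1..<j. X j - X i)"

definition pdiff :: "nat \<Rightarrow> cpoly \<Rightarrow> cpoly" where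
  "pdiff i p = (\<Sum>m \<in> Poly_Mapping.keys p.
      Poly_Mapping.single (m - Poly_Mapping.single i 1)
        (of_nat (Poly_Mapping.lookup m i) * Poly_Mapping.lookup p m))"

text \<open>\<open>complete_hom n k i\<close> is $h_k(x_i, x_{i+1}, \dots, x_n)$, the sum of all monomials of degree
  \<open>k\<close> in these variables.\<close>

definition complete_hom :: "nat \<Rightarrow> int \<Rightarrow> nat \<Rightarrow> cpoly" where
  "complete_hom n k i = (if k < 0 then 0 else
     (\<Sum>m \<in> {m. Poly_Mapping.keys m \<subseteq> {i..n} \<and>
               (\<Sum>a \<in> Poly_Mapping.keys m. Poly_Mapping.lookup m a) = nat k}.
        Poly_Mapping.single m 1))"

text \<open>Rows and columns of library matrices are numbered from 0, those of the mathematical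
  matrix from 1; hence the shifts in the following two definitions.\<close>

definition H_mat :: "nat \<Rightarrow> cpoly mat" where
  "H_mat n = mat n n (\<lambda>(i, j). complete_hom n (int (i + 1) - int (j + 1)) (i + 1))"

definition minor :: "cpoly mat \<Rightarrow> nat set \<Rightarrow> nat set \<Rightarrow> cpoly" where
  "minor A R C = Determinant.det (submatrix A ((\<lambda>k. k - 1) ` R) ((\<lambda>k. k - 1) ` C))"

section \<open>Superspace\<close>

text \<open>
  An element \<open>\<Sum>\<^sub>K p\<^sub>K \<theta>\<^sub>K\<close>, with \<open>\<theta>\<^sub>K\<close> the increasing product, is represented by its coefficient
  map \<open>K \<mapsto> p\<^sub>K\<close>; so \<open>Poly_Mapping.single K p\<close> stands for \<open>p \<cdot> \<theta>\<^sub>K\<close>.  The superspace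
  \<open>\<Omega>\<^sub>n\<close> is the subset \<open>superspace n\<close>.
\<close>

type_synonym sform = "nat set \<Rightarrow>\<^sub>0 cpoly"

definition superspace :: "nat \<Rightarrow> sform set" where
  "superspace n = {f. \<forall>K \<in> Poly_Mapping.keys f.
      K \<subseteq> {1..n} \<and> Poly_Mapping.lookup f K \<in> polys n}"

definition sscale :: "complex \<Rightarrow> sform \<Rightarrow> sform" where
  "sscale c f = Poly_Mapping.map (pscale c) f"

definition of_poly :: "cpoly \<Rightarrow> sform" where
  "of_poly p = Poly_Mapping.single {} p"

definition theta :: "nat \<Rightarrow> sform" where
  "theta i = Poly_Mapping.single {i} 1"

text \<open>For disjoint \<open>A\<close>, \<open>B\<close>: sorting \<open>\<theta>\<^sub>A \<theta>\<^sub>B\<close> into increasing order costs one sign for each pair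
  \<open>a \<in> A\<close>, \<open>b \<in> B\<close> with \<open>b < a\<close>.\<close>

definition smult :: "sform \<Rightarrow> sform \<Rightarrow> sform" (infixl "\<circledast>" 70) where
  "f \<circledast> g = (\<Sum>A \<in> Poly_Mapping.keys f. \<Sum>B \<in> Poly_Mapping.keys g.
      if A \<inter> B = {} then
        Poly_Mapping.single (A \<union> B)
          ((-1) ^ card {(a, b) \<in> A \<times> B. b < a} * Poly_Mapping.lookup f A * Poly_Mapping.lookup g B)
      else 0)"

text \<open>The diagonal action: the algebra automorphism with \<open>x\<^sub>i \<mapsto> x\<^bsub>w(i)\<^esub>\<close> and
  \<open>\<theta>\<^sub>i \<mapsto> \<theta>\<^bsub>w(i)\<^esub>\<close>; the factors \<open>\<theta>\<^bsub>w(k)\<^esub>\<close> are multiplied in the order of increasing \<open>k\<close>.\<close>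

definition sperm :: "(nat \<Rightarrow> nat) \<Rightarrow> sform \<Rightarrow> sform" where
  "sperm w f = (\<Sum>K \<in> Poly_Mapping.keys f.
      of_poly (pperm w (Poly_Mapping.lookup f K)) \<circledast>
        foldr (\<lambda>k g. theta (w k) \<circledast> g) (sorted_list_of_set K) (of_poly 1))"

definition is_super_ideal :: "nat \<Rightarrow> sform set \<Rightarrow> bool" where
  "is_super_ideal n T \<longleftrightarrow> T \<subseteq> superspace n \<and> 0 \<in> T \<and>
     (\<forall>s \<in> T. \<forall>t \<in> T. s + t \<in> T) \<and>
     (\<forall>a \<in> superspace n. \<forall>t \<in> T. a \<circledast> t \<in> T \<and> t \<circledast> a \<in> T)"

definition SI :: "nat \<Rightarrow> sform set" where
  "SI n = is_super_ideal n hull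
     {f \<in> superspace n. (\<forall>w. w permutes {1..n} \<longrightarrow> sperm w f = f) \<and>
        Poly_Mapping.lookup (Poly_Mapping.lookup f {}) 0 = 0}"

section \<open>The action of superspace on itself by differential operators\<close>

definition sdiff :: "nat \<Rightarrow> sform \<Rightarrow> sform" where
  "sdiff i f = Poly_Mapping.map (pdiff i) f"

definition contract :: "nat \<Rightarrow> sform \<Rightarrow> sform" where
  "contract i f = (\<Sum>K \<in> Poly_Mapping.keys f.
      if i \<in> K then
        Poly_Mapping.single (K - {i}) ((-1) ^ card {k \<in> K. k < i} * Poly_Mapping.lookup f K)
      else 0)"

text \<open>The operator of $x^m \theta_K$ with $K = \{k_1 < \dots < k_r\}$ is
  $\partial^m \circ \partial^\theta_{k_1} \circ \dots \circ \partial^\theta_{k_r}$: products become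
  compositions, so $\partial^\theta_{k_r}$ is applied first.  The \<open>\<partial>/\<partial>x\<^sub>i\<close> commute with each other
  and with the contractions.\<close>

definition mono_op :: "(nat \<Rightarrow>\<^sub>0 nat) \<Rightarrow> nat set \<Rightarrow> sform \<Rightarrow> sform" where
  "mono_op m K g =
     foldr (\<lambda>i. sdiff i ^^ Poly_Mapping.lookup m i) (sorted_list_of_set (Poly_Mapping.keys m))
       (foldr contract (sorted_list_of_set K) g)"

definition sodot :: "sform \<Rightarrow> sform \<Rightarrow> sform" (infixl "\<Odot>" 70) where
  "f \<Odot> g = (\<Sum>K \<in> Poly_Mapping.keys f. \<Sum>m \<in> Poly_Mapping.keys (Poly_Mapping.lookup f K).
      sscale (Poly_Mapping.lookup (Poly_Mapping.lookup f K) m) (mono_op m K g))"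

definition SH :: "nat \<Rightarrow> sform set" where
  "SH n = {g \<in> superspace n. \<forall>f \<in> SI n. f \<Odot> g = 0}"

definition dj :: "nat \<Rightarrow> nat \<Rightarrow> sform \<Rightarrow> sform" where
  "dj n j f = (\<Sum>i = 1..n. (sdiff i ^^ j) f \<circledast> theta i)"

definition dI :: "nat \<Rightarrow> nat set \<Rightarrow> sform \<Rightarrow> sform" where
  "dI n I f = foldr (dj n) (sorted_list_of_set I) f"

definition star :: "nat \<Rightarrow> nat set \<Rightarrow> nat set" where
  "star n K = (\<lambda>k. n - k + 1) ` K"

definition D_op :: "nat \<Rightarrow> nat set \<Rightarrow> sform \<Rightarrow> sform" where
  "D_op n J f = (\<Sum>I \<in> {I. I \<subseteq> {1..n} \<and> card I = card J}.
      sscale ((-1) ^ (\<Sum>i \<in> I. i))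
        (of_poly (minor (H_mat n) ({1..n} - J) (star n ({1..n} - I))) \<Odot> dI n I f))"

section \<open>Bases\<close>

lemma vector_space_pscale: "vector_space pscale"
  by unfold_locales (simp_all add: pscale_def algebra_simps single_add mult_single
      flip: mult.assoc)

lemma lookup_sscale: "Poly_Mapping.lookup (sscale c f) K = pscale c (Poly_Mapping.lookup f K)"
  by (simp add: sscale_def map.rep_eq when_def pscale_def)

lemma vector_space_sscale: "vector_space sscale"
proof -
  interpret p: vector_space pscale by (rule vector_space_pscale)
  show ?thesis
    by unfold_locales (auto intro!: poly_mapping_eqI
        simp: lookup_sscale lookup_add p.scale_right_distrib p.scale_left_distrib)
qed

text \<open>
  Bases are indexed families, as in a disjoint union of sets of vectors: a repeated vector
  violates independence.  \<open>quotient_family_basis\<close> says that the cosets \<open>b i + W\<close>, for \<open>i \<in> I\<close>,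
  form a basis of \<open>V/W\<close>, written out on representatives: a linear combination of the cosets is zero
  in \<open>V/W\<close> iff the combination of the \<open>b i\<close> lies in \<open>W\<close>, and it equals the coset of \<open>v\<close> iff the
  difference lies in \<open>W\<close>.
\<close>

definition family_basis ::
  "(complex \<Rightarrow> 'v \<Rightarrow> 'v) \<Rightarrow> 'v::ab_group_add set \<Rightarrow> 'i set \<Rightarrow> ('i \<Rightarrow> 'v) \<Rightarrow> bool" where
  "family_basis scale V I b \<longleftrightarrow> inj_on b I \<and>
     \<not> Modules.module.dependent scale (b ` I) \<and> Modules.module.span scale (b ` I) = V"

definition quotient_family_basis ::
  "(complex \<Rightarrow> 'v \<Rightarrow> 'v) \<Rightarrow> 'v::ab_group_add set \<Rightarrow> 'v set \<Rightarrow> 'i set \<Rightarrow> ('i \<Rightarrow> 'v) \<Rightarrow> bool" where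
  "quotient_family_basis scale V W I b \<longleftrightarrow> b ` I \<subseteq> V \<and>
     (\<forall>F c. finite F \<and> F \<subseteq> I \<and> (\<Sum>i \<in> F. scale (c i) (b i)) \<in> W \<longrightarrow> (\<forall>i \<in> F. c i = 0)) \<and>
     (\<forall>v \<in> V. \<exists>F c. finite F \<and> F \<subseteq> I \<and> v - (\<Sum>i \<in> F. scale (c i) (b i)) \<in> W)"

end

theory Submission
  imports Defs
begin

text \<open>
  Rank a subset \<open>J\<close> of \<open>[n]\<close> by the sum of its elements.  Newton interpolation at
  \<open>x\<^sub>n, x\<^bsub>n-1\<^esub>, \<dots>\<close> and Laplace expansion show that \<open>\<DD>\<^sub>J(\<delta>\<^sub>n)\<close> is \<open>\<plusminus>(f\<^sub>J \<odot> \<delta>\<^sub>n) \<theta>\<^sub>J\<close> plus terms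
  \<open>\<theta>\<^sub>K\<close> of smaller rank, and it is superharmonic because every \<open>d\<^sub>j\<close> is adjoint to an odd derivation
  preserving \<open>SI\<^sub>n\<close>.  Dually, every \<open>g \<in> (I\<^sub>n : f\<^sub>J)\<close> is the coefficient of \<open>\<theta>\<^sub>J\<close> in an element of
  \<open>SI\<^sub>n\<close> whose other terms have larger rank.  Pairing the two triangular systems and using Macaulay
  duality, \<open>(I\<^sub>n : f\<^sub>J)\<^sup>\<bottom> = \<complex>[x] \<odot> (f\<^sub>J \<odot> \<delta>\<^sub>n)\<close>, reduces all three statements to one \<open>J\<close> at a time,
  where conjugation and positivity give \<open>\<complex>[x] = (I\<^sub>n : f\<^sub>J) \<oplus> (I\<^sub>n : f\<^sub>J)\<^sup>\<bottom>\<close>.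

  The dual triangularity rests on explicit generators: \<open>(I\<^sub>n : f\<^sub>J)\<close> is generated by the power sums
  \<open>p\<^sub>1, \<dots>, p\<^bsub>n-|J|\<^esub>\<close> and the products of the \<open>x\<^sub>j - x\<^sub>k\<close> with \<open>k < j\<close>, \<open>k \<notin> J\<close>, one for each
  \<open>j \<in> J\<close>.  When \<open>j > max J\<close> is added to \<open>J\<close>, the last power sum is congruent to \<open>f\<^sub>j\<close> times the new
  generator.  All generators split into linear forms modulo the others, so codimensions are bounded
  above by products of degrees; starting from \<open>dim \<complex>[x]/I\<^sub>n = n!\<close> these bounds have to be attained,
  which forces the colon ideals to be the expected ones.
\<close>

text \<open>The double action in (2) is a matter of degrees. All terms of
  \<open>\<DD>\<^sub>J(\<delta>\<^sub>n)\<close> have exactly |J| theta factors, so contraction by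
  \<open>b \<theta>\<^sub>J\<close> leaves, up to sign, only the polynomial b \<odot> h with h =
  \<open>f\<^sub>J \<odot> \<delta>\<^sub>n\<close>. The vector attached to (J, b) thus depends only
  on b modulo the annihilator of h, and its coefficient at \<open>\<theta>\<^sub>J\<close> is (b
  \<odot> h) \<odot> h up to sign.

  Leading coefficients are controlled from one side only: \<open>(I\<^sub>n : f\<^sub>J)\<close> is
  contained in the leading ideal of \<open>SI\<^sub>n\<close> at J, and
  \<open>\<DD>\<^sub>J(\<delta>\<^sub>n)\<close> is superharmonic. The first fact gives spanning in
  \<open>SH\<^sub>n\<close> and in \<open>SR\<^sub>n\<close>, the second independence in
  \<open>SR\<^sub>n\<close>; independence in \<open>SH\<^sub>n\<close> comes from triangularity and
  positivity. So the dimension of \<open>SR\<^sub>n\<close> never has to be known beforehand. In the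
  same spirit the colon ideals are found without regular sequences: upper bounds by spanning sets
  are played off against a single lower bound, the n! independent derivatives of
  \<open>\<delta>\<^sub>n\<close>.\<close>

abbreviation coef :: "('a \<Rightarrow>\<^sub>0 'b::zero) \<Rightarrow> 'a \<Rightarrow> 'b" where "coef \<equiv> Poly_Mapping.lookup"
abbreviation supp :: "('a \<Rightarrow>\<^sub>0 'b::zero) \<Rightarrow> 'a set" where "supp \<equiv> Poly_Mapping.keys"
abbreviation sing :: "'a \<Rightarrow> 'b \<Rightarrow> ('a \<Rightarrow>\<^sub>0 'b::zero)" where "sing \<equiv> Poly_Mapping.single"

interpretation P: vector_space pscale by (rule vector_space_pscale)

lemma coef_pscale [simp]: "coef (pscale c p) m = c * coef p m"
proof -
  have "Poly_Mapping.map ((*) c) p = pscale c p"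
    by (simp add: pscale_def mult_map_scale_conv_mult)
  moreover have "coef (Poly_Mapping.map ((*) c) p) m = c * coef p m"
    by (simp add: map.rep_eq when_def)
  ultimately show ?thesis by simp
qed

lemma pscale_mult_left: "pscale c p * q = pscale c (p * q)"
  by (simp add: pscale_def mult.assoc)

lemma pscale_mult_right: "p * pscale c q = pscale c (p * q)"
  by (simp add: pscale_def mult.left_commute)

lemma pscale_single: "pscale c (sing m d) = sing m (c * d)"
  by (simp add: pscale_def mult_single)

lemma sum_single_coef:
  fixes p :: "'a \<Rightarrow>\<^sub>0 'b::comm_monoid_add"
  assumes "finite S" "supp p \<subseteq> S"
  shows "(\<Sum>m\<in>S. sing m (coef p m)) = p"
proof (rule poly_mapping_eqI)
  fix k
  have "coef (\<Sum>m\<in>S. sing m (coef p m)) k = (\<Sum>m\<in>S. if m = k then coef p m else 0)"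
    by (simp add: lookup_sum lookup_single when_def)
  also have "\<dots> = coef p k"
    using assms by (auto simp: sum.delta not_in_keys_iff_lookup_eq_zero)
  finally show "coef (\<Sum>m\<in>S. sing m (coef p m)) k = coef p k" .
qed

lemma poly_mapping_decompose:
  fixes p :: "'a \<Rightarrow>\<^sub>0 'b::comm_monoid_add"
  shows "p = (\<Sum>m\<in>supp p. sing m (coef p m))"
  using sum_single_coef[of "supp p" p] by simp

text \<open>Bilinear identities such as \<open>act_mult\<close>, \<open>pperm_mult\<close> and
  \<open>coef_mult_0\<close> are obtained by applying this rule to each argument, which leaves only
  monomials.\<close>

lemma poly_mapping_single_induct [case_names zero single add]:
  fixes p :: "'a \<Rightarrow>\<^sub>0 'b::comm_monoid_add"
  assumes "P 0" "\<And>m c. P (sing m c)" "\<And>p q. P p \<Longrightarrow> P q \<Longrightarrow> P (p + q)"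
  shows "P p"
proof -
  have "finite S \<Longrightarrow> P (\<Sum>m\<in>S. sing m (coef p m))" for S
    by (induction S rule: finite_induct) (auto intro: assms)
  then show ?thesis using poly_mapping_decompose[of p] by (metis finite_keys)
qed

section \<open>The polynomial ring\<close>

lemma polys_iff: "p \<in> polys n \<longleftrightarrow> (\<forall>m. coef p m \<noteq> 0 \<longrightarrow> supp m \<subseteq> {1..n})"
  by (auto simp: polys_def in_keys_iff)

lemma polys_0 [simp]: "0 \<in> polys n" by (simp add: polys_iff)

lemma polys_add [intro]: "p \<in> polys n \<Longrightarrow> q \<in> polys n \<Longrightarrow> p + q \<in> polys n"
  unfolding polys_iff lookup_add by (metis add.right_neutral add.left_neutral)

lemma polys_uminus [intro]: "p \<in> polys n \<Longrightarrow> - p \<in> polys n"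
  by (auto simp: polys_iff)

lemma polys_diff [intro]: "p \<in> polys n \<Longrightarrow> q \<in> polys n \<Longrightarrow> p - q \<in> polys n"
  using polys_add[of p n "- q"] by auto

lemma polys_single: "sing m c \<in> polys n \<longleftrightarrow> c = 0 \<or> supp m \<subseteq> {1..n}"
  by (auto simp: polys_iff lookup_single when_def)

lemma supp_add_nat: "supp (m + m' :: nat \<Rightarrow>\<^sub>0 nat) = supp m \<union> supp m'"
  by (auto simp: in_keys_iff lookup_add)

lemma polys_mult [intro]:
  assumes "p \<in> polys n" "q \<in> polys n" shows "p * q \<in> polys n"
proof -
  have "supp m \<subseteq> {1..n}" if "m \<in> supp (p * q)" for m
  proof -
    from that obtain a b where "m = a + b" "a \<in> supp p" "b \<in> supp q"
      using keys_mult[of p q] by auto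
    then show ?thesis using assms by (auto simp: polys_def supp_add_nat)
  qed
  then show ?thesis by (simp add: polys_def)
qed

lemma polys_const [simp]: "sing 0 c \<in> polys n" by (simp add: polys_single)

lemma polys_1 [simp]: "1 \<in> polys n" by (metis polys_const single_one)

lemma polys_X [simp]: "i \<in> {1..n} \<Longrightarrow> X i \<in> polys n"
  by (simp add: X_def polys_single)

lemma polys_pscale [intro]: "p \<in> polys n \<Longrightarrow> pscale c p \<in> polys n"
  unfolding pscale_def by (rule polys_mult) auto

lemma polys_sum [intro]: "(\<And>i. i \<in> A \<Longrightarrow> f i \<in> polys n) \<Longrightarrow> sum f A \<in> polys n"
  by (induction A rule: infinite_finite_induct) auto

lemma polys_prod [intro]: "(\<And>i. i \<in> A \<Longrightarrow> f i \<in> polys n) \<Longrightarrow> prod f A \<in> polys n"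
  by (induction A rule: infinite_finite_induct) auto

lemma polys_power [intro]: "p \<in> polys n \<Longrightarrow> p ^ k \<in> polys n"
  by (induction k) auto

lemma polys_sign [simp]: "(- 1) ^ k \<in> polys n" by (intro polys_power polys_uminus polys_1)

lemma X_power: "X i ^ k = sing (sing i k) 1"
proof (induction k)
  case (Suc k)
  then show ?case by (simp add: X_def mult_single flip: single_add)
qed simp

section \<open>The action by differential operators\<close>

definition mfact :: "(nat \<Rightarrow>\<^sub>0 nat) \<Rightarrow> complex" where
  "mfact m = (\<Prod>i\<in>supp m. fact (coef m i))"

lemma mfact_nonzero [simp]: "mfact m \<noteq> 0" by (simp add: mfact_def)

lemma mfact_0 [simp]: "mfact 0 = 1" by (simp add: mfact_def)

lemma mfact_superset: "finite S \<Longrightarrow> supp m \<subseteq> S \<Longrightarrow> mfact m = (\<Prod>i\<in>S. fact (coef m i))"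
  unfolding mfact_def by (rule prod.mono_neutral_left) (auto simp: in_keys_iff)

text \<open>The extra factor is the one that differentiation in \<open>X i\<close> brings down, so
  that \<open>dcoef_pdiff\<close> is free of scalars.\<close>

lemma mfact_add_single: "mfact (m + sing i 1) = of_nat (coef m i + 1) * mfact m"
proof -
  let ?S = "insert i (supp m)"
  have *: "mfact m = fact (coef m i) * (\<Prod>j\<in>supp m - {i}. fact (coef m j))"
    using mfact_superset[of ?S m] by (auto simp: prod.insert_remove)
  have "mfact (m + sing i 1) = (\<Prod>j\<in>?S. fact (coef (m + sing i 1) j))"
    by (rule mfact_superset) (auto simp: supp_add_nat)
  also have "\<dots> = fact (coef m i + 1) * (\<Prod>j\<in>supp m - {i}. fact (coef m j))"
    by (simp add: prod.insert_remove lookup_add lookup_single)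
  finally show ?thesis by (simp add: * algebra_simps)
qed

text \<open>With coefficients in the divided power basis, derivatives become shifts of the exponent.\<close>

definition dcoef :: "cpoly \<Rightarrow> (nat \<Rightarrow>\<^sub>0 nat) \<Rightarrow> complex" where
  "dcoef p m = mfact m * coef p m"

lemma dcoef_0 [simp]: "dcoef 0 m = 0" by (simp add: dcoef_def)

lemma dcoef_eqI: "(\<And>m. dcoef p m = dcoef q m) \<Longrightarrow> p = q"
  by (rule poly_mapping_eqI) (simp add: dcoef_def)

lemma dcoef_add: "dcoef (p + q) m = dcoef p m + dcoef q m"
  by (simp add: dcoef_def lookup_add algebra_simps)

lemma dcoef_pscale: "dcoef (pscale c p) m = c * dcoef p m"
  by (simp add: dcoef_def)

lemma dcoef_sum: "dcoef (sum f A) m = (\<Sum>a\<in>A. dcoef (f a) m)"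
  by (simp add: dcoef_def lookup_sum sum_distrib_left)

lemma coef_pdiff: "coef (pdiff i p) m = of_nat (coef m i + 1) * coef p (m + sing i 1)"
proof -
  let ?e = "sing i (1::nat)"
  have eq: "(sing (k - ?e) (of_nat (coef k i) * coef p k) :: cpoly)
      = (if coef k i = 0 then 0 else sing (k - ?e) (of_nat (coef k i) * coef p k))" for k
    by simp
  \<comment> \<open>Subtraction of exponents truncates at zero. Monomials without \<open>X i\<close>
    are therefore kept apart; they contribute 0 through the factor \<open>coef k i\<close>.\<close>
  have iff: "k - ?e = m \<longleftrightarrow> k = m + ?e" if "coef k i \<noteq> 0" for k
  proof
    assume "k - ?e = m"
    then show "k = m + ?e" using that
      by (intro poly_mapping_eqI) (auto simp: lookup_add lookup_minus lookup_single when_def)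
  qed auto
  have "coef (pdiff i p) m
      = (\<Sum>k\<in>supp p. if k = m + ?e then of_nat (coef k i) * coef p k else 0)"
    unfolding pdiff_def lookup_sum
  proof (rule sum.cong[OF refl])
    fix k assume "k \<in> supp p"
    show "coef (sing (k - ?e) (of_nat (coef k i) * coef p k)) m
      = (if k = m + ?e then of_nat (coef k i) * coef p k else 0)"
    proof (cases "coef k i = 0")
      case True
      then have "k \<noteq> m + ?e" by (auto simp: lookup_add)
      then show ?thesis using True by simp
    next
      case False
      then show ?thesis using iff[of k] by (auto simp: lookup_single when_def)
    qed
  qed
  also have "\<dots> = (if m + ?e \<in> supp p then of_nat (coef (m + ?e) i) * coef p (m + ?e) else 0)"
    by (simp add: sum.delta)
  finally show ?thesis by (simp add: lookup_add in_keys_iff)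
qed

lemma dcoef_pdiff: "dcoef (pdiff i p) m = dcoef p (m + sing i 1)"
  using mfact_add_single[of m i] by (simp add: dcoef_def coef_pdiff)

lemma dcoef_pdiff_funpow: "dcoef ((pdiff i ^^ k) p) m = dcoef p (m + sing i k)"
proof (induction k arbitrary: m)
  case (Suc k)
  have "m + sing i 1 + sing i k = m + sing i (Suc k)"
    by (simp add: add.assoc flip: single_add)
  then show ?case using Suc[of "m + sing i 1"] by (simp add: dcoef_pdiff)
qed simp

definition pmono_op :: "(nat \<Rightarrow>\<^sub>0 nat) \<Rightarrow> cpoly \<Rightarrow> cpoly" where
  "pmono_op a p = foldr (\<lambda>i. pdiff i ^^ coef a i) (sorted_list_of_set (supp a)) p"

lemma dcoef_pmono_op: "dcoef (pmono_op a p) m = dcoef p (m + a)"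
proof -
  have *: "dcoef (foldr (\<lambda>i. pdiff i ^^ coef a i) is p) m = dcoef p (m + (\<Sum>i\<leftarrow>is. sing i (coef a i)))"
    for "is" m
    by (induction "is" arbitrary: m) (auto simp: dcoef_pdiff_funpow add.assoc add.left_commute)
  have "(\<Sum>i\<leftarrow>sorted_list_of_set (supp a). sing i (coef a i)) = a"
    by (subst sum_list_distinct_conv_sum_set) (auto simp: poly_mapping_decompose[of a, symmetric])
  then show ?thesis unfolding pmono_op_def * by simp
qed

text \<open>The polynomial part of \<open>sodot\<close>: by \<open>coef_sodot_contract\<close>,
  \<open>sodot\<close> is contraction followed by \<open>act\<close> on every coefficient.\<close>

definition act :: "cpoly \<Rightarrow> cpoly \<Rightarrow> cpoly" where
  "act p q = (\<Sum>a\<in>supp p. pscale (coef p a) (pmono_op a q))"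

lemma dcoef_act: "dcoef (act p q) m = (\<Sum>a\<in>supp p. coef p a * dcoef q (m + a))"
  by (simp add: act_def dcoef_sum dcoef_pscale dcoef_pmono_op)

lemma dcoef_act_superset:
  assumes "finite S" "supp p \<subseteq> S"
  shows "dcoef (act p q) m = (\<Sum>a\<in>S. coef p a * dcoef q (m + a))"
  unfolding dcoef_act using assms
  by (intro sum.mono_neutral_left) (auto simp: in_keys_iff)

lemma act_add_left: "act (p + p') q = act p q + act p' q"
proof (rule dcoef_eqI)
  fix m
  let ?S = "supp p \<union> supp p'"
  show "dcoef (act (p + p') q) m = dcoef (act p q + act p' q) m"
    unfolding dcoef_add
    using dcoef_act_superset[of ?S p] dcoef_act_superset[of ?S p']
      dcoef_act_superset[of ?S "p + p'", OF _ keys_add]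
    by (simp add: lookup_add algebra_simps sum.distrib)
qed

lemma act_add_right: "act p (q + q') = act p q + act p q'"
  by (rule dcoef_eqI) (simp add: dcoef_add dcoef_act sum.distrib algebra_simps)

lemma act_0_left [simp]: "act 0 q = 0" by (simp add: act_def)

lemma act_0_right [simp]: "act p 0 = 0" by (rule dcoef_eqI) (simp add: dcoef_act)

lemma act_single: "act (sing a c) q = pscale c (pmono_op a q)"
  by (cases "c = 0") (simp_all add: act_def)

lemma act_pscale_right: "act p (pscale c q) = pscale c (act p q)"
  by (rule dcoef_eqI) (simp add: dcoef_act dcoef_pscale sum_distrib_left algebra_simps)

lemma act_pscale_left: "act (pscale c p) q = pscale c (act p q)"
  by (induction p rule: poly_mapping_single_induct)
    (simp_all add: P.scale_right_distrib act_add_left pscale_single act_single)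

lemma act_uminus_left: "act (- p) q = - act p q"
  using act_add_left[of p "- p" q] by (simp add: eq_neg_iff_add_eq_0 add.commute)

lemma act_uminus_right: "act p (- q) = - act p q"
  using act_add_right[of p q "- q"] by (simp add: eq_neg_iff_add_eq_0 add.commute)

lemma act_diff_left: "act (p - p') q = act p q - act p' q"
  using act_add_left[of p "- p'" q] by (simp add: act_uminus_left)

lemma act_diff_right: "act p (q - q') = act p q - act p q'"
  using act_add_right[of p q "- q'"] by (simp add: act_uminus_right)

lemma act_sum_left: "act (sum f A) q = (\<Sum>a\<in>A. act (f a) q)"
  by (induction A rule: infinite_finite_induct) (auto simp: act_add_left)

lemma act_sum_right: "act p (sum f A) = (\<Sum>a\<in>A. act p (f a))"
  by (induction A rule: infinite_finite_induct) (auto simp: act_add_right)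

text \<open>Monomial operators shift the index of \<open>dcoef\<close>, and shifts add up; the rest
  is linearity in both operators.\<close>

lemma act_mult: "act (p * p') q = act p (act p' q)"
proof (induction p rule: poly_mapping_single_induct)
  case (single a c)
  show ?case
  proof (induction p' rule: poly_mapping_single_induct)
    case (single b d)
    show ?case
      by (rule dcoef_eqI) (simp add: mult_single act_single dcoef_pscale dcoef_pmono_op
        add.assoc add.commute add.left_commute)
  qed (simp_all add: distrib_left act_add_left act_add_right)
qed (simp_all add: distrib_right act_add_left)

lemma act_commute: "act p (act p' q) = act p' (act p q)"
  by (metis act_mult mult.commute)

lemma act_1 [simp]: "act 1 q = q"
proof -
  have "act (sing 0 1) q = q"
    by (rule dcoef_eqI) (simp add: act_single dcoef_pmono_op del: single_one)
  then show ?thesis by simp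
qed

lemma act_sign_left: "act ((- 1) ^ k * p) q = (- 1) ^ k * act p q"
  by (cases "even k") (simp_all add: act_uminus_left)

lemma act_sign_right: "act p ((- 1) ^ k * q) = (- 1) ^ k * act p q"
  by (cases "even k") (simp_all add: act_uminus_right)

lemma act_X_power: "act (X i ^ k) q = (pdiff i ^^ k) q"
  by (rule dcoef_eqI) (simp add: X_power act_single dcoef_pmono_op dcoef_pdiff_funpow)

lemma polys_dcoef: "p \<in> polys n \<longleftrightarrow> (\<forall>m. dcoef p m \<noteq> 0 \<longrightarrow> supp m \<subseteq> {1..n})"
  by (simp add: polys_iff dcoef_def)

text \<open>Differentiation only lowers exponents, so no new variable can appear.\<close>

lemma polys_act [intro]:
  assumes "q \<in> polys n" shows "act p q \<in> polys n"
  unfolding polys_dcoef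
proof (intro allI impI)
  fix m assume "dcoef (act p q) m \<noteq> 0"
  then have "\<exists>a. dcoef q (m + a) \<noteq> 0"
    by (rule contrapos_np) (simp add: dcoef_act)
  then obtain a where "dcoef q (m + a) \<noteq> 0" ..
  then have "supp (m + a) \<subseteq> {1..n}"
    using assms unfolding polys_dcoef by blast
  then show "supp m \<subseteq> {1..n}" by (simp add: supp_add_nat)
qed

section \<open>Permutations of the variables\<close>

lemma coef_map_key [simp]: "inj w \<Longrightarrow> coef (Poly_Mapping.map_key w m) i = coef m (w i)"
  by (simp add: map_key.rep_eq)

lemma map_key_inv_eq:
  fixes m m' :: "'a \<Rightarrow>\<^sub>0 'b::zero"
  assumes "bij w"
  shows "Poly_Mapping.map_key (inv_into UNIV w) m = m' \<longleftrightarrow> m = Poly_Mapping.map_key w m'"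
proof -
  have i: "inj w" "inj (inv_into UNIV w)" "\<And>x. w (inv_into UNIV w x) = x" "\<And>x. inv_into UNIV w (w x) = x"
    using assms by (auto simp: bij_is_inj bij_imp_bij_inv surj_f_inv_f bij_is_surj)
  show ?thesis
    by (auto simp: poly_mapping_eq_iff fun_eq_iff i) (metis i(3,4))+
qed

lemma prod_single_one:
  "finite A \<Longrightarrow> (\<Prod>i\<in>A. (sing (f i) 1 :: 'a::comm_monoid_add \<Rightarrow>\<^sub>0 'b::comm_semiring_1)) = sing (\<Sum>i\<in>A. f i) 1"
  by (induction A rule: finite_induct) (auto simp: mult_single)

text \<open>Pulling exponents back along \<open>w\<close> makes the action a reindexing of
  coefficients, and linearity and equivariance become comparisons of coefficients.\<close>

lemma coef_pperm:
  assumes w: "bij w"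
  shows "coef (pperm w p) m = coef p (Poly_Mapping.map_key w m)"
proof -
  have i: "inj (inv_into UNIV w)" "inj w" "\<And>x. inv_into UNIV w (w x) = x" "\<And>x. w (inv_into UNIV w x) = x"
    using w by (auto simp: bij_is_inj bij_imp_bij_inv surj_f_inv_f bij_is_surj)
  have mon: "(\<Prod>i\<in>supp k. X (w i) ^ coef k i) = sing (Poly_Mapping.map_key (inv_into UNIV w) k) 1" for k
  proof -
    have "(\<Sum>i\<in>supp k. sing (w i) (coef k i)) = Poly_Mapping.map_key (inv_into UNIV w) k"
    proof (rule poly_mapping_eqI)
      fix j
      have "coef (\<Sum>i\<in>supp k. sing (w i) (coef k i)) j = (\<Sum>i\<in>supp k. if i = inv_into UNIV w j then coef k i else 0)"
        unfolding lookup_sum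
        by (intro sum.cong) (auto simp: lookup_single when_def i)
      also have "\<dots> = coef k (inv_into UNIV w j)" by (auto simp: sum.delta in_keys_iff)
      finally show "coef (\<Sum>i\<in>supp k. sing (w i) (coef k i)) j = coef (Poly_Mapping.map_key (inv_into UNIV w) k) j"
        using i by simp
    qed
    then show ?thesis by (simp add: X_power prod_single_one)
  qed
  have "coef (pperm w p) m = (\<Sum>k\<in>supp p. if k = Poly_Mapping.map_key w m then coef p k else 0)"
    unfolding pperm_def mon lookup_sum
    by (intro sum.cong) (auto simp: pscale_single lookup_single when_def map_key_inv_eq[OF w])
  also have "\<dots> = coef p (Poly_Mapping.map_key w m)" by (auto simp: sum.delta in_keys_iff)
  finally show ?thesis .
qed

lemma pperm_add: "bij w \<Longrightarrow> pperm w (p + q) = pperm w p + pperm w q"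
  by (rule poly_mapping_eqI) (simp add: coef_pperm lookup_add)

lemma pperm_uminus: "bij w \<Longrightarrow> pperm w (- p) = - pperm w p"
  by (rule poly_mapping_eqI) (simp add: coef_pperm)

lemma pperm_sign: "bij w \<Longrightarrow> pperm w ((- 1) ^ k * p) = (- 1) ^ k * pperm w p"
  by (cases "even k") (auto simp: pperm_uminus)

lemma pperm_0 [simp]: "pperm w 0 = 0" by (simp add: pperm_def)

lemma pperm_sum: "bij w \<Longrightarrow> pperm w (sum f A) = (\<Sum>a\<in>A. pperm w (f a))"
  by (induction A rule: infinite_finite_induct) (auto simp: pperm_add)

lemma pperm_single:
  assumes "bij w" shows "pperm w (sing m c) = sing (Poly_Mapping.map_key (inv_into UNIV w) m) c"
  by (rule poly_mapping_eqI)
    (auto simp: coef_pperm[OF assms] lookup_single when_def map_key_inv_eq[OF assms])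

lemma pperm_mult:
  assumes "bij w" shows "pperm w (p * q) = pperm w p * pperm w q"
proof (induction p rule: poly_mapping_single_induct)
  case (single a c)
  have i: "inj (inv_into UNIV w)" using assms by (simp add: bij_imp_bij_inv bij_is_inj)
  show ?case
    by (induction q rule: poly_mapping_single_induct)
      (simp_all add: mult_single pperm_single assms map_key_plus i distrib_left pperm_add)
qed (simp_all add: distrib_right pperm_add assms)

lemma pperm_1: "bij w \<Longrightarrow> pperm w 1 = 1"
proof -
  assume w: "bij w"
  have "inj (inv_into UNIV w)" using w by (simp add: bij_imp_bij_inv bij_is_inj)
  then show ?thesis
    using pperm_single[OF w, of 0 1] by simp
qed

lemma pperm_prod: "bij w \<Longrightarrow> pperm w (prod f A) = (\<Prod>a\<in>A. pperm w (f a))"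
  by (induction A rule: infinite_finite_induct) (auto simp: pperm_mult pperm_1)

lemma pperm_power: "bij w \<Longrightarrow> pperm w (p ^ k) = pperm w p ^ k"
  by (induction k) (auto simp: pperm_mult pperm_1)

lemma pperm_X: "bij w \<Longrightarrow> pperm w (X i) = X (w i)"
proof -
  assume w: "bij w"
  have i: "inj (inv_into UNIV w)" "\<And>x. w (inv_into UNIV w x) = x" "\<And>x. inv_into UNIV w (w x) = x"
    using w by (auto simp: bij_is_inj bij_imp_bij_inv surj_f_inv_f bij_is_surj)
  have "Poly_Mapping.map_key (inv_into UNIV w) (sing i (1::nat)) = sing (w i) 1"
    using i by (intro poly_mapping_eqI) (auto simp: lookup_single when_def)
  then show ?thesis by (simp add: X_def pperm_single[OF w])
qed

lemma mfact_map_key: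
  assumes "bij w" shows "mfact (Poly_Mapping.map_key w m) = mfact m"
proof -
  have i: "inj w" "\<And>x. w (inv_into UNIV w x) = x" "\<And>x. inv_into UNIV w (w x) = x"
    using assms by (auto simp: bij_is_inj surj_f_inv_f bij_is_surj)
  have "supp m = w ` supp (Poly_Mapping.map_key w m)"
  proof (intro equalityI subsetI)
    fix x assume "x \<in> supp m"
    then have "inv_into UNIV w x \<in> supp (Poly_Mapping.map_key w m)" by (simp add: in_keys_iff i)
    then show "x \<in> w ` supp (Poly_Mapping.map_key w m)" by (metis i(2) imageI)
  qed (auto simp: in_keys_iff i)
  then show ?thesis
    unfolding mfact_def by (simp add: prod.reindex inj_on_subset[OF i(1)] i(1))
qed

lemma dcoef_pperm: "bij w \<Longrightarrow> dcoef (pperm w p) m = dcoef p (Poly_Mapping.map_key w m)"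
  by (simp add: dcoef_def coef_pperm mfact_map_key)

text \<open>Exponent shifts commute with reindexing and, by \<open>mfact_map_key\<close>, so does
  the passage to divided powers.\<close>

lemma pperm_act:
  assumes w: "bij w" shows "pperm w (act p q) = act (pperm w p) (pperm w q)"
proof (induction p rule: poly_mapping_single_induct)
  case (single a c)
  have i: "inj w" "inj (inv_into UNIV w)" "\<And>x. inv_into UNIV w (w x) = x"
    using w by (auto simp: bij_is_inj bij_imp_bij_inv)
  have "Poly_Mapping.map_key w (Poly_Mapping.map_key (inv_into UNIV w) a) = a"
    using i by (intro poly_mapping_eqI) simp
  then show ?case
    by (intro dcoef_eqI)
      (simp add: pperm_single w dcoef_pperm act_single dcoef_pscale dcoef_pmono_op map_key_plus i)
qed (simp_all add: act_add_left pperm_add w)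

lemma pperm_polys:
  assumes "w permutes {1..n}" "p \<in> polys n" shows "pperm w p \<in> polys n"
  unfolding polys_iff
proof (intro allI impI)
  fix m assume "coef (pperm w p) m \<noteq> 0"
  have w: "bij w" using assms(1) by (rule permutes_bij)
  have "coef p (Poly_Mapping.map_key w m) \<noteq> 0"
    using \<open>coef (pperm w p) m \<noteq> 0\<close> by (simp add: coef_pperm[OF w])
  then have s: "supp (Poly_Mapping.map_key w m) \<subseteq> {1..n}" using assms(2) by (simp add: polys_iff)
  show "supp m \<subseteq> {1..n}"
  proof
    fix j assume "j \<in> supp m"
    then have "inv_into UNIV w j \<in> supp (Poly_Mapping.map_key w m)"
      using w by (simp add: in_keys_iff bij_is_inj surj_f_inv_f bij_is_surj)
    then have "inv_into UNIV w j \<in> {1..n}" using s by blast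
    then show "j \<in> {1..n}" using permutes_in_image[OF assms(1), of "inv_into UNIV w j"] w
      by (simp add: surj_f_inv_f bij_is_surj)
  qed
qed

section \<open>Ideals and their codimension\<close>

lemma ideal_polys: "is_poly_ideal n K \<Longrightarrow> p \<in> K \<Longrightarrow> p \<in> polys n"
  by (auto simp: is_poly_ideal_def)

lemma ideal_0: "is_poly_ideal n K \<Longrightarrow> 0 \<in> K"
  by (auto simp: is_poly_ideal_def)

lemma ideal_add: "is_poly_ideal n K \<Longrightarrow> p \<in> K \<Longrightarrow> q \<in> K \<Longrightarrow> p + q \<in> K"
  by (auto simp: is_poly_ideal_def)

lemma ideal_mult: "is_poly_ideal n K \<Longrightarrow> p \<in> polys n \<Longrightarrow> q \<in> K \<Longrightarrow> p * q \<in> K"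
  by (auto simp: is_poly_ideal_def)

lemma ideal_mult_right: "is_poly_ideal n K \<Longrightarrow> p \<in> polys n \<Longrightarrow> q \<in> K \<Longrightarrow> q * p \<in> K"
  using ideal_mult[of n K p q] by (simp add: mult.commute)

lemma ideal_pscale: "is_poly_ideal n K \<Longrightarrow> p \<in> K \<Longrightarrow> pscale c p \<in> K"
  unfolding pscale_def by (rule ideal_mult) auto

lemma ideal_uminus: "is_poly_ideal n K \<Longrightarrow> p \<in> K \<Longrightarrow> - p \<in> K"
  using ideal_pscale[of n K p "-1"] by simp

lemma ideal_diff: "is_poly_ideal n K \<Longrightarrow> p \<in> K \<Longrightarrow> q \<in> K \<Longrightarrow> p - q \<in> K"
  using ideal_add[of n K p "- q"] ideal_uminus by simp

lemma ideal_sum: "is_poly_ideal n K \<Longrightarrow> (\<And>i. i \<in> A \<Longrightarrow> f i \<in> K) \<Longrightarrow> sum f A \<in> K"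
  by (induction A rule: infinite_finite_induct) (auto simp: ideal_0 ideal_add)

lemma ideal_subspace: "is_poly_ideal n K \<Longrightarrow> P.subspace K"
  by (rule P.subspaceI) (auto simp: ideal_0 ideal_add ideal_pscale)

lemma polys_ideal: "is_poly_ideal n (polys n)"
  by (auto simp: is_poly_ideal_def)

lemma ideal_Inter:
  assumes "\<And>T. T \<in> F \<Longrightarrow> is_poly_ideal n T" "F \<noteq> {}"
  shows "is_poly_ideal n (\<Inter>F)"
  using assms unfolding is_poly_ideal_def by blast

lemma ideal_hull: "G \<subseteq> polys n \<Longrightarrow> is_poly_ideal n (is_poly_ideal n hull G)"
  unfolding hull_def by (rule ideal_Inter) (use polys_ideal in auto)

lemma ideal_colon:
  assumes "is_poly_ideal n K" "a \<in> polys n"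
  shows "is_poly_ideal n (colon n K a)"
  using assms unfolding is_poly_ideal_def colon_def
  by (auto simp: distrib_right mult.assoc)

lemma colon_superset: "is_poly_ideal n K \<Longrightarrow> a \<in> polys n \<Longrightarrow> K \<subseteq> colon n K a"
  by (auto simp: colon_def ideal_polys ideal_mult_right)

lemma colon_mult: "a \<in> polys n \<Longrightarrow> colon n K (a * b) = colon n (colon n K b) a"
  by (auto simp: colon_def mult.assoc)

lemma colon_1: "is_poly_ideal n K \<Longrightarrow> colon n K 1 = K"
  by (auto simp: colon_def ideal_polys)

definition ideal_adjoin :: "nat \<Rightarrow> cpoly set \<Rightarrow> cpoly \<Rightarrow> cpoly set" where
  "ideal_adjoin n K a = {k + q * a | k q. k \<in> K \<and> q \<in> polys n}"

lemma ideal_ideal_adjoin: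
  assumes K: "is_poly_ideal n K" and a: "a \<in> polys n"
  shows "is_poly_ideal n (ideal_adjoin n K a)"
  unfolding is_poly_ideal_def
proof (intro conjI ballI subsetI)
  fix x assume "x \<in> ideal_adjoin n K a"
  then show "x \<in> polys n" using a by (auto simp: ideal_adjoin_def ideal_polys[OF K])
next
  have "0 = 0 + 0 * a \<and> 0 \<in> K \<and> 0 \<in> polys n" using ideal_0[OF K] by simp
  then show "0 \<in> ideal_adjoin n K a" unfolding ideal_adjoin_def by blast
next
  fix s t assume "s \<in> ideal_adjoin n K a" "t \<in> ideal_adjoin n K a"
  then obtain k q k' q' where *: "s = k + q * a" "t = k' + q' * a" "k \<in> K" "k' \<in> K" "q \<in> polys n" "q' \<in> polys n"
    by (auto simp: ideal_adjoin_def)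
  then have "s + t = (k + k') + (q + q') * a" by (simp add: algebra_simps)
  moreover have "k + k' \<in> K" "q + q' \<in> polys n" using * K by (auto intro: ideal_add)
  ultimately show "s + t \<in> ideal_adjoin n K a" unfolding ideal_adjoin_def by blast
next
  fix r t assume r: "r \<in> polys n" and "t \<in> ideal_adjoin n K a"
  then obtain k q where *: "t = k + q * a" "k \<in> K" "q \<in> polys n" by (auto simp: ideal_adjoin_def)
  then have "r * t = r * k + (r * q) * a" by (simp add: algebra_simps)
  moreover have "r * k \<in> K" "r * q \<in> polys n" using * K r by (auto intro: ideal_mult)
  ultimately show "r * t \<in> ideal_adjoin n K a" unfolding ideal_adjoin_def by blast
qed

lemma ideal_adjoin_superset: "K \<subseteq> ideal_adjoin n K a"
proof
  fix k assume "k \<in> K"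
  moreover have "k = k + 0 * a" by simp
  ultimately show "k \<in> ideal_adjoin n K a" unfolding ideal_adjoin_def using polys_0 by blast
qed

lemma ideal_adjoin_mem: "is_poly_ideal n K \<Longrightarrow> a \<in> ideal_adjoin n K a"
proof -
  assume K: "is_poly_ideal n K"
  have "a = 0 + 1 * a" by simp
  then show ?thesis unfolding ideal_adjoin_def using ideal_0[OF K] polys_1 by blast
qed

text \<open>A finite set of representatives replaces the quotient space. Lower bounds on a
  codimension are expressed as negations of this predicate.\<close>

definition codim_le :: "nat \<Rightarrow> cpoly set \<Rightarrow> nat \<Rightarrow> bool" where
  "codim_le n K N \<longleftrightarrow> (\<exists>S. finite S \<and> card S \<le> N \<and> S \<subseteq> polys n \<and>
     (\<forall>p \<in> polys n. \<exists>q \<in> P.span S. p - q \<in> K))"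

lemma span_mult_image:
  assumes "x \<in> P.span S" shows "x * a \<in> P.span ((\<lambda>s. s * a) ` S)"
  using assms
proof (induction rule: P.span_induct_alt)
  case base
  then show ?case by (simp add: P.span_zero)
next
  case (step c s x)
  have "(pscale c s + x) * a = pscale c (s * a) + x * a"
    by (simp add: distrib_right pscale_mult_left)
  then show ?case using step by (auto intro!: P.span_add P.span_scale intro: P.span_base)
qed

text \<open>Multiplication by \<open>a\<close> embeds \<open>\<complex>[x]/(K:a)\<close> into \<open>\<complex>[x]/K\<close> with cokernel \<open>\<complex>[x]/(K + (a))\<close>.\<close>

lemma codim_le_colon:
  assumes K: "is_poly_ideal n K" and a: "a \<in> polys n"
    and 1: "codim_le n (colon n K a) N1" and 2: "codim_le n (ideal_adjoin n K a) N2"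
  shows "codim_le n K (N1 + N2)"
proof -
  obtain S1 where S1: "finite S1" "card S1 \<le> N1" "S1 \<subseteq> polys n"
      "\<And>p. p \<in> polys n \<Longrightarrow> \<exists>q \<in> P.span S1. p - q \<in> colon n K a"
    using 1 unfolding codim_le_def by blast
  obtain S2 where S2: "finite S2" "card S2 \<le> N2" "S2 \<subseteq> polys n"
      "\<And>p. p \<in> polys n \<Longrightarrow> \<exists>q \<in> P.span S2. p - q \<in> ideal_adjoin n K a"
    using 2 unfolding codim_le_def by blast
  let ?S = "(\<lambda>s. s * a) ` S1 \<union> S2"
  have "card ?S \<le> N1 + N2"
    using card_Un_le[of "(\<lambda>s. s * a) ` S1" S2] card_image_le[OF S1(1), of "\<lambda>s. s * a"] S1 S2 by linarith
  moreover have "?S \<subseteq> polys n" using S1 S2 a by auto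
  moreover have "\<exists>q \<in> P.span ?S. p - q \<in> K" if p: "p \<in> polys n" for p
  proof -
    obtain q2 where q2: "q2 \<in> P.span S2" "p - q2 \<in> ideal_adjoin n K a" using S2(4)[OF p] by blast
    then obtain k r where kr: "p - q2 = k + r * a" "k \<in> K" "r \<in> polys n" by (auto simp: ideal_adjoin_def)
    obtain q1 where q1: "q1 \<in> P.span S1" "r - q1 \<in> colon n K a" using S1(4)[OF kr(3)] by blast
    have "p - (q1 * a + q2) = k + (r - q1) * a" using kr(1) by (simp add: algebra_simps)
    also have "\<dots> \<in> K" using q1(2) kr(2) K by (auto simp: colon_def intro: ideal_add)
    finally have "p - (q1 * a + q2) \<in> K" .
    moreover have "q1 * a + q2 \<in> P.span ?S"
      using span_mult_image[OF q1(1), of a] q2(1) P.span_mono[of "(\<lambda>s. s * a) ` S1" ?S]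
        P.span_mono[of S2 ?S] by (intro P.span_add) auto
    ultimately show ?thesis by blast
  qed
  ultimately show ?thesis unfolding codim_le_def using S1(1) S2(1) by (intro exI[of _ ?S]) auto
qed

text \<open>An element of \<open>K'\<close> outside \<open>K\<close> yields a nonzero combination of
  the representatives that vanishes modulo \<open>K'\<close>, and with it one representative can be
  eliminated.\<close>

lemma codim_le_strict:
  assumes K: "P.subspace K" and K': "P.subspace K'" and sub: "K \<subset> K'" "K' \<subseteq> polys n"
    and N: "codim_le n K N"
  shows "0 < N \<and> codim_le n K' (N - 1)"
proof -
  obtain S where S: "finite S" "card S \<le> N" "S \<subseteq> polys n"
      "\<And>p. p \<in> polys n \<Longrightarrow> \<exists>q \<in> P.span S. p - q \<in> K"
    using N unfolding codim_le_def by blast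
  obtain c where c: "c \<in> K'" "c \<notin> K" using sub by blast
  then obtain q where q: "q \<in> P.span S" "c - q \<in> K" using S(4) sub by blast
  have q': "q \<in> K'"
    using P.subspace_diff[OF K' c(1), of "c - q"] q(2) sub by auto
  have "q \<notin> K" using P.subspace_add[OF K q(2), of q] c(2) by auto
  obtain u where u: "q = (\<Sum>s\<in>S. pscale (u s) s)"
    using q(1) unfolding P.span_finite[OF S(1)] by auto
  have "\<exists>s\<in>S. u s \<noteq> 0"
  proof (rule ccontr)
    assume "\<not> (\<exists>s\<in>S. u s \<noteq> 0)"
    then have "q = 0" unfolding u by (intro sum.neutral) auto
    then show False using \<open>q \<notin> K\<close> P.subspace_0[OF K] by simp
  qed
  then obtain s where s: "s \<in> S" "u s \<noteq> 0" by blast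
  let ?S = "S - {s}"
  have "card ?S \<le> N - 1" "0 < N" using S s by (auto simp: card_gt_0_iff intro: Nat.gr0I)
  moreover have "\<exists>r \<in> P.span ?S. p - r \<in> K'" if p: "p \<in> polys n" for p
  proof -
    obtain q1 where q1: "q1 \<in> P.span S" "p - q1 \<in> K" using S(4)[OF p] by blast
    obtain v where v: "q1 = (\<Sum>s\<in>S. pscale (v s) s)"
      using q1(1) unfolding P.span_finite[OF S(1)] by auto
    \<comment> \<open>The multiple of \<open>q\<close> cancels the coefficient of \<open>s\<close>;
      as \<open>q\<close> lies in \<open>K'\<close>, the class modulo \<open>K'\<close> is
      unchanged.\<close>
    let ?r = "q1 - pscale (v s / u s) q"
    have "?r = (\<Sum>t\<in>S. pscale (v t - v s / u s * u t) t)"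
      unfolding u v by (simp add: P.scale_sum_right P.scale_left_diff_distrib sum_subtractf)
    also have "\<dots> = (\<Sum>t\<in>?S. pscale (v t - v s / u s * u t) t)"
      using s S(1) by (subst sum.remove[of S s]) auto
    also have "\<dots> \<in> P.span ?S" by (intro P.span_sum P.span_scale P.span_base)
    finally have "?r \<in> P.span ?S" .
    moreover have "p - ?r \<in> K'"
    proof -
      have "p - ?r = (p - q1) + pscale (v s / u s) q" by simp
      also have "\<dots> \<in> K'" using q1(2) q' sub K' by (auto intro: P.subspace_add P.subspace_scale)
      finally show ?thesis .
    qed
    ultimately show ?thesis by blast
  qed
  ultimately show ?thesis unfolding codim_le_def using S by (auto intro!: exI[of _ ?S])
qed

text \<open>One factor is split off at a time: the colon ideal by \<open>l a\<close> contains the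
  product of the other factors, and the ideal enlarged by \<open>l a\<close> is bounded by
  assumption. The assumption ranges over all ideals above \<open>K\<close> because the induction
  passes to the colon ideal.\<close>

lemma codim_le_split:
  assumes "finite A" "is_poly_ideal n K" "prod l A \<in> K" "\<And>a. a \<in> A \<Longrightarrow> l a \<in> polys n"
    and "\<And>a K'. a \<in> A \<Longrightarrow> is_poly_ideal n K' \<Longrightarrow> K \<subseteq> K' \<Longrightarrow> l a \<in> K' \<Longrightarrow> codim_le n K' N"
  shows "codim_le n K (card A * N)"
  using assms
proof (induction A arbitrary: K rule: finite_induct)
  case empty
  then have "p \<in> K" if "p \<in> polys n" for p using ideal_mult[of n K p 1] that by simp
  then show ?case unfolding codim_le_def by (intro exI[of _ "{}"]) auto
next
  case (insert a A)
  have la: "l a \<in> polys n" using insert by auto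
  have "codim_le n (colon n K (l a)) (card A * N)"
  proof (rule insert.IH)
    show "is_poly_ideal n (colon n K (l a))" using insert la by (intro ideal_colon)
    show "prod l A \<in> colon n K (l a)"
      using insert by (auto simp: colon_def mult.commute)
    show "l b \<in> polys n" if "b \<in> A" for b using insert.prems(3) that by simp
    show "codim_le n K' N"
      if "b \<in> A" "is_poly_ideal n K'" "colon n K (l a) \<subseteq> K'" "l b \<in> K'" for b K'
      using insert.prems(4)[of b K'] that colon_superset[OF insert.prems(1) la] by simp
  qed
  moreover have "codim_le n (ideal_adjoin n K (l a)) N"
    using insert la by (intro insert.prems(4)[of a] ideal_ideal_adjoin ideal_adjoin_superset ideal_adjoin_mem) auto
  ultimately have "codim_le n K (card A * N + N)" using insert la by (intro codim_le_colon)
  then show ?case using insert by (simp add: add.commute)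
qed

text \<open>Iterated splitting leaves only ideals that contain one factor of every product;
  geometrically, one component is chosen on each hypersurface.\<close>

lemma codim_le_multi_split:
  assumes "finite J" "is_poly_ideal n K" "\<And>j. j \<in> J \<Longrightarrow> finite (A j)"
    "\<And>j. j \<in> J \<Longrightarrow> prod (l j) (A j) \<in> K" "\<And>j a. j \<in> J \<Longrightarrow> a \<in> A j \<Longrightarrow> l j a \<in> polys n"
    and "\<And>K'. is_poly_ideal n K' \<Longrightarrow> K \<subseteq> K' \<Longrightarrow> (\<And>j. j \<in> J \<Longrightarrow> \<exists>a\<in>A j. l j a \<in> K')
           \<Longrightarrow> codim_le n K' N"
  shows "codim_le n K ((\<Prod>j\<in>J. card (A j)) * N)"
  using assms
proof (induction J arbitrary: K rule: finite_induct)
  case empty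
  then show ?case by simp
next
  case (insert j J)
  have "codim_le n K (card (A j) * ((\<Prod>j\<in>J. card (A j)) * N))"
  proof (rule codim_le_split[where l = "l j"])
    fix a K' assume a: "a \<in> A j" and K': "is_poly_ideal n K'" "K \<subseteq> K'" "l j a \<in> K'"
    show "codim_le n K' ((\<Prod>j\<in>J. card (A j)) * N)"
    proof (rule insert.IH[OF K'(1)])
      fix K'' assume K'': "is_poly_ideal n K''" "K' \<subseteq> K''" "\<And>j. j \<in> J \<Longrightarrow> \<exists>a\<in>A j. l j a \<in> K''"
      show "codim_le n K'' N"
      proof (rule insert.prems(5)[OF K''(1)])
        show "K \<subseteq> K''" using K'(2) K''(2) by simp
        fix i assume "i \<in> insert j J"
        then show "\<exists>a\<in>A i. l i a \<in> K''" using K''(2) K''(3)[of i] K'(3) a by auto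
      qed
    next
      fix i assume i: "i \<in> J"
      show "finite (A i)" using insert.prems(2) i by simp
      show "prod (l i) (A i) \<in> K'" using insert.prems(3)[of i] K'(2) i by auto
      show "l i a \<in> polys n" if "a \<in> A i" for a using insert.prems(4)[of i a] i that by simp
    qed
  next
    show "finite (A j)" "prod (l j) (A j) \<in> K" using insert.prems(2,3)[of j] by simp_all
    show "l j a \<in> polys n" if "a \<in> A j" for a using insert.prems(4)[of j a] that by simp
  qed (rule insert.prems(1))
  then show ?case using insert by (simp add: mult.assoc)
qed

section \<open>The ideals \<open>(I\<^sub>n : f\<^sub>J)\<close>\<close>

definition psum :: "nat \<Rightarrow> nat \<Rightarrow> cpoly" where
  "psum n k = (\<Sum>i=1..n. X i ^ k)"

lemma psum_polys [simp]: "psum n k \<in> polys n" unfolding psum_def by (intro polys_sum polys_power polys_X)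

text \<open>Index \<open>0\<close> stands for the zero form, so that the factor \<open>X j\<close> of \<open>fJ\<close> is one more
  difference \<open>X j - X0 k\<close>.\<close>

definition X0 :: "nat \<Rightarrow> cpoly" where
  "X0 k = (if k = 0 then 0 else X k)"

lemma X0_polys: "k \<le> n \<Longrightarrow> X0 k \<in> polys n" by (simp add: X0_def)

text \<open>Multiplying out the factors \<open>X i - X a\<close> turns the sum over \<open>i\<close>
  into a combination of power sums of degrees \<open>e\<close> to \<open>e + card A\<close>. The
  induction multiplies out one factor, which raises \<open>e\<close> by one in one of the two
  resulting terms.\<close>

lemma psum_combination_mem:
  assumes K: "is_poly_ideal n K" and "finite A" "A \<subseteq> {1..n}"
    and "\<And>k. e \<le> k \<Longrightarrow> k \<le> e + card A \<Longrightarrow> psum n k \<in> K"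
  shows "(\<Sum>i=1..n. X i ^ e * (\<Prod>a\<in>A. X i - X a)) \<in> K"
  using assms(2-)
proof (induction A arbitrary: e rule: finite_induct)
  case empty
  then show ?case using empty(2)[of e] by (simp add: psum_def)
next
  case (insert a A)
  have "(\<Sum>i=1..n. X i ^ e * (\<Prod>a\<in>insert a A. X i - X a))
      = (\<Sum>i=1..n. X i ^ Suc e * (\<Prod>a\<in>A. X i - X a)) - X a * (\<Sum>i=1..n. X i ^ e * (\<Prod>a\<in>A. X i - X a))"
    using insert by (simp add: sum_subtractf sum_distrib_left algebra_simps)
  moreover have "(\<Sum>i=1..n. X i ^ Suc e * (\<Prod>a\<in>A. X i - X a)) \<in> K"
    using insert by (intro insert.IH) auto
  moreover have "(\<Sum>i=1..n. X i ^ e * (\<Prod>a\<in>A. X i - X a)) \<in> K"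
    using insert by (intro insert.IH) auto
  ultimately show ?case
    using K insert.prems by (auto intro!: ideal_diff ideal_mult)
qed

lemma ideal_prod_cong:
  assumes K: "is_poly_ideal n K" and ab: "a - b \<in> K" "a \<in> polys n" "b \<in> polys n"
    and "finite Z" "\<And>z. z \<in> Z \<Longrightarrow> c z \<in> polys n"
  shows "a * (\<Prod>z\<in>Z. a - c z) - b * (\<Prod>z\<in>Z. b - c z) \<in> K"
  using assms(5,6)
proof (induction Z rule: finite_induct)
  case empty
  then show ?case using ab by simp
next
  case (insert z Z)
  let ?A = "a * (\<Prod>z\<in>Z. a - c z)" and ?B = "b * (\<Prod>z\<in>Z. b - c z)"
  have "a * (\<Prod>z\<in>insert z Z. a - c z) - b * (\<Prod>z\<in>insert z Z. b - c z)
      = (a - c z) * (?A - ?B) + ?B * (a - b)"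
    using insert by (simp add: algebra_simps)
  moreover have "(a - c z) * (?A - ?B) \<in> K" "?B * (a - b) \<in> K"
    using insert ab by (auto intro!: ideal_mult[OF K])
  ultimately show ?case using K by (auto intro: ideal_add)
qed

lemma sub_const_mem:
  assumes K: "is_poly_ideal n K" and X: "\<And>i. i \<in> {1..n} \<Longrightarrow> X i \<in> K" and p: "p \<in> polys n"
  shows "p - sing 0 (coef p 0) \<in> K"
proof -
  let ?S = "insert 0 (supp p)"
  have "p = (\<Sum>m\<in>?S. sing m (coef p m))"
    by (rule sum_single_coef[symmetric]) auto
  also have "\<dots> = sing 0 (coef p 0) + (\<Sum>m\<in>supp p - {0}. sing m (coef p m))"
    by (simp add: sum.insert_remove)
  finally have "p - sing 0 (coef p 0) = (\<Sum>m\<in>supp p - {0}. sing m (coef p m))"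
    by (simp add: algebra_simps)
  also have "\<dots> \<in> K"
  proof (rule ideal_sum[OF K])
    fix m assume m: "m \<in> supp p - {0}"
    then obtain i where i: "i \<in> supp m" by (metis Diff_iff all_not_in_conv keys_eq_empty singletonI)
    have sm: "supp m \<subseteq> {1..n}" using m p by (auto simp: polys_def)
    have "m = (m - sing i 1) + sing i 1"
      using i by (intro poly_mapping_eqI) (auto simp: lookup_add lookup_minus lookup_single when_def in_keys_iff)
    then have "sing m (coef p m) = sing (m - sing i 1) (coef p m) * X i"
      by (simp add: X_def mult_single)
    moreover have "supp (m - sing i 1) \<subseteq> {1..n}"
      using sm by (auto simp: in_keys_iff lookup_minus)
    ultimately show "sing m (coef p m) \<in> K"
      using X[of i] i sm K by (auto intro!: ideal_mult simp: polys_single)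
  qed
  finally show ?thesis .
qed

text \<open>Modulo \<open>K\<close> every variable is 0 or some \<open>X y\<close> with
  \<open>y \<in> Y\<close>. Fix \<open>y\<close> and let q(t) be t times the product of all t -
  \<open>X z\<close> with z in Y, z \<noteq> y. The power sums put the sum of q over all variables
  into \<open>K\<close>, but only the variables identified with \<open>X y\<close> contribute.
  Dividing by their number gives q(\<open>X y\<close>) \<in> \<open>K\<close>. This is a product of
  \<open>card Y\<close> linear forms, each identifying \<open>X y\<close> with 0 or with another
  \<open>X z\<close>; induction then yields the factorial.\<close>

lemma codim_le_identified:
  assumes "is_poly_ideal n K" "Y \<subseteq> {1..n}"
    and "\<And>i. i \<in> {1..n} \<Longrightarrow> \<exists>y\<in>insert 0 Y. X i - X0 y \<in> K"
    and "\<And>k. 1 \<le> k \<Longrightarrow> k \<le> card Y \<Longrightarrow> psum n k \<in> K"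
  shows "codim_le n K (fact (card Y))"
  using assms
proof (induction "card Y" arbitrary: Y K)
  case 0
  then have "Y = {}" using finite_subset[OF \<open>Y \<subseteq> {1..n}\<close>] by auto
  then have "X i \<in> K" if "i \<in> {1..n}" for i using 0(4)[OF that] by (auto simp: X0_def)
  then have "p - sing 0 (coef p 0) \<in> K" if "p \<in> polys n" for p
    using sub_const_mem[OF 0(2) _ that] by blast
  moreover have "sing 0 c \<in> P.span {1}" for c
  proof -
    have "sing 0 c = pscale c 1" by (simp add: pscale_def)
    then show ?thesis by (auto intro: P.span_scale P.span_base)
  qed
  ultimately show ?case unfolding codim_le_def \<open>Y = {}\<close> by (intro exI[of _ "{1}"]) auto
next
  case (Suc m)
  note K = \<open>is_poly_ideal n K\<close>
  have fin: "finite Y" using finite_subset[OF \<open>Y \<subseteq> {1..n}\<close>] by auto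
  obtain y where y: "y \<in> Y" using Suc by fastforce
  let ?Z = "Y - {y}"
  have Z: "card ?Z = m" "?Z \<subseteq> {1..n}" "finite ?Z" using Suc y fin by auto
  have y1: "y \<in> {1..n}" using y Suc by blast
  obtain f where f: "\<And>i. i \<in> {1..n} \<Longrightarrow> f i \<in> insert 0 Y \<and> X i - X0 (f i) \<in> K"
    using Suc.prems(3) by metis
  \<comment> \<open>Changing the choice at \<open>y\<close> makes \<open>y\<close> represent itself,
    so that the number of variables identified with \<open>X y\<close> is not zero.\<close>
  define g where "g i = (if i = y then y else f i)" for i
  have g: "g i \<in> insert 0 Y" and gK: "X i - X0 (g i) \<in> K" if "i \<in> {1..n}" for i
    using f[OF that] y that ideal_0[OF K] by (auto simp: g_def X0_def)
  let ?q = "\<lambda>t. t * (\<Prod>z\<in>?Z. t - X z)"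
  have "?q (X y) \<in> K"
  proof -
    \<comment> \<open>With \<open>e = 1\<close> the degrees run from 1 to
      \<open>1 + card ?Z\<close>, which is \<open>card Y\<close>.\<close>
    have s: "(\<Sum>i=1..n. ?q (X i)) \<in> K"
      using psum_combination_mem[OF K Z(3,2), of 1] Suc Z by simp
    have d: "?q (X i) - ?q (X0 (g i)) \<in> K" if "i \<in> {1..n}" for i
      using that g[OF that] gK[OF that] Suc.prems(2) Z
      by (intro ideal_prod_cong[OF K] polys_X X0_polys) auto
    have q0: "?q (X0 (g i)) = (if g i = y then ?q (X y) else 0)" if i: "i \<in> {1..n}" for i
    proof -
      consider "g i = y" | "g i = 0" "g i \<noteq> y" | "g i \<in> ?Z"
        using g[OF i] by (cases "g i = y"; cases "g i = 0") auto
      then show ?thesis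
      proof cases
        case 1
        then show ?thesis using y1 by (simp add: X0_def)
      next
        case 2
        then show ?thesis by (simp add: X0_def)
      next
        case 3
        then have "X0 (g i) = X (g i)" using Z by (auto simp: X0_def)
        then have "(\<Prod>z\<in>?Z. X0 (g i) - X z) = 0" using 3 Z by (auto simp: prod_zero_iff)
        then show ?thesis using 3 by simp
      qed
    qed
    have "(\<Sum>i=1..n. ?q (X0 (g i))) = (\<Sum>i=1..n. ?q (X i)) - (\<Sum>i=1..n. ?q (X i) - ?q (X0 (g i)))"
      by (simp add: sum_subtractf)
    also have "\<dots> \<in> K" by (rule ideal_diff[OF K s]) (rule ideal_sum[OF K d])
    finally have "(\<Sum>i=1..n. ?q (X0 (g i))) \<in> K" .
    moreover have "(\<Sum>i=1..n. ?q (X0 (g i))) = (\<Sum>i=1..n. if g i = y then ?q (X y) else 0)"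
      by (rule sum.cong[OF refl]) (rule q0)
    ultimately have "(\<Sum>i=1..n. if g i = y then ?q (X y) else 0) \<in> K" by simp
    moreover have "(\<Sum>i=1..n. if g i = y then ?q (X y) else 0)
       = pscale (of_nat (card {i\<in>{1..n}. g i = y})) (?q (X y))"
      by (subst sum.inter_filter[symmetric]) (simp_all add: pscale_def)
    moreover define c where "c = card {i\<in>{1..n}. g i = y}"
    ultimately have "pscale (of_nat c) (?q (X y)) \<in> K" by simp
    then have "pscale (1 / of_nat c) (pscale (of_nat c) (?q (X y))) \<in> K" by (rule ideal_pscale[OF K])
    moreover have "c \<noteq> 0" using y1 by (auto simp: g_def c_def)
    ultimately show ?thesis by simp
  qed
  moreover have "?q (X y) = (\<Prod>z\<in>insert 0 ?Z. X y - X0 z)"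
    using Z by (subst prod.insert) (auto simp: X0_def intro!: prod.cong)
  ultimately have "(\<Prod>z\<in>insert 0 ?Z. X y - X0 z) \<in> K" by simp
  then have "codim_le n K (card (insert 0 ?Z) * fact m)"
  proof (rule codim_le_split[rotated 2])
    fix z K' assume z: "z \<in> insert 0 ?Z" and K': "is_poly_ideal n K'" "K \<subseteq> K'" "X y - X0 z \<in> K'"
    have "codim_le n K' (fact (card ?Z))"
    proof (rule Suc.hyps(1)[OF _ K'(1)])
      fix i assume i: "i \<in> {1..n}"
      show "\<exists>w\<in>insert 0 ?Z. X i - X0 w \<in> K'"
      proof (cases "g i = y")
        case True
        then have "X i - X y \<in> K'" using gK[OF i] K' y1 by (auto simp: X0_def)
        then have "(X i - X y) + (X y - X0 z) \<in> K'" using K' by (intro ideal_add)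
        then show ?thesis using z by (intro bexI[of _ z]) auto
      next
        case False
        then show ?thesis using g[OF i] gK[OF i] K' by blast
      qed
    qed (use Z Suc K' in auto)
    then show "codim_le n K' (fact m)" using Z by simp
  qed (use K Z y1 in \<open>auto intro!: X0_polys polys_diff\<close>)
  moreover have "card (insert 0 ?Z) = Suc m"
    using Z by (subst card_insert_disjoint) auto
  ultimately show ?case using \<open>Suc m = card Y\<close> by (metis fact_Suc of_nat_id)
qed

text \<open>\<open>EJ n J\<close> turns out to be \<open>(I\<^sub>n : f\<^sub>J)\<close>.  Its generators form a complete intersection, and
  \<open>EJ_codim n J\<close> is the product of their degrees.\<close>

definition gJ :: "nat set \<Rightarrow> nat \<Rightarrow> cpoly" where
  "gJ J j = (\<Prod>k\<in>{1..<j} - J. X j - X k)"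

definition EJ :: "nat \<Rightarrow> nat set \<Rightarrow> cpoly set" where
  "EJ n J = is_poly_ideal n hull (psum n ` {1..n - card J} \<union> gJ J ` J)"

definition EJ_codim :: "nat \<Rightarrow> nat set \<Rightarrow> nat" where
  "EJ_codim n J = (\<Prod>j\<in>J. card ({1..<j} - J)) * fact (n - card J)"

lemma gJ_polys: "j \<in> {1..n} \<Longrightarrow> gJ J j \<in> polys n"
  unfolding gJ_def by (intro polys_prod polys_diff polys_X) auto

lemma EJ_ideal:
  assumes "J \<subseteq> {1..n}" shows "is_poly_ideal n (EJ n J)"
proof -
  have "gJ J j \<in> polys n" if "j \<in> J" for j using assms that by (intro gJ_polys) auto
  then show ?thesis unfolding EJ_def by (intro ideal_hull) auto
qed

lemma EJ_psum: "1 \<le> k \<Longrightarrow> k \<le> n - card J \<Longrightarrow> psum n k \<in> EJ n J"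
  unfolding EJ_def by (rule hull_inc) auto

lemma EJ_gJ: "j \<in> J \<Longrightarrow> gJ J j \<in> EJ n J"
  unfolding EJ_def by (rule hull_inc) auto

lemma EJ_least:
  "is_poly_ideal n K \<Longrightarrow> (\<And>k. 1 \<le> k \<Longrightarrow> k \<le> n - card J \<Longrightarrow> psum n k \<in> K) \<Longrightarrow>
    (\<And>j. j \<in> J \<Longrightarrow> gJ J j \<in> K) \<Longrightarrow> EJ n J \<subseteq> K"
  unfolding EJ_def by (rule hull_minimal) auto

lemma card_Compl_interval: "J \<subseteq> {1..n} \<Longrightarrow> card ({1..n} - J) = n - card J"
  by (simp add: card_Diff_subset finite_subset)

lemmas card_Compl_interval_simp = card_Compl_interval[unfolded One_nat_def]

text \<open>A factor of \<open>gJ J j\<close> identifies \<open>X j\<close> with some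
  \<open>X k\<close>, \<open>k \<notin> J\<close>. After one such choice for every
  \<open>j \<in> J\<close> only the variables outside \<open>J\<close> remain, and the power sums
  account for \<open>fact (n - card J)\<close>.\<close>

lemma EJ_codim_le:
  assumes J: "J \<subseteq> {1..n}" shows "codim_le n (EJ n J) (EJ_codim n J)"
  unfolding EJ_codim_def
proof (rule codim_le_multi_split[where l = "\<lambda>j k. X j - X k"])
  show "finite J" using J by (rule finite_subset) auto
  show "is_poly_ideal n (EJ n J)" by (rule EJ_ideal[OF J])
  show "(\<Prod>k\<in>{1..<j} - J. X j - X k) \<in> EJ n J" if "j \<in> J" for j
    using EJ_gJ[OF that] by (simp add: gJ_def)
  show "X j - X a \<in> polys n" if "j \<in> J" "a \<in> {1..<j} - J" for j a
    using that J by (intro polys_diff polys_X) force+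
  fix K' assume K': "is_poly_ideal n K'" "EJ n J \<subseteq> K'" "\<And>j. j \<in> J \<Longrightarrow> \<exists>k\<in>{1..<j} - J. X j - X k \<in> K'"
  have "codim_le n K' (fact (card ({1..n} - J)))"
  proof (rule codim_le_identified[OF K'(1)])
    fix i assume i: "i \<in> {1..n}"
    show "\<exists>y\<in>insert 0 ({1..n} - J). X i - X0 y \<in> K'"
    proof (cases "i \<in> J")
      case True
      then obtain k where "k \<in> {1..<i} - J" "X i - X k \<in> K'" using K' by blast
      then show ?thesis using i by (intro bexI[of _ k]) (auto simp: X0_def)
    next
      case False
      then show ?thesis using i ideal_0[OF K'(1)] by (intro bexI[of _ i]) (auto simp: X0_def)
    qed
  next
    fix k assume "1 \<le> k" "k \<le> card ({1..n} - J)"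
    then show "psum n k \<in> K'" using EJ_psum[of k n J] K'(2) J by (auto simp: card_Compl_interval_simp)
  qed auto
  then show "codim_le n K' (fact (n - card J))" using J by (simp add: card_Compl_interval_simp)
qed auto

text \<open>The factor of \<open>fJ\<close> belonging to \<open>j\<close>, written as a product of
  differences so that \<open>codim_le_multi_split\<close> applies to it as it does to the
  generators.\<close>

definition fj :: "nat \<Rightarrow> nat \<Rightarrow> cpoly" where
  "fj n j = (\<Prod>k\<in>insert 0 {j+1..n}. X j - X0 k)"

lemma fj_eq: "fj n j = X j * (\<Prod>i=j+1..n. X j - X i)"
  unfolding fj_def by (subst prod.insert) (auto simp: X0_def intro!: prod.cong)

lemma fJ_eq: "fJ n J = (\<Prod>j\<in>J. fj n j)"
  by (simp add: fJ_def fj_eq)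

lemma fj_polys: "j \<in> {1..n} \<Longrightarrow> fj n j \<in> polys n"
  unfolding fj_eq by (intro polys_mult polys_prod polys_diff polys_X) auto

lemma fJ_polys: "J \<subseteq> {1..n} \<Longrightarrow> fJ n J \<in> polys n"
  unfolding fJ_eq by (intro polys_prod fj_polys) auto

section \<open>Enlarging J by an element above its maximum\<close>

context
  fixes n j :: nat and J J' :: "nat set"
  assumes J: "J \<subseteq> {1..n}" and j: "j \<in> {1..n}" and max: "\<And>i. i \<in> J \<Longrightarrow> i < j"
  defines "J' \<equiv> insert j J"
begin

lemma extension_facts:
  shows ext_fin: "finite J" and ext_not_mem: "j \<notin> J" and ext_J': "J' \<subseteq> {1..n}"
    and ext_card: "card J' = Suc (card J)" and ext_card_le: "card J < n"
    and ext_interval: "\<And>i. i \<in> J \<Longrightarrow> {1..<i} - J' = {1..<i} - J" "{1..<j} - J' = {1..<j} - J"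
    and ext_gJ: "\<And>i. i \<in> J \<Longrightarrow> gJ J' i = gJ J i"
proof -
  show fin: "finite J" using J by (rule finite_subset) auto
  show nj: "j \<notin> J" using max by auto
  show s: "J' \<subseteq> {1..n}" using J j by (auto simp: J'_def)
  show c: "card J' = Suc (card J)" using fin nj by (simp add: J'_def)
  have "card J' \<le> n" using card_mono[OF _ s] by simp
  then show "card J < n" using c by simp
  show iv: "{1..<i} - J' = {1..<i} - J" if "i \<in> J" for i using max[OF that] by (auto simp: J'_def)
  show "{1..<j} - J' = {1..<j} - J" by (auto simp: J'_def)
  show "gJ J' i = gJ J i" if "i \<in> J" for i using iv[OF that] by (simp add: gJ_def)
qed

text \<open>Of \<open>\<Sum>i. q (X i)\<close> with \<open>q t = t * (\<Prod>k\<notin>J'. t - X k)\<close> only the terms with \<open>i \<in> J'\<close> survive,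
  and those with \<open>i \<in> J\<close> are multiples of generators; hence \<open>q (X j) = fj n j * gJ J' j\<close> lies in \<open>EJ n J\<close>.\<close>

lemma EJ_extend_subset: "EJ n J' \<subseteq> colon n (EJ n J) (fj n j)"
proof (rule EJ_least)
  note I = EJ_ideal[OF J]
  have sup: "EJ n J \<subseteq> colon n (EJ n J) (fj n j)" by (rule colon_superset[OF I fj_polys[OF j]])
  show "is_poly_ideal n (colon n (EJ n J) (fj n j))" by (rule ideal_colon[OF I fj_polys[OF j]])
  show "psum n k \<in> colon n (EJ n J) (fj n j)" if "1 \<le> k" "k \<le> n - card J'" for k
    using EJ_psum[of k n J] that sup ext_card by auto
  fix i assume i: "i \<in> J'"
  show "gJ J' i \<in> colon n (EJ n J) (fj n j)"
  proof (cases "i = j")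
    case False
    then show ?thesis using i ext_gJ[of i] EJ_gJ[of i J n] sup by (auto simp: J'_def)
  next
    case True
    let ?A = "{1..n} - J'"
    let ?t = "\<lambda>i. X i ^ 1 * (\<Prod>a\<in>?A. X i - X a)"
    have "(\<Sum>i=1..n. ?t i) \<in> EJ n J"
    \<comment> \<open>The top degree is 1 + (n - card J') = n - card J, the degree of the last power
      sum among the generators of \<open>EJ n J\<close>.\<close>
    proof (rule psum_combination_mem[OF I])
      fix k assume "1 \<le> k" "k \<le> 1 + card ?A"
      then show "psum n k \<in> EJ n J"
        using EJ_psum[of k n J] card_Compl_interval[OF ext_J'] ext_card ext_card_le by simp
    qed auto
    moreover have "(\<Sum>i=1..n. ?t i) = (\<Sum>i\<in>J'. ?t i)"
      using ext_J' by (intro sum.mono_neutral_right) (auto intro!: prod_zero)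
    moreover have "(\<Sum>i\<in>J'. ?t i) = ?t j + (\<Sum>i\<in>J. ?t i)"
      using ext_fin ext_not_mem by (simp add: J'_def)
    moreover have "(\<Sum>i\<in>J. ?t i) \<in> EJ n J"
    proof (rule ideal_sum[OF I])
      fix i assume i: "i \<in> J"
      \<comment> \<open>Whatever lies below \<open>i\<close> and outside \<open>J\<close> is also
        outside \<open>J'\<close>, because \<open>j\<close> exceeds \<open>i\<close>; hence
        \<open>gJ J i\<close> splits off.\<close>
      have "?A = ({1..<i} - J) \<union> (?A - {1..<i})" using J i ext_interval(1)[OF i] by fastforce
      then have "(\<Prod>a\<in>?A. X i - X a) = gJ J i * (\<Prod>a\<in>?A - {1..<i}. X i - X a)"
        unfolding gJ_def by (subst prod.union_disjoint[symmetric]) auto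
      then have "?t i = (X i * (\<Prod>a\<in>?A - {1..<i}. X i - X a)) * gJ J i" by (simp add: algebra_simps)
      moreover have "X i * (\<Prod>a\<in>?A - {1..<i}. X i - X a) \<in> polys n"
        using i J by (intro polys_mult polys_prod polys_diff polys_X) auto
      ultimately show "?t i \<in> EJ n J" using ideal_mult[OF I _ EJ_gJ[OF i]] by metis
    qed
    ultimately have "?t j \<in> EJ n J" using ideal_diff[OF I, of "?t j + (\<Sum>i\<in>J. ?t i)" "\<Sum>i\<in>J. ?t i"] by simp
    moreover have "?t j = gJ J' j * fj n j"
    proof -
      have "?A = ({1..<j} - J') \<union> {j+1..n}" using j max by (force simp: J'_def)
      then have "(\<Prod>a\<in>?A. X j - X a) = gJ J' j * (\<Prod>a=j+1..n. X j - X a)"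
        unfolding gJ_def by (subst prod.union_disjoint[symmetric]) auto
      then show ?thesis by (simp add: fj_eq algebra_simps)
    qed
    ultimately show ?thesis using True gJ_polys[OF j] by (simp add: colon_def)
  qed
qed

text \<open>A factor of \<open>fj n j\<close> sends \<open>X j\<close> to 0 or to a later variable,
  which makes n - j + 1 choices. The old generators split as in \<open>EJ_codim_le\<close>, and the
  variables outside \<open>J'\<close> remain.\<close>

lemma EJ_codim_adjoin:
  "codim_le n (ideal_adjoin n (EJ n J) (fj n j)) ((n - j + 1) * ((\<Prod>i\<in>J. card ({1..<i} - J)) * fact (n - card J')))"
proof -
  note I = EJ_ideal[OF J]
  let ?K = "ideal_adjoin n (EJ n J) (fj n j)"
  let ?A = "\<lambda>i. if i = j then insert 0 {j+1..n} else {1..<i} - J"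
  have sup: "EJ n J \<subseteq> ?K" by (rule ideal_adjoin_superset)
  have "codim_le n ?K ((\<Prod>i\<in>J'. card (?A i)) * fact (n - card J'))"
  proof (rule codim_le_multi_split[where l = "\<lambda>j k. X j - X0 k"])
    show "finite J'" using ext_fin by (simp add: J'_def)
    show "is_poly_ideal n ?K" by (rule ideal_ideal_adjoin[OF I fj_polys[OF j]])
    show "finite (?A i)" for i by auto
    fix i assume i: "i \<in> J'"
    show "(\<Prod>k\<in>?A i. X i - X0 k) \<in> ?K"
    proof (cases "i = j")
      case True
      then show ?thesis using ideal_adjoin_mem[OF I, of "fj n j"] by (simp add: fj_def)
    next
      case False
      then have iJ: "i \<in> J" using i by (simp add: J'_def)
      have "(\<Prod>k\<in>{1..<i} - J. X i - X0 k) = gJ J i"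
        unfolding gJ_def by (intro prod.cong) (auto simp: X0_def)
      then show ?thesis using False EJ_gJ[OF iJ, of n] sup by auto
    qed
    show "X i - X0 a \<in> polys n" if "a \<in> ?A i" for a
      using that i ext_J' by (intro polys_diff polys_X X0_polys) (force split: if_splits)+
  next
    fix K' assume K': "is_poly_ideal n K'" "?K \<subseteq> K'"
      and ex: "\<And>i. i \<in> J' \<Longrightarrow> \<exists>k\<in>?A i. X i - X0 k \<in> K'"
    have "codim_le n K' (fact (card ({1..n} - J')))"
    proof (rule codim_le_identified[OF K'(1)])
      fix i assume i: "i \<in> {1..n}"
      show "\<exists>y\<in>insert 0 ({1..n} - J'). X i - X0 y \<in> K'"
      proof (cases "i \<in> J'")
        case True
        then obtain k where k: "k \<in> ?A i" "X i - X0 k \<in> K'" using ex by blast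
        have "k \<in> insert 0 ({1..n} - J')"
        proof (cases "i = j")
          case True
          then show ?thesis using k(1) max j by (auto simp: J'_def dest: max)
        next
          case False
          then have "i < j" using True max by (auto simp: J'_def)
          then show ?thesis using k(1) False i by (auto simp: J'_def)
        qed
        then show ?thesis using k by blast
      next
        case False
        then show ?thesis using i ideal_0[OF K'(1)] by (intro bexI[of _ i]) (auto simp: X0_def)
      qed
    next
      fix k assume "1 \<le> k" "k \<le> card ({1..n} - J')"
      then show "psum n k \<in> K'"
        using EJ_psum[of k n J] subsetD[OF sup] subsetD[OF K'(2)] ext_card card_Compl_interval[OF ext_J'] by simp
    qed auto
    then show "codim_le n K' (fact (n - card J'))" using ext_J' by (simp add: card_Compl_interval_simp)
  qed
  moreover have "(\<Prod>i\<in>J'. card (?A i)) = (n - j + 1) * (\<Prod>i\<in>J. card ({1..<i} - J))"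
  proof -
    have "(\<Prod>i\<in>J. card (?A i)) = (\<Prod>i\<in>J. card ({1..<i} - J))"
      using ext_not_mem by (intro prod.cong) auto
    moreover have "card (insert 0 {j+1..n}) = n - j + 1" by simp
    ultimately show ?thesis using ext_fin ext_not_mem by (simp add: J'_def)
  qed
  ultimately show ?thesis by (metis mult.assoc)
qed

text \<open>The complement of \<open>J\<close> consists of its elements below \<open>j\<close> and
  of the interval from \<open>j\<close> to \<open>n\<close>. Hence the bounds for the colon ideal
  and for the enlarged ideal add up to the bound for \<open>EJ n J\<close> without any loss.\<close>

lemma EJ_codim_step:
  "EJ_codim n J = EJ_codim n J' + (n - j + 1) * ((\<Prod>i\<in>J. card ({1..<i} - J)) * fact (n - card J'))"
proof -
  let ?p = "\<Prod>i\<in>J. card ({1..<i} - J)"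
  have "n - card J = Suc (n - card J')" using ext_card ext_card_le by simp
  then have "EJ_codim n J = (n - card J) * (?p * fact (n - card J'))"
    by (simp add: EJ_codim_def algebra_simps)
  moreover have "EJ_codim n J' = card ({1..<j} - J) * (?p * fact (n - card J'))"
    using ext_fin ext_not_mem ext_interval by (simp add: EJ_codim_def J'_def cong: prod.cong)
  moreover have "n - card J = card ({1..<j} - J) + (n - j + 1)"
  proof -
    have "{1..n} - J = ({1..<j} - J) \<union> {j..n}" using j max by (force dest: max)
    then have "card ({1..n} - J) = card ({1..<j} - J) + card {j..n}"
      by (simp add: card_Un_disjoint disjoint_iff)
    moreover have "card {j..n} = n - j + 1" using j by auto
    ultimately show ?thesis using card_Compl_interval[OF J] by linarith
  qed
  ultimately show ?thesis by (simp add: distrib_right)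
qed

text \<open>If the colon ideal were larger than \<open>EJ n J'\<close>, its codimension would drop
  below \<open>EJ_codim n J'\<close>, and together with \<open>EJ_codim_adjoin\<close> this would
  push \<open>EJ n J\<close> below its assumed minimum. The same addition carries the lower bound
  over to \<open>J'\<close>, which keeps the induction going.\<close>

lemma colon_EJ_step:
  assumes low: "\<And>M. M < EJ_codim n J \<Longrightarrow> \<not> codim_le n (EJ n J) M"
  shows "colon n (EJ n J) (fj n j) = EJ n J'"
    and "M < EJ_codim n J' \<Longrightarrow> \<not> codim_le n (EJ n J') M"
proof -
  note I = EJ_ideal[OF J] and I' = EJ_ideal[OF ext_J']
  have bound: "\<not> codim_le n (colon n (EJ n J) (fj n j)) M" if "M < EJ_codim n J'" for M
    using codim_le_colon[OF I fj_polys[OF j] _ EJ_codim_adjoin, of M] low that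
    unfolding EJ_codim_step by auto
  show "colon n (EJ n J) (fj n j) = EJ n J'"
  proof (rule ccontr)
    assume "colon n (EJ n J) (fj n j) \<noteq> EJ n J'"
    then have "EJ n J' \<subset> colon n (EJ n J) (fj n j)" using EJ_extend_subset by blast
    then have "0 < EJ_codim n J' \<and> codim_le n (colon n (EJ n J) (fj n j)) (EJ_codim n J' - 1)"
      by (intro codim_le_strict[OF ideal_subspace[OF I'] ideal_subspace[OF ideal_colon[OF I fj_polys[OF j]]]]
          EJ_codim_le[OF ext_J']) (auto simp: colon_def)
    then show False using bound[of "EJ_codim n J' - 1"] by simp
  qed
  then show "\<not> codim_le n (EJ n J') M" if "M < EJ_codim n J'" using bound[OF that] by simp
qed

end

text \<open>The elements of \<open>J\<close> are adjoined in increasing order, since each step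
  requires the new element to exceed the earlier ones.\<close>

lemma colon_EJ:
  assumes J: "J \<subseteq> {1..n}" and low: "\<And>M. M < fact n \<Longrightarrow> \<not> codim_le n (EJ n {}) M"
  shows "colon n (EJ n {}) (fJ n J) = EJ n J"
proof -
  have "finite J" using J by (rule finite_subset) auto
  then have "J \<subseteq> {1..n} \<Longrightarrow> colon n (EJ n {}) (fJ n J) = EJ n J \<and>
      (\<forall>M < EJ_codim n J. \<not> codim_le n (EJ n J) M)"
  proof (induction J rule: finite_linorder_max_induct)
    case empty
    then show ?case using low by (simp add: fJ_eq colon_1 EJ_ideal EJ_codim_def)
  next
    case (insert j J)
    have "fJ n (insert j J) = fj n j * fJ n J" using insert by (auto simp: fJ_eq)
    then have "colon n (EJ n {}) (fJ n (insert j J)) = colon n (EJ n J) (fj n j)"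
      using insert fj_polys[of j n] by (simp add: colon_mult)
    then show ?case using insert colon_EJ_step[of J n j] by auto
  qed
  then show ?thesis using J by blast
qed

section \<open>The annihilator of the Vandermonde polynomial\<close>

text \<open>Two weights occur: the constant 1, which gives the total degree, and \<open>id\<close>,
  which singles out the leading exponent of the Vandermonde polynomial.\<close>

definition wt :: "(nat \<Rightarrow> nat) \<Rightarrow> (nat \<Rightarrow>\<^sub>0 nat) \<Rightarrow> nat" where
  "wt u m = (\<Sum>i\<in>supp m. u i * coef m i)"

lemma wt_superset: "finite S \<Longrightarrow> supp m \<subseteq> S \<Longrightarrow> wt u m = (\<Sum>i\<in>S. u i * coef m i)"
  unfolding wt_def by (rule sum.mono_neutral_left) (auto simp: in_keys_iff)

lemma wt_add: "wt u (m + m') = wt u m + wt u m'"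
proof -
  let ?S = "supp m \<union> supp m'"
  have "wt u (m + m') = (\<Sum>i\<in>?S. u i * coef (m + m') i)"
    by (rule wt_superset) (auto simp: supp_add_nat)
  also have "\<dots> = (\<Sum>i\<in>?S. u i * coef m i) + (\<Sum>i\<in>?S. u i * coef m' i)"
    by (simp add: lookup_add algebra_simps sum.distrib)
  finally show ?thesis using wt_superset[of ?S m u] wt_superset[of ?S m' u] by simp
qed

lemma wt_single: "wt u (sing i k) = u i * k"
  using wt_superset[of "{i}" "sing i k" u] by auto

lemma wt_0 [simp]: "wt u 0 = 0" by (simp add: wt_def)

lemma coef_single_mult:
  fixes p :: cpoly
  shows "coef (sing a c * p) (a + m) = c * coef p m"
proof (induction p rule: poly_mapping_single_induct)
  case (single b d)
  then show ?case by (simp add: mult_single lookup_single when_def)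
qed (simp_all add: distrib_left lookup_add)

lemma supp_single_mult:
  fixes p :: cpoly
  assumes "k \<in> supp (sing a c * p)" shows "\<exists>m\<in>supp p. k = a + m"
  using keys_mult[of "sing a c" p] assms by (cases "c = 0") auto

text \<open>The exponent of the lexicographically leading term of a product of forms \<open>X j - X i\<close> with
  \<open>i < j\<close> is the strict maximum of the weight giving \<open>X i\<close> the weight \<open>i\<close>.\<close>

lemma differences_leading:
  fixes A :: "(nat \<times> nat) set"
  assumes "finite A" "\<And>j i. (j, i) \<in> A \<Longrightarrow> i < j"
  defines "\<rho> \<equiv> (\<Sum>e\<in>A. sing (fst e) (1::nat))" and "p \<equiv> (\<Prod>e\<in>A. X (fst e) - X (snd e))"
  shows "coef p \<rho> = 1 \<and> (\<forall>m\<in>supp p. wt (\<lambda>_. 1) m = card A \<and> (m = \<rho> \<or> wt id m < wt id \<rho>))"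
  unfolding \<rho>_def p_def using assms(1,2)
proof (induction A rule: finite_induct)
  case empty
  then show ?case by (auto simp: lookup_one)
next
  case (insert e A)
  obtain j i where e: "e = (j, i)" by (cases e)
  have ij: "i < j" using insert e by auto
  let ?r = "\<Sum>e\<in>A. sing (fst e) (1::nat)" and ?p = "\<Prod>e\<in>A. X (fst e) - X (snd e)"
  have IH: "coef ?p ?r = 1" "\<And>m. m \<in> supp ?p \<Longrightarrow> wt (\<lambda>_. 1) m = card A \<and> (m = ?r \<or> wt id m < wt id ?r)"
    using insert.IH[OF insert.prems[OF insertI2]] by blast+
  have r: "(\<Sum>e\<in>insert e A. sing (fst e) (1::nat)) = sing j 1 + ?r"
    using insert e by simp
  have p: "(\<Prod>e\<in>insert e A. X (fst e) - X (snd e)) = sing (sing j 1) 1 * ?p - sing (sing i 1) 1 * ?p"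
    using insert e by (simp add: X_def left_diff_distrib)
  \<comment> \<open>If \<open>X i\<close> also produced the leading exponent, the cofactor would
    have a monomial whose \<open>id\<close>-weight exceeds that of \<open>?r\<close> by
    \<open>j - i\<close>.\<close>
  have no: "sing j 1 + ?r \<notin> supp (sing (sing i 1) 1 * ?p)"
  proof
    assume "sing j 1 + ?r \<in> supp (sing (sing i 1) 1 * ?p)"
    then obtain m where m: "m \<in> supp ?p" "sing j 1 + ?r = sing i 1 + m" using supp_single_mult by blast
    then have "wt id (sing j 1 + ?r) = wt id (sing i 1 + m)" by simp
    then have "j + wt id ?r = i + wt id m" by (simp add: wt_add wt_single)
    then show False using IH(2)[OF m(1)] ij by auto
  qed
  have "coef (\<Prod>e\<in>insert e A. X (fst e) - X (snd e)) (sing j 1 + ?r) = 1"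
    using no IH(1) unfolding p lookup_minus coef_single_mult by (simp add: in_keys_iff)
  moreover have "wt (\<lambda>_. 1) m = card (insert e A) \<and> (m = sing j 1 + ?r \<or> wt id m < wt id (sing j 1 + ?r))"
    if m: "m \<in> supp (\<Prod>e\<in>insert e A. X (fst e) - X (snd e))" for m
  proof -
    have "m \<in> supp (sing (sing j 1) 1 * ?p) \<or> m \<in> supp (sing (sing i 1) 1 * ?p)"
      using m unfolding p by (auto simp: in_keys_iff lookup_minus)
    then obtain k l where kl: "k = j \<or> k = i" "l \<in> supp ?p" "m = sing k 1 + l"
      using supp_single_mult by blast
    then show ?thesis
      using IH(2)[OF kl(2)] ij insert by (auto simp: wt_add wt_single)
  qed
  ultimately show ?case unfolding r by blast
qed

definition vpairs :: "nat \<Rightarrow> (nat \<times> nat) set" where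
  "vpairs n = (SIGMA j:{1..n}. {1..<j})"

lemma vandermonde_eq: "vandermonde n = (\<Prod>e\<in>vpairs n. X (fst e) - X (snd e))"
  unfolding vandermonde_def vpairs_def by (subst prod.Sigma) (auto simp: case_prod_beta)

text \<open>The exponent vector (0, 1, ..., n - 1) of the leading monomial, see
  \<open>coef_rho\<close>.\<close>

definition rho :: "nat \<Rightarrow> (nat \<Rightarrow>\<^sub>0 nat)" where
  "rho n = (\<Sum>e\<in>vpairs n. sing (fst e) (1::nat))"

lemma finite_vpairs [simp]: "finite (vpairs n)" by (simp add: vpairs_def)

lemma vandermonde_leading:
  shows "coef (vandermonde n) (rho n) = 1"
    and "m \<in> supp (vandermonde n) \<Longrightarrow> wt (\<lambda>_. 1) m = card (vpairs n)"
    and "m \<in> supp (vandermonde n) \<Longrightarrow> m = rho n \<or> wt id m < wt id (rho n)"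
  using differences_leading[of "vpairs n"] unfolding vandermonde_eq rho_def
  by (auto simp: vpairs_def)

lemma coef_rho: "i \<in> {1..n} \<Longrightarrow> coef (rho n) i = i - 1"
proof -
  assume i: "i \<in> {1..n}"
  have "coef (rho n) i = (\<Sum>e\<in>vpairs n. if fst e = i then 1 else 0)"
    unfolding rho_def lookup_sum by (intro sum.cong) (auto simp: lookup_single when_def)
  also have "\<dots> = card {e\<in>vpairs n. fst e = i}"
    by (subst sum.inter_filter[symmetric]) auto
  also have "{e\<in>vpairs n. fst e = i} = {i} \<times> {1..<i}" using i by (auto simp: vpairs_def)
  finally show ?thesis by simp
qed

lemma card_vpairs: "card (vpairs n) = \<Sum>{..<n}"
proof -
  have "card (vpairs n) = (\<Sum>j=1..n. j - 1)" by (simp add: vpairs_def)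
  also have "\<dots> = \<Sum>{..<n}"
    by (rule sum.reindex_bij_witness[of _ Suc "\<lambda>j. j - 1"]) auto
  finally show ?thesis .
qed

lemma vandermonde_polys [simp]: "vandermonde n \<in> polys n"
  unfolding vandermonde_def by (intro polys_prod polys_diff polys_X) auto

section \<open>Alternating polynomials\<close>

lemma pperm_diff: "bij w \<Longrightarrow> pperm w (p - q) = pperm w p - pperm w q"
  using pperm_add[of w p "- q"] by (simp add: pperm_uminus)

text \<open>An adjacent transposition reverses the order of no pair except
  \<open>(Suc k, k)\<close>: this factor changes sign and the others are permuted among
  themselves.\<close>

lemma pperm_vandermonde_adjacent:
  assumes k: "1 \<le> k" "k < n"
  shows "pperm (transpose k (Suc k)) (vandermonde n) = - vandermonde n"
proof -
  let ?s = "transpose k (Suc k)"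
  let ?A = "vpairs n - {(Suc k, k)}"
  let ?F = "\<lambda>e. X (fst e) - X (snd e)"
  have m: "(Suc k, k) \<in> vpairs n" using k by (auto simp: vpairs_def)
  have v: "vandermonde n = (X (Suc k) - X k) * prod ?F ?A"
    unfolding vandermonde_eq by (subst prod.remove[OF _ m]) auto
  have b: "bij ?s" by simp
  have "pperm ?s (prod ?F ?A) = (\<Prod>e\<in>?A. ?F (map_prod ?s ?s e))"
    by (simp add: pperm_prod pperm_diff pperm_X b)
  also have "\<dots> = prod ?F ?A"
  proof -
    have closed: "map_prod ?s ?s e \<in> ?A" if e: "e \<in> ?A" for e
    proof -
      obtain j i where ji: "e = (j, i)" by (cases e)
      have "1 \<le> i" "i < j" "j \<le> n" "\<not> (j = Suc k \<and> i = k)" using e ji by (auto simp: vpairs_def)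
      then show ?thesis using k
        by (auto simp: ji vpairs_def transpose_def)
    qed
    have "map_prod ?s ?s (map_prod ?s ?s e) = e" for e by (cases e) simp
    then show ?thesis using closed
      by (intro prod.reindex_bij_witness[of _ "map_prod ?s ?s" "map_prod ?s ?s"]) simp_all
  qed
  finally have "pperm ?s (prod ?F ?A) = prod ?F ?A" .
  then show ?thesis unfolding v by (simp add: pperm_mult pperm_diff pperm_X b algebra_simps)
qed

text \<open>Adjacent swaps bring the equal exponents next to each other at the cost of signs; one
  further swap fixes the monomial, so its coefficient equals its own negative.\<close>

lemma coef_alternating:
  assumes alt: "\<And>k. 1 \<le> k \<Longrightarrow> k < n \<Longrightarrow> pperm (transpose k (Suc k)) q = - q"
    and "1 \<le> a" "a < b" "b \<le> n" "coef m a = coef m b"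
  shows "coef q m = 0"
  using assms(2-)
proof (induction "b - a" arbitrary: b m)
  case 0
  then show ?case by simp
next
  case (Suc d)
  obtain c where c: "b = Suc c" using Suc by (cases b) auto
  let ?s = "transpose c (Suc c)"
  have b: "bij ?s" by simp
  let ?m = "Poly_Mapping.map_key ?s m"
  have "coef (pperm ?s q) m = - coef q m" using alt[of c] Suc c by simp
  then have eq: "coef q ?m = - coef q m" by (simp add: coef_pperm[OF b])
  show ?case
  proof (cases "a = c")
    case True
    have "?m = m"
      using Suc True c by (intro poly_mapping_eqI) (auto simp: bij_is_inj transpose_def)
    then show ?thesis using eq by (simp add: eq_neg_iff_add_eq_0 flip: mult_2)
  next
    case False
    have "coef q ?m = 0"
      using Suc.prems c False Suc.hyps(2)
      by (intro Suc.hyps(1)[of c]) (auto simp: bij_is_inj transpose_def)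
    then show ?thesis using eq by simp
  qed
qed

lemma sum_lessThan_card_le:
  fixes S :: "nat set" assumes "finite S" shows "\<Sum>{..<card S} \<le> \<Sum>S"
  using assms
proof (induction S rule: finite_linorder_max_induct)
  case (insert b A)
  then have "card A \<le> b" using card_mono[of "{..<b}" A] by auto
  moreover have "card (insert b A) = Suc (card A)" using insert by (subst card_insert_disjoint) auto
  ultimately show ?case using insert by (auto simp: lessThan_Suc)
qed simp

text \<open>The result is alternating, so each of its monomials has \<open>n\<close> distinct
  exponents and degree at least 0 + ... + (n - 1), the degree of the Vandermonde polynomial. But
  \<open>s\<close>, having no constant term, strictly lowers the degree.\<close>

lemma symmetric_act_vandermonde:
  assumes s: "s \<in> polys n" "\<And>w. w permutes {1..n} \<Longrightarrow> pperm w s = s" "coef s 0 = 0"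
  shows "act s (vandermonde n) = 0"
proof (rule dcoef_eqI)
  fix m
  let ?q = "act s (vandermonde n)"
  have alt: "pperm (transpose k (Suc k)) ?q = - ?q" if k: "1 \<le> k" "k < n" for k
  proof -
    have "transpose k (Suc k) permutes {1..n}" using k by (intro permutes_swap_id) auto
    then show ?thesis
      using s(2) k by (simp add: pperm_act pperm_vandermonde_adjacent act_uminus_right)
  qed
  have "dcoef ?q m = 0"
  proof (rule ccontr)
    assume nz: "dcoef ?q m \<noteq> 0"
    have "?q \<in> polys n" by auto
    then have supp: "supp m \<subseteq> {1..n}" using nz by (simp add: polys_dcoef)
    have "\<exists>a\<in>supp s. dcoef (vandermonde n) (m + a) \<noteq> 0"
      using nz unfolding dcoef_act by (metis (no_types, lifting) mult_zero_right sum.neutral)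
    then obtain a where a: "a \<in> supp s" "m + a \<in> supp (vandermonde n)"
      by (auto simp: dcoef_def in_keys_iff)
    have "a \<noteq> 0" using a(1) s(3) by (auto simp: in_keys_iff)
    then obtain i where "i \<in> supp a" by (metis all_not_in_conv keys_eq_empty)
    then have "wt (\<lambda>_. 1) a > 0"
      unfolding wt_def by (intro sum_pos2[of _ i]) (auto simp: in_keys_iff)
    then have "wt (\<lambda>_. 1) m < card (vpairs n)"
      using vandermonde_leading(2)[OF a(2)] by (simp add: wt_add)
    moreover have "inj_on (coef m) {1..n}"
    proof (rule ccontr)
      assume "\<not> inj_on (coef m) {1..n}"
      then obtain a b where "a \<in> {1..n}" "b \<in> {1..n}" "coef m a = coef m b" "a < b"
        unfolding inj_on_def by (metis linorder_neqE_nat)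
      then have "coef ?q m = 0" using coef_alternating[of n ?q a b m] alt by auto
      then show False using nz by (simp add: dcoef_def)
    qed
    then have "\<Sum>{..<n} \<le> (\<Sum>i=1..n. coef m i)"
      using sum_lessThan_card_le[of "coef m ` {1..n}"] by (simp add: card_image sum.reindex)
    moreover have "wt (\<lambda>_. 1) m = (\<Sum>i=1..n. coef m i)"
      using wt_superset[OF _ supp, of "\<lambda>_. 1"] by simp
    ultimately show False by (simp add: card_vpairs)
  qed
  then show "dcoef ?q m = dcoef 0 m" by simp
qed

section \<open>Annihilators and the coinvariant ideal\<close>

definition ann :: "nat \<Rightarrow> cpoly \<Rightarrow> cpoly set" where
  "ann n h = {g \<in> polys n. act g h = 0}"

lemma ann_ideal: "is_poly_ideal n (ann n h)"
  by (auto simp: is_poly_ideal_def ann_def act_add_left act_mult)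

lemma colon_ann: "f \<in> polys n \<Longrightarrow> colon n (ann n h) f = ann n (act f h)"
  by (auto simp: ann_def colon_def act_mult)

lemma coinv_ideal_subset_ann: "coinv_ideal n \<subseteq> ann n (vandermonde n)"
  unfolding coinv_ideal_def
  by (rule hull_minimal) (auto simp: ann_def intro: symmetric_act_vandermonde ann_ideal[unfolded ann_def])

lemma coinv_ideal_ideal: "is_poly_ideal n (coinv_ideal n)"
  unfolding coinv_ideal_def by (rule ideal_hull) auto

lemma psum_symmetric: "w permutes {1..n} \<Longrightarrow> pperm w (psum n k) = psum n k"
proof -
  assume w: "w permutes {1..n}"
  have "pperm w (psum n k) = (\<Sum>i=1..n. X (w i) ^ k)"
    using permutes_bij[OF w] by (simp add: psum_def pperm_sum pperm_power pperm_X)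
  also have "\<dots> = (\<Sum>i=1..n. X i ^ k)"
    using sum.permute[OF w, of "\<lambda>i. X i ^ k"] by (simp add: comp_def)
  finally show ?thesis by (simp add: psum_def)
qed

lemma psum_coinv: 
  assumes "1 \<le> k" shows "psum n k \<in> coinv_ideal n"
proof -
  have "sing i k \<noteq> 0" for i :: nat
  proof
    assume "sing i k = 0"
    then have "coef (sing i k) i = 0" by simp
    then show False using assms by simp
  qed
  then have "coef (psum n k) 0 = 0"
    by (simp add: psum_def lookup_sum X_power lookup_single when_def)
  then show ?thesis
    unfolding coinv_ideal_def by (intro hull_inc) (simp add: psum_symmetric)
qed

lemma family_independent:
  assumes "\<And>c. (\<Sum>i\<in>I. pscale (c i) (b i)) = 0 \<Longrightarrow> \<forall>i\<in>I. c i = 0" "finite I"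
  shows "inj_on b I \<and> P.independent (b ` I)"
proof
  show inj: "inj_on b I"
  proof (rule inj_onI, rule ccontr)
    fix i j assume ij: "i \<in> I" "j \<in> I" "b i = b j" "i \<noteq> j"
    let ?c = "\<lambda>k. if k = i then 1 else if k = j then -1 else (0::complex)"
    have "(\<Sum>k\<in>I. pscale (?c k) (b k)) = (\<Sum>k\<in>{i, j}. pscale (?c k) (b k))"
      using ij assms(2) by (intro sum.mono_neutral_right) auto
    also have "\<dots> = 0" using ij by simp
    finally have "\<forall>i\<in>I. ?c i = 0" by (rule assms(1))
    then show False using ij(1) by force
  qed
  show "P.independent (b ` I)"
  proof (rule P.independent_if_scalars_zero)
    show "finite (b ` I)" using assms(2) by simp
    fix f x assume f: "(\<Sum>x\<in>b ` I. pscale (f x) x) = 0" and x: "x \<in> b ` I"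
    from f have "(\<Sum>i\<in>I. pscale (f (b i)) (b i)) = 0" by (simp add: sum.reindex[OF inj])
    then show "f x = 0" using assms(1)[of "\<lambda>i. f (b i)"] x by auto
  qed
qed

text \<open>The n! exponents with \<open>f i < i\<close> divide the leading monomial. The derivative
  by \<open>e f\<close> has \<open>rho n - e f\<close> as its only monomial of top weight, so these
  derivatives are independent. Since p \<mapsto> \<open>act p (vandermonde n)\<close> factors
  through the quotient by the annihilator, at least n! representatives are needed.\<close>

lemma ann_vandermonde_codim:
  assumes M: "codim_le n (ann n (vandermonde n)) M" shows "fact n \<le> M"
proof -
  let ?I = "PiE {1..n} (\<lambda>i. {..<i})"
  let ?d = "vandermonde n"
  define e where "e f = (\<Sum>i=1..n. sing i (f i))" for f :: "nat \<Rightarrow> nat"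
  define v where "v f = act (sing (e f) 1) ?d" for f
  have e: "coef (e f) i = (if i \<in> {1..n} then f i else 0)" for f i
    by (simp add: e_def lookup_sum lookup_single when_def)
  have e_inj: "inj_on e ?I"
  proof (rule inj_onI)
    fix f g assume fg: "f \<in> ?I" "g \<in> ?I" "e f = e g"
    show "f = g"
    proof (rule PiE_ext[OF fg(1,2)])
      fix i assume "i \<in> {1..n}"
      then show "f i = g i" using e[of f i] e[of g i] fg(3) by simp
    qed
  qed
  have fin: "finite ?I" by (intro finite_PiE) auto
  have cardI: "card ?I = fact n"
    by (simp add: card_PiE fact_prod)
  have "inj_on v ?I \<and> P.independent (v ` ?I)"
  proof (rule family_independent[OF _ fin], rule ccontr)
    fix c assume s: "(\<Sum>f\<in>?I. pscale (c f) (v f)) = 0" and "\<not> (\<forall>f\<in>?I. c f = 0)"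
    then have "{f\<in>?I. c f \<noteq> 0} \<noteq> {}" "finite {f\<in>?I. c f \<noteq> 0}" using fin by auto
    \<comment> \<open>For \<open>e g\<close> of least weight, look at the exponent
      \<open>rho n - e g\<close>: another \<open>f\<close> could contribute only through a monomial
      of the Vandermonde polynomial that differs from \<open>rho n\<close> and has at least the same
      weight.\<close>
    then obtain g where g: "g \<in> ?I" "c g \<noteq> 0"
      and gmin: "\<And>f. f \<in> ?I \<Longrightarrow> c f \<noteq> 0 \<Longrightarrow> wt id (e g) \<le> wt id (e f)"
      using ex_min_if_finite[of "(\<lambda>f. wt id (e f)) ` {f\<in>?I. c f \<noteq> 0}"]
      by (auto simp: not_less) (metis (mono_tags, lifting) linorder_not_le)
    \<comment> \<open>The condition \<open>g i < i\<close> makes this truncated subtraction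
      exact.\<close>
    have le: "rho n - e g + e g = rho n"
    proof (rule poly_mapping_eqI)
      fix i
      show "coef (rho n - e g + e g) i = coef (rho n) i"
      proof (cases "i \<in> {1..n}")
        case True
        then have "g i < i" using PiE_mem[OF g(1), of i] by simp
        then show ?thesis using coef_rho[OF True] True by (simp add: lookup_add lookup_minus e)
      qed (auto simp: lookup_add lookup_minus e)
    qed
    have "0 = dcoef (\<Sum>f\<in>?I. pscale (c f) (v f)) (rho n - e g)" using s by simp
    also have "\<dots> = (\<Sum>f\<in>?I. c f * dcoef ?d (rho n - e g + e f))"
      by (simp add: dcoef_sum dcoef_pscale v_def act_single dcoef_pmono_op)
    also have "\<dots> = (\<Sum>f\<in>{g}. c f * dcoef ?d (rho n - e g + e f))"
    proof (rule sum.mono_neutral_right[OF fin])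
      show "\<forall>f\<in>?I - {g}. c f * dcoef ?d (rho n - e g + e f) = 0"
      proof (rule ballI, rule ccontr)
        fix f assume f: "f \<in> ?I - {g}" and nz: "c f * dcoef ?d (rho n - e g + e f) \<noteq> 0"
        then have "rho n - e g + e f \<in> supp ?d" by (auto simp: dcoef_def in_keys_iff)
        then have "rho n - e g + e f = rho n \<or> wt id (rho n - e g + e f) < wt id (rho n)"
          by (rule vandermonde_leading(3))
        moreover have "wt id (rho n) = wt id (rho n - e g) + wt id (e g)"
          using arg_cong[OF le, of "wt id"] by (simp add: wt_add)
        moreover have "wt id (e g) \<le> wt id (e f)" using f nz by (intro gmin) auto
        ultimately have "rho n - e g + e f = rho n - e g + e g" using le by (auto simp: wt_add)
        then have "e f = e g" by simp
        then show False using f g e_inj by (auto dest: inj_onD)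
      qed
    qed (use g in auto)
    also have "\<dots> \<noteq> 0" using g(2) le by (simp add: dcoef_def vandermonde_leading(1))
    finally show False by simp
  qed
  moreover obtain S where S: "finite S" "card S \<le> M"
      "\<And>p. p \<in> polys n \<Longrightarrow> \<exists>q \<in> P.span S. p - q \<in> ann n ?d"
    using M unfolding codim_le_def by blast
  have "v ` ?I \<subseteq> P.span ((\<lambda>s. act s ?d) ` S)"
  proof
    fix x assume "x \<in> v ` ?I"
    then obtain f where x: "x = act (sing (e f) 1) ?d" by (auto simp: v_def)
    have "supp (e f) \<subseteq> {1..n}" by (auto simp: in_keys_iff e split: if_splits)
    then have "sing (e f) 1 \<in> polys n" by (simp add: polys_single)
    then obtain q where q: "q \<in> P.span S" "sing (e f) 1 - q \<in> ann n ?d" using S(3) by blast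
    then have "x = act q ?d" by (simp add: ann_def act_diff_left x)
    moreover have "act q ?d \<in> P.span ((\<lambda>s. act s ?d) ` S)"
      using q(1)
    proof (induction rule: P.span_induct_alt)
      case base
      then show ?case by (simp add: P.span_zero)
    next
      case (step c s y)
      then show ?case
        by (auto simp: act_add_left act_pscale_left intro!: P.span_add P.span_scale intro: P.span_base)
    qed
    ultimately show "x \<in> P.span ((\<lambda>s. act s ?d) ` S)" by simp
  qed
  ultimately have "card (v ` ?I) \<le> card ((\<lambda>s. act s ?d) ` S)"
    using P.independent_span_bound[of "(\<lambda>s. act s ?d) ` S" "v ` ?I"] S(1) by auto
  moreover have "card (v ` ?I) = fact n"
    using \<open>inj_on v ?I \<and> P.independent (v ` ?I)\<close> cardI by (simp add: card_image)
  ultimately show ?thesis using S(2) card_image_le[OF S(1), of "\<lambda>s. act s ?d"] by linarith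
qed

text \<open>In the chain \<open>EJ n {} \<subseteq> coinv_ideal n \<subseteq> ann n (vandermonde
  n)\<close> the first ideal has codimension at most n! and the last at least n!, so all three
  coincide. In particular the first n power sums generate \<open>I\<^sub>n\<close>.\<close>

lemma EJ_empty: "EJ n {} = ann n (vandermonde n)" "coinv_ideal n = EJ n {}"
proof -
  have 1: "EJ n {} \<subseteq> coinv_ideal n"
    using psum_coinv by (intro EJ_least[OF coinv_ideal_ideal]) auto
  have 2: "EJ n {} = ann n (vandermonde n)"
  proof (rule ccontr)
    assume "EJ n {} \<noteq> ann n (vandermonde n)"
    then have "EJ n {} \<subset> ann n (vandermonde n)" using 1 coinv_ideal_subset_ann by blast
    moreover have "codim_le n (EJ n {}) (fact n)"
      using EJ_codim_le[of "{}" n] by (simp add: EJ_codim_def)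
    ultimately have "0 < (fact n::nat) \<and> codim_le n (ann n (vandermonde n)) (fact n - 1)"
      by (intro codim_le_strict[OF ideal_subspace[OF EJ_ideal] ideal_subspace[OF ann_ideal]])
        (auto simp: ann_def)
    then have "(fact n :: nat) \<le> fact n - 1" using ann_vandermonde_codim by blast
    moreover have "(fact n :: nat) > 0" by simp
    ultimately show False by linarith
  qed
  show "EJ n {} = ann n (vandermonde n)" by (fact 2)
  show "coinv_ideal n = EJ n {}" using 1 2 coinv_ideal_subset_ann[of n] by blast
qed

text \<open>Colon ideals of an annihilator are annihilators of derivatives, by
  \<open>colon_ann\<close>; the lower bound required by \<open>colon_EJ\<close> is
  \<open>ann_vandermonde_codim\<close>.\<close>

theorem colon_coinv_ideal:
  assumes J: "J \<subseteq> {1..n}"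
  shows "colon n (coinv_ideal n) (fJ n J) = EJ n J"
    and "EJ n J = ann n (act (fJ n J) (vandermonde n))"
proof -
  have "colon n (EJ n {}) (fJ n J) = EJ n J"
  proof (rule colon_EJ[OF J])
    fix M :: nat assume "M < fact n"
    then show "\<not> codim_le n (EJ n {}) M" using ann_vandermonde_codim[of n M] EJ_empty(1)[of n] by auto
  qed
  then show "colon n (coinv_ideal n) (fJ n J) = EJ n J"
    and "EJ n J = ann n (act (fJ n J) (vandermonde n))"
    using EJ_empty[of n] colon_ann[OF fJ_polys[OF J]] by auto
qed

section \<open>Superspace\<close>

lemma superspace_iff:
  "f \<in> superspace n \<longleftrightarrow> (\<forall>K. coef f K \<noteq> 0 \<longrightarrow> K \<subseteq> {1..n} \<and> coef f K \<in> polys n)"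
  by (auto simp: superspace_def in_keys_iff)

lemma superspace_coef: "f \<in> superspace n \<Longrightarrow> coef f K \<in> polys n"
  by (cases "coef f K = 0") (auto simp: superspace_iff)

lemma superspace_coef_0: "f \<in> superspace n \<Longrightarrow> \<not> K \<subseteq> {1..n} \<Longrightarrow> coef f K = 0"
  by (auto simp: superspace_iff)

lemma superspace_0 [simp]: "0 \<in> superspace n" by (simp add: superspace_iff)

lemma superspace_add [intro]: "f \<in> superspace n \<Longrightarrow> g \<in> superspace n \<Longrightarrow> f + g \<in> superspace n"
  unfolding superspace_iff lookup_add by (metis add.right_neutral add.left_neutral polys_add)

lemma superspace_sum [intro]: "(\<And>i. i \<in> A \<Longrightarrow> f i \<in> superspace n) \<Longrightarrow> sum f A \<in> superspace n"
  by (induction A rule: infinite_finite_induct) auto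

lemma superspace_single [intro]: "K \<subseteq> {1..n} \<Longrightarrow> p \<in> polys n \<Longrightarrow> sing K p \<in> superspace n"
  by (auto simp: superspace_iff lookup_single when_def)

lemma superspace_of_poly [intro]: "p \<in> polys n \<Longrightarrow> of_poly p \<in> superspace n"
  unfolding of_poly_def by auto

lemma superspace_eqI:
  assumes "f \<in> superspace n" "g \<in> superspace n" "\<And>K. K \<subseteq> {1..n} \<Longrightarrow> coef f K = coef g K"
  shows "f = g"
proof (rule poly_mapping_eqI)
  fix K show "coef f K = coef g K"
    using assms by (cases "K \<subseteq> {1..n}") (auto simp: superspace_coef_0)
qed

section \<open>Signs from reordering anticommuting variables\<close>

lemma neg1_cong: "even a = even b \<Longrightarrow> (- 1) ^ a = ((- 1) ^ b :: 'a::ring_1)"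
  by (simp add: minus_one_power_iff)

text \<open>The exponent of the sign in \<open>smult\<close>, counting the crossings when
  \<open>\<theta>\<^sub>A \<theta>\<^sub>B\<close> is sorted.\<close>

definition cr :: "nat set \<Rightarrow> nat set \<Rightarrow> nat" where
  "cr A B = card {(a, b) \<in> A \<times> B. b < a}"

definition lt :: "nat set \<Rightarrow> nat \<Rightarrow> nat" where "lt S i = card {k \<in> S. k < i}"
definition gt :: "nat set \<Rightarrow> nat \<Rightarrow> nat" where "gt S i = card {k \<in> S. i < k}"

lemma cr_empty [simp]: "cr {} B = 0" "cr A {} = 0" by (simp_all add: cr_def)

lemma cr_eq_sum: "finite A \<Longrightarrow> finite B \<Longrightarrow> cr A B = (\<Sum>a\<in>A. lt B a)"
proof -
  assume "finite A" "finite B"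
  have "{(a, b) \<in> A \<times> B. b < a} = (SIGMA a:A. {b \<in> B. b < a})" by auto
  then show ?thesis using \<open>finite A\<close> \<open>finite B\<close> by (simp add: cr_def lt_def)
qed

lemma lt_insert: "finite S \<Longrightarrow> j \<notin> S \<Longrightarrow> lt (insert j S) i = lt S i + (if j < i then 1 else 0)"
proof -
  assume "finite S" "j \<notin> S"
  moreover have "{k \<in> insert j S. k < i} = (if j < i then insert j {k \<in> S. k < i} else {k \<in> S. k < i})" by auto
  ultimately show ?thesis by (simp add: lt_def)
qed

lemma lt_Un: "finite A \<Longrightarrow> finite B \<Longrightarrow> A \<inter> B = {} \<Longrightarrow> lt (A \<union> B) i = lt A i + lt B i"
  unfolding lt_def by (subst card_Un_disjoint[symmetric]) (auto intro: arg_cong[where f = card])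

lemma gt_Un: "finite A \<Longrightarrow> finite B \<Longrightarrow> A \<inter> B = {} \<Longrightarrow> gt (A \<union> B) i = gt A i + gt B i"
  unfolding gt_def by (subst card_Un_disjoint[symmetric]) (auto intro: arg_cong[where f = card])

lemma lt_gt: "finite A \<Longrightarrow> i \<notin> A \<Longrightarrow> lt A i + gt A i = card A"
proof -
  assume A: "finite A" "i \<notin> A"
  have "k < i \<or> i < k" if "k \<in> A" for k using that A(2) by (cases k i rule: linorder_cases) auto
  then have "A = {k \<in> A. k < i} \<union> {k \<in> A. i < k}" by blast
  moreover have "card ({k \<in> A. k < i} \<union> {k \<in> A. i < k}) = lt A i + gt A i"
    unfolding lt_def gt_def using A by (intro card_Un_disjoint) auto
  ultimately show ?thesis by simp
qed

lemma lt_empty [simp]: "lt {} i = 0" and gt_empty [simp]: "gt {} i = 0" by (simp_all add: lt_def gt_def)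

lemma gt_eq_sum: "finite A \<Longrightarrow> gt A i = (\<Sum>a\<in>A. if i < a then 1 else 0)"
  unfolding gt_def by (subst sum.inter_filter[symmetric]) auto

lemma cr_insert_left: "finite A \<Longrightarrow> finite B \<Longrightarrow> i \<notin> A \<Longrightarrow> cr (insert i A) B = cr A B + lt B i"
  by (simp add: cr_eq_sum)

lemma cr_insert_right: "finite A \<Longrightarrow> finite B \<Longrightarrow> i \<notin> B \<Longrightarrow> cr A (insert i B) = cr A B + gt A i"
  by (simp add: cr_eq_sum lt_insert sum.distrib gt_eq_sum)

lemma cr_single_left: "finite B \<Longrightarrow> cr {i} B = lt B i"
  by (simp add: cr_eq_sum)

lemma cr_single_right: "finite A \<Longrightarrow> cr A {i} = gt A i"
  using cr_insert_right[of A "{}" i] by simp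

lemma smult_superset:
  assumes "finite S" "supp f \<subseteq> S" "finite T" "supp g \<subseteq> T"
  shows "f \<circledast> g = (\<Sum>A\<in>S. \<Sum>B\<in>T. if A \<inter> B = {} then
      sing (A \<union> B) ((-1) ^ cr A B * coef f A * coef g B) else 0)"
proof -
  have "f \<circledast> g = (\<Sum>A\<in>supp f. \<Sum>B\<in>supp g. if A \<inter> B = {} then
      sing (A \<union> B) ((-1) ^ cr A B * coef f A * coef g B) else 0)"
    by (simp only: smult_def cr_def)
  also have "\<dots> = (\<Sum>A\<in>supp f. \<Sum>B\<in>T. if A \<inter> B = {} then
      sing (A \<union> B) ((-1) ^ cr A B * coef f A * coef g B) else 0)"
    using assms by (intro sum.cong[OF refl] sum.mono_neutral_left) (auto simp: in_keys_iff)
  also have "\<dots> = (\<Sum>A\<in>S. \<Sum>B\<in>T. if A \<inter> B = {} then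
      sing (A \<union> B) ((-1) ^ cr A B * coef f A * coef g B) else 0)"
    using assms by (intro sum.mono_neutral_left) (auto simp: in_keys_iff intro!: sum.neutral)
  finally show ?thesis .
qed

lemma coef_smult:
  assumes K: "finite K"
  shows "coef (f \<circledast> g) K = (\<Sum>A\<in>Pow K. (-1) ^ cr A (K - A) * coef f A * coef g (K - A))"
proof -
  let ?S = "supp f \<union> Pow K" and ?T = "supp g \<union> Pow K"
  have "coef (f \<circledast> g) K = (\<Sum>A\<in>?S. \<Sum>B\<in>?T. if A \<inter> B = {} \<and> A \<union> B = K
      then (-1) ^ cr A B * coef f A * coef g B else 0)"
    using K by (subst smult_superset[of ?S f ?T g])
      (auto simp: lookup_sum lookup_single when_def if_distribR intro!: sum.cong)
  also have "\<dots> = (\<Sum>A\<in>?S. if A \<subseteq> K then (-1) ^ cr A (K - A) * coef f A * coef g (K - A) else 0)"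
  proof (rule sum.cong[OF refl])
    fix A
    have iff: "A \<inter> B = {} \<and> A \<union> B = K \<longleftrightarrow> A \<subseteq> K \<and> B = K - A" for B by auto
    show "(\<Sum>B\<in>?T. if A \<inter> B = {} \<and> A \<union> B = K then (-1) ^ cr A B * coef f A * coef g B else 0)
      = (if A \<subseteq> K then (-1) ^ cr A (K - A) * coef f A * coef g (K - A) else 0)"
    proof (cases "A \<subseteq> K")
      case True
      have "(\<Sum>B\<in>?T. if B = K - A then (-1) ^ cr A B * coef f A * coef g B else 0)
        = (if K - A \<in> ?T then (-1) ^ cr A (K - A) * coef f A * coef g (K - A) else 0)"
        using K by (intro sum.delta) auto
      then show ?thesis using True by (simp add: iff)
    qed (auto simp: iff)
  qed
  also have "\<dots> = (\<Sum>A\<in>Pow K. (-1) ^ cr A (K - A) * coef f A * coef g (K - A))"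
    using K by (intro sum.mono_neutral_cong_right) auto
  finally show ?thesis .
qed

lemma smult_single:
  "sing A p \<circledast> sing B q = (if A \<inter> B = {} then sing (A \<union> B) ((-1) ^ cr A B * p * q) else 0)"
  by (subst smult_superset[of "{A}" _ "{B}"]) auto

lemma coef_of_poly_smult [simp]: "coef (of_poly p \<circledast> f) K = p * coef f K"
proof -
  have "of_poly p \<circledast> f = (\<Sum>B\<in>supp f. sing B (p * coef f B))"
    by (subst smult_superset[of "{{}}" _ "supp f"]) (auto simp: of_poly_def)
  then have "coef (of_poly p \<circledast> f) K = (\<Sum>B\<in>supp f. if B = K then p * coef f B else 0)"
    by (simp add: lookup_sum lookup_single when_def)
  then show ?thesis by (auto simp: sum.delta in_keys_iff)
qed

lemma coef_smult_infinite:
  assumes "f \<in> superspace n" "g \<in> superspace n" "\<not> K \<subseteq> {1..n}"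
  shows "coef (f \<circledast> g) K = 0"
proof -
  have "A \<union> B \<noteq> K" if "A \<in> supp f" "B \<in> supp g" for A B
    using assms that by (auto simp: superspace_def)
  then show ?thesis
    by (subst smult_superset[of "supp f" _ "supp g"])
      (auto simp: lookup_sum lookup_single when_def if_distribR intro!: sum.neutral)
qed

lemma superspace_smult [intro]:
  assumes "f \<in> superspace n" "g \<in> superspace n" shows "f \<circledast> g \<in> superspace n"
  unfolding superspace_iff
proof (intro allI impI conjI)
  fix K assume nz: "coef (f \<circledast> g) K \<noteq> 0"
  show K: "K \<subseteq> {1..n}" using coef_smult_infinite[OF assms] nz by blast
  then have "finite K" by (rule finite_subset) auto
  then show "coef (f \<circledast> g) K \<in> polys n"
    using assms by (auto simp: coef_smult intro!: polys_sum polys_mult superspace_coef)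
qed

lemma smult_add_left: "(f + f') \<circledast> g = f \<circledast> g + f' \<circledast> g"
proof -
  let ?S = "supp f \<union> supp f'" and ?T = "supp g"
  have 1: "(f + f') \<circledast> g = (\<Sum>A\<in>?S. \<Sum>B\<in>?T. if A \<inter> B = {} then
      sing (A \<union> B) ((-1) ^ cr A B * coef (f + f') A * coef g B) else 0)"
    using keys_add[of f f'] by (intro smult_superset) auto
  have 2: "f \<circledast> g = (\<Sum>A\<in>?S. \<Sum>B\<in>?T. if A \<inter> B = {} then
      sing (A \<union> B) ((-1) ^ cr A B * coef f A * coef g B) else 0)"
    by (intro smult_superset) auto
  have 3: "f' \<circledast> g = (\<Sum>A\<in>?S. \<Sum>B\<in>?T. if A \<inter> B = {} then
      sing (A \<union> B) ((-1) ^ cr A B * coef f' A * coef g B) else 0)"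
    by (intro smult_superset) auto
  show ?thesis unfolding 1 2 3
    by (auto simp: lookup_add algebra_simps single_add simp flip: sum.distrib intro!: sum.cong)
qed

lemma smult_0_left [simp]: "0 \<circledast> g = 0" by (simp add: smult_def)

lemma smult_sum_left: "sum f A \<circledast> g = (\<Sum>a\<in>A. f a \<circledast> g)"
  by (induction A rule: infinite_finite_induct) (auto simp: smult_add_left)

text \<open>The grading automorphism, which is the twist in the Leibniz rule of an odd
  derivation.\<close>

definition eps :: "sform \<Rightarrow> sform" where
  "eps f = (\<Sum>K\<in>supp f. sing K ((-1) ^ card K * coef f K))"

lemma coef_eps [simp]: "coef (eps f) K = (-1) ^ card K * coef f K"
  by (auto simp: eps_def lookup_sum lookup_single when_def sum.delta in_keys_iff)

lemma superspace_eps [intro]: "f \<in> superspace n \<Longrightarrow> eps f \<in> superspace n"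
  unfolding superspace_iff by (auto intro!: polys_mult)

lemma coef_contract:
  "coef (contract i f) K = (if i \<notin> K then (-1) ^ lt K i * coef f (insert i K) else 0)"
proof -
  have eq: "L - {i} = K \<longleftrightarrow> i \<notin> K \<and> L = insert i K" if "i \<in> L" for L using that by auto
  have "coef (contract i f) K = (\<Sum>L\<in>supp f. if L = insert i K \<and> i \<notin> K then (-1) ^ card {k \<in> L. k < i} * coef f L else 0)"
    unfolding contract_def lookup_sum
    by (intro sum.cong) (auto simp: lookup_single when_def eq)
  also have "\<dots> = (if i \<notin> K then (-1) ^ card {k \<in> insert i K. k < i} * coef f (insert i K) else 0)"
    by (cases "i \<in> K") (auto simp: sum.delta in_keys_iff)
  also have "{k \<in> insert i K. k < i} = {k \<in> K. k < i}" by auto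
  finally show ?thesis by (simp add: lt_def)
qed

lemma superspace_contract [intro]:
  assumes "f \<in> superspace n" shows "contract i f \<in> superspace n"
  using assms unfolding superspace_iff coef_contract by (auto intro!: polys_mult split: if_splits)

lemma smult_eps:
  assumes a: "a \<in> superspace n" and t: "t \<in> superspace n"
  shows "eps (a \<circledast> t) = eps a \<circledast> eps t"
proof (rule superspace_eqI)
  fix K assume K: "K \<subseteq> {1..n}"
  then have fin: "finite K" by (rule finite_subset) auto
  show "coef (eps (a \<circledast> t)) K = coef (eps a \<circledast> eps t) K"
    unfolding coef_eps coef_smult[OF fin] sum_distrib_left
  proof (rule sum.cong[OF refl])
    fix A assume A: "A \<in> Pow K"
    then have "card K = card A + card (K - A)"
      using fin by (metis PowD card_Diff_subset card_mono finite_subset le_add_diff_inverse)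
    then show "(- 1) ^ card K * ((- 1) ^ cr A (K - A) * coef a A * coef t (K - A)) =
        (- 1) ^ cr A (K - A) * ((- 1) ^ card A * coef a A) * ((- 1) ^ card (K - A) * coef t (K - A))"
      by (simp add: power_add algebra_simps)
  qed
qed (use a t in auto)

lemma sum_Pow_insert:
  assumes "finite K" "i \<notin> K"
  shows "(\<Sum>A\<in>Pow (insert i K). g A) = (\<Sum>A\<in>Pow K. g (insert i A)) + (\<Sum>A\<in>Pow K. g A)"
proof -
  have "inj_on (insert i) (Pow K)" using assms(2) by (auto simp: inj_on_def)
  then show ?thesis using assms
    by (subst Pow_insert, subst sum.union_disjoint) (auto simp: sum.reindex add.commute)
qed

text \<open>At \<open>K\<close> without \<open>i\<close>, the product is split according to the
  factor that contains \<open>\<theta>\<^sub>i\<close>; this gives the two terms on the right. At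
  \<open>K\<close> containing \<open>i\<close> the left side vanishes, and the terms on the right
  cancel in pairs.\<close>

lemma contract_smult:
  assumes a: "a \<in> superspace n" and t: "t \<in> superspace n"
  shows "contract i (a \<circledast> t) = contract i a \<circledast> t + eps a \<circledast> contract i t"
proof (rule superspace_eqI)
  fix K assume K: "K \<subseteq> {1..n}"
  then have fin: "finite K" by (rule finite_subset) auto
  show "coef (contract i (a \<circledast> t)) K = coef (contract i a \<circledast> t + eps a \<circledast> contract i t) K"
  proof (cases "i \<in> K")
    case True
    have "coef (contract i a \<circledast> t + eps a \<circledast> contract i t) K
      = (\<Sum>A\<in>Pow K. (-1) ^ cr A (K - A) * coef (contract i a) A * coef t (K - A))
       + (\<Sum>A\<in>Pow K. (-1) ^ cr A (K - A) * coef (eps a) A * coef (contract i t) (K - A))"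
      unfolding lookup_add coef_smult[OF fin] ..
    also have "(\<Sum>A\<in>Pow K. (-1) ^ cr A (K - A) * coef (contract i a) A * coef t (K - A))
        = (\<Sum>A\<in>Pow (K - {i}). (-1) ^ cr A (K - A) * coef (contract i a) A * coef t (K - A))"
      using fin by (intro sum.mono_neutral_right) (auto simp: coef_contract)
    also have "(\<Sum>A\<in>Pow K. (-1) ^ cr A (K - A) * coef (eps a) A * coef (contract i t) (K - A))
        = (\<Sum>A\<in>insert i ` Pow (K - {i}). (-1) ^ cr A (K - A) * coef (eps a) A * coef (contract i t) (K - A))"
    proof (rule sum.mono_neutral_right)
      show "\<forall>A\<in>Pow K - insert i ` Pow (K - {i}).
          (-1) ^ cr A (K - A) * coef (eps a) A * coef (contract i t) (K - A) = 0"
      proof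
        fix A assume "A \<in> Pow K - insert i ` Pow (K - {i})"
        moreover have "A \<in> insert i ` Pow (K - {i})" if "i \<in> A" "A \<subseteq> K"
          using that by (intro image_eqI[of _ _ "A - {i}"]) auto
        ultimately have "i \<in> K - A" using True by auto
        then show "(-1) ^ cr A (K - A) * coef (eps a) A * coef (contract i t) (K - A) = 0"
          by (simp add: coef_contract)
      qed
    qed (use fin True in auto)
    also have "\<dots> = (\<Sum>A\<in>Pow (K - {i}). (-1) ^ cr (insert i A) (K - insert i A) * coef (eps a) (insert i A) * coef (contract i t) (K - insert i A))"
      by (subst sum.reindex) (auto simp: inj_on_def)
    also have "(\<Sum>A\<in>Pow (K - {i}). (-1) ^ cr A (K - A) * coef (contract i a) A * coef t (K - A))
       + (\<Sum>A\<in>Pow (K - {i}). (-1) ^ cr (insert i A) (K - insert i A) * coef (eps a) (insert i A) * coef (contract i t) (K - insert i A)) = 0"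
      unfolding sum.distrib[symmetric]
    \<comment> \<open>Both summands are \<open>coef a (insert i A) * coef t (K - A)\<close> up to
      sign, where both index sets contain \<open>i\<close>; the signs are opposite.\<close>
    proof (rule sum.neutral, rule ballI)
      fix A assume A: "A \<in> Pow (K - {i})"
      define B where "B = K - insert i A"
      have B: "K - A = insert i B" "i \<notin> B" "finite B" "finite A" "i \<notin> A"
        using A True fin by (auto simp: B_def intro: finite_subset)
      have "card A = lt A i + gt A i" using B by (simp add: lt_gt)
      then have "(-1 :: cpoly) ^ (cr A B + gt A i + lt A i) = - ((-1) ^ (cr A B + lt B i + Suc (card A) + lt B i))"
        by (auto simp: minus_one_power_iff)
      then show "(-1) ^ cr A (K - A) * coef (contract i a) A * coef t (K - A) +
          (-1) ^ cr (insert i A) (K - insert i A) * coef (eps a) (insert i A) * coef (contract i t) (K - insert i A) = 0"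
        using B unfolding B_def[symmetric] coef_contract coef_eps B(1)
        by (simp add: cr_insert_left cr_insert_right power_add algebra_simps)
    qed
    finally show ?thesis using True by (simp add: coef_contract)
  next
    case False
    have "coef (contract i (a \<circledast> t)) K = (-1) ^ lt K i *
        (\<Sum>A\<in>Pow (insert i K). (-1) ^ cr A (insert i K - A) * coef a A * coef t (insert i K - A))"
      using False fin by (simp add: coef_contract coef_smult)
    also have "\<dots> = (\<Sum>A\<in>Pow K. (-1) ^ lt K i * ((-1) ^ cr (insert i A) (insert i K - insert i A) * coef a (insert i A) * coef t (insert i K - insert i A)))
      + (\<Sum>A\<in>Pow K. (-1) ^ lt K i * ((-1) ^ cr A (insert i K - A) * coef a A * coef t (insert i K - A)))"
      by (simp add: sum_Pow_insert[OF fin False] distrib_left sum_distrib_left)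
    also have "(\<Sum>A\<in>Pow K. (-1) ^ lt K i * ((-1) ^ cr (insert i A) (insert i K - insert i A) * coef a (insert i A) * coef t (insert i K - insert i A)))
       = (\<Sum>A\<in>Pow K. (-1) ^ cr A (K - A) * coef (contract i a) A * coef t (K - A))"
    proof (rule sum.cong[OF refl])
      fix A assume A: "A \<in> Pow K"
      have B: "insert i K - insert i A = K - A" "finite A" "finite (K - A)" "i \<notin> A"
        using A False fin by (auto intro: finite_subset)
      have "lt K i = lt A i + lt (K - A) i"
        using lt_Un[of A "K - A" i] A B by (simp add: Un_absorb1)
      then have "(-1 :: cpoly) ^ (lt K i + (cr A (K - A) + lt (K - A) i)) = (-1) ^ (cr A (K - A) + lt A i)"
        by (intro neg1_cong) auto
      then show "(-1) ^ lt K i * ((-1) ^ cr (insert i A) (insert i K - insert i A) * coef a (insert i A) * coef t (insert i K - insert i A))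
         = (-1) ^ cr A (K - A) * coef (contract i a) A * coef t (K - A)"
        unfolding B(1) using B by (simp add: coef_contract cr_insert_left power_add algebra_simps)
    qed
    also have "(\<Sum>A\<in>Pow K. (-1) ^ lt K i * ((-1) ^ cr A (insert i K - A) * coef a A * coef t (insert i K - A)))
       = (\<Sum>A\<in>Pow K. (-1) ^ cr A (K - A) * coef (eps a) A * coef (contract i t) (K - A))"
    proof (rule sum.cong[OF refl])
      fix A assume A: "A \<in> Pow K"
      have B: "insert i K - A = insert i (K - A)" "finite A" "finite (K - A)" "i \<notin> A" "i \<notin> K - A"
        using A False fin by (auto intro: finite_subset)
      have "lt K i = lt A i + lt (K - A) i" "card A = lt A i + gt A i"
        using lt_Un[of A "K - A" i] A B by (auto simp: Un_absorb1 lt_gt)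
      then have "(-1 :: cpoly) ^ (lt K i + (cr A (K - A) + gt A i)) = (-1) ^ (cr A (K - A) + card A + lt (K - A) i)"
        by (intro neg1_cong) auto
      then show "(-1) ^ lt K i * ((-1) ^ cr A (insert i K - A) * coef a A * coef t (insert i K - A))
         = (-1) ^ cr A (K - A) * coef (eps a) A * coef (contract i t) (K - A)"
        unfolding B(1) using B by (simp add: coef_contract cr_insert_right power_add algebra_simps)
    qed
    finally show ?thesis by (simp add: lookup_add coef_smult[OF fin])
  qed
qed (use a t in auto)

text \<open>The odd derivation with \<open>\<theta>\<^sub>i \<mapsto> x\<^sub>i\<^sup>j\<close>; by
  \<open>pair_dj\<close> it is the adjoint of \<open>dj n j\<close>.\<close>

definition Dop :: "nat \<Rightarrow> nat \<Rightarrow> sform \<Rightarrow> sform" where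
  "Dop n j f = (\<Sum>i=1..n. of_poly (X i ^ j) \<circledast> contract i f)"

lemma coef_Dop: "coef (Dop n j f) K = (\<Sum>i=1..n. X i ^ j * coef (contract i f) K)"
  by (simp add: Dop_def lookup_sum)

lemma superspace_Dop [intro]: "f \<in> superspace n \<Longrightarrow> Dop n j f \<in> superspace n"
  unfolding Dop_def by (intro superspace_sum superspace_smult superspace_of_poly polys_power polys_X superspace_contract)

lemma Dop_smult:
  assumes a: "a \<in> superspace n" and t: "t \<in> superspace n"
  shows "Dop n j (a \<circledast> t) = Dop n j a \<circledast> t + eps a \<circledast> Dop n j t"
proof (rule superspace_eqI)
  fix K assume K: "K \<subseteq> {1..n}"
  then have fin: "finite K" by (rule finite_subset) auto
  have "coef (Dop n j a \<circledast> t) K = (\<Sum>i=1..n. X i ^ j * coef (contract i a \<circledast> t) K)"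
    unfolding coef_smult[OF fin] coef_Dop
    by (simp add: sum_distrib_left sum_distrib_right mult.assoc mult.left_commute)
      (subst sum.swap, simp)
  moreover have "coef (eps a \<circledast> Dop n j t) K = (\<Sum>i=1..n. X i ^ j * coef (eps a \<circledast> contract i t) K)"
    unfolding coef_smult[OF fin] coef_Dop
    by (simp add: sum_distrib_left sum_distrib_right mult.assoc mult.left_commute)
      (subst sum.swap, simp)
  ultimately show "coef (Dop n j (a \<circledast> t)) K = coef (Dop n j a \<circledast> t + eps a \<circledast> Dop n j t) K"
    by (simp add: coef_Dop contract_smult[OF a t] lookup_add distrib_left sum.distrib)
qed (use a t in auto)

section \<open>The diagonal action and the ideal \<open>SI\<^sub>n\<close>\<close>

text \<open>The exponent of the sign that arises when the factors \<open>theta (w k)\<close>, taken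
  for increasing \<open>k \<in> K\<close>, are sorted, see \<open>theta_product\<close>.\<close>

definition invs :: "(nat \<Rightarrow> nat) \<Rightarrow> nat set \<Rightarrow> nat" where
  "invs w K = card {(a, b) \<in> K \<times> K. a < b \<and> w b < w a}"

lemma invs_insert:
  assumes "finite K" "i \<notin> K"
  shows "invs w (insert i K) = invs w K + card {a \<in> K. a < i \<and> w i < w a} + card {b \<in> K. i < b \<and> w b < w i}"
proof -
  let ?A = "{(a, b) \<in> K \<times> K. a < b \<and> w b < w a}"
  let ?B = "(\<lambda>a. (a, i)) ` {a \<in> K. a < i \<and> w i < w a}"
  let ?C = "(\<lambda>b. (i, b)) ` {b \<in> K. i < b \<and> w b < w i}"
  have "{(a, b) \<in> insert i K \<times> insert i K. a < b \<and> w b < w a} = ?A \<union> ?B \<union> ?C"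
    by (auto simp: image_iff)
  moreover have "finite ?A" using assms by (intro finite_subset[of ?A "K \<times> K"]) auto
  moreover have "(?A \<union> ?B) \<inter> ?C = {}" "?A \<inter> ?B = {}" using assms by auto
  moreover have "card ?B = card {a \<in> K. a < i \<and> w i < w a}" "card ?C = card {b \<in> K. i < b \<and> w b < w i}"
    by (simp_all add: card_image inj_on_def)
  ultimately show ?thesis using assms by (simp add: invs_def card_Un_disjoint)
qed

lemma theta_product:
  assumes "inj w" "sorted_wrt (<) ks"
  shows "foldr (\<lambda>k g. theta (w k) \<circledast> g) ks (of_poly 1) = sing (w ` set ks) ((-1) ^ invs w (set ks))"
  using assms(2)
proof (induction ks)
  case Nil
  then show ?case by (simp add: of_poly_def invs_def)
next
  case (Cons k ks)
  have k: "k \<notin> set ks" "\<And>l. l \<in> set ks \<Longrightarrow> k < l" using Cons.prems by auto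
  have "w k \<notin> w ` set ks" using assms(1) k(1) by (auto dest: injD)
  moreover have "cr {w k} (w ` set ks) = card {b \<in> set ks. k < b \<and> w b < w k}"
  proof -
    have "{x \<in> w ` set ks. x < w k} = w ` {b \<in> set ks. k < b \<and> w b < w k}" using k by auto
    then show ?thesis using assms(1)
      by (simp add: cr_single_left lt_def card_image inj_on_subset)
  qed
  moreover have "{a \<in> set ks. a < k \<and> w k < w a} = {}" using k(2) by force
  then have "card {a \<in> set ks. a < k \<and> w k < w a} = 0" by (simp only: card.empty)
  then have "invs w (insert k (set ks)) = invs w (set ks) + card {b \<in> set ks. k < b \<and> w b < w k}"
    using invs_insert[OF finite_set k(1), of w] by linarith
  ultimately show ?case
    using Cons by (simp add: theta_def smult_single power_add mult.commute)
qed

lemma coef_sperm: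
  assumes w: "bij w" and fin: "\<And>K. K \<in> supp f \<Longrightarrow> finite K"
  shows "coef (sperm w f) (w ` K) = (-1) ^ invs w K * pperm w (coef f K)"
proof -
  have inj: "inj w" using w by (rule bij_is_inj)
  have "sperm w f = (\<Sum>L\<in>supp f. sing (w ` L) ((-1) ^ invs w L * pperm w (coef f L)))"
    unfolding sperm_def
  proof (rule sum.cong[OF refl])
    fix L assume "L \<in> supp f"
    then have L: "finite L" by (rule fin)
    show "of_poly (pperm w (coef f L)) \<circledast> foldr (\<lambda>k g. theta (w k) \<circledast> g) (sorted_list_of_set L) (of_poly 1)
      = sing (w ` L) ((-1) ^ invs w L * pperm w (coef f L))"
      using L theta_product[OF inj, of "sorted_list_of_set L"]
      by (simp add: of_poly_def smult_single mult.commute strict_sorted_iff)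
  qed
  then have "coef (sperm w f) (w ` K) = (\<Sum>L\<in>supp f. if L = K then (-1) ^ invs w L * pperm w (coef f L) else 0)"
    by (simp add: lookup_sum lookup_single when_def inj_image_eq_iff[OF inj])
  then show ?thesis by (auto simp: sum.delta in_keys_iff)
qed

lemma superspace_finite: "f \<in> superspace n \<Longrightarrow> K \<in> supp f \<Longrightarrow> finite K"
  by (auto simp: superspace_def intro: finite_subset)

lemma sperm_superspace:
  assumes w: "w permutes {1..n}" and f: "f \<in> superspace n"
  shows "sperm w f \<in> superspace n"
  unfolding superspace_iff
proof (intro allI impI)
  fix L assume nz: "coef (sperm w f) L \<noteq> 0"
  have b: "bij w" using w by (rule permutes_bij)
  obtain K where L: "L = w ` K" using b by (metis bij_is_surj surj_image_vimage_eq)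
  have c: "coef (sperm w f) L = (-1) ^ invs w K * pperm w (coef f K)"
    unfolding L using superspace_finite[OF f] by (rule coef_sperm[OF b])
  have "coef f K \<noteq> 0" using nz unfolding c by auto
  then have "K \<subseteq> {1..n}" "coef f K \<in> polys n" using f by (auto simp: superspace_iff)
  then show "L \<subseteq> {1..n} \<and> coef (sperm w f) L \<in> polys n"
    unfolding c using pperm_polys[OF w] permutes_in_image[OF w] by (auto simp: L intro!: polys_mult)
qed

text \<open>Invariance under \<open>sperm\<close> in terms of coefficients
  (\<open>sinv_iff\<close>), the form in which it can be checked for \<open>Dop\<close> and
  \<open>eps\<close>.\<close>

definition sinv :: "nat \<Rightarrow> sform \<Rightarrow> bool" where
  "sinv n f \<longleftrightarrow> (\<forall>w K. w permutes {1..n} \<longrightarrow> K \<subseteq> {1..n} \<longrightarrow>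
     coef f (w ` K) = (-1) ^ invs w K * pperm w (coef f K))"

lemma sinv_iff:
  assumes f: "f \<in> superspace n"
  shows "(\<forall>w. w permutes {1..n} \<longrightarrow> sperm w f = f) \<longleftrightarrow> sinv n f"
proof
  assume "\<forall>w. w permutes {1..n} \<longrightarrow> sperm w f = f"
  then show "sinv n f"
    unfolding sinv_def using coef_sperm[of _ f] superspace_finite[OF f] permutes_bij by metis
next
  assume s: "sinv n f"
  show "\<forall>w. w permutes {1..n} \<longrightarrow> sperm w f = f"
  proof (intro allI impI)
    fix w assume w: "w permutes {1..n}"
    show "sperm w f = f"
    proof (rule superspace_eqI[OF sperm_superspace[OF w f] f])
      fix L assume L: "L \<subseteq> {1..n}"
      obtain K where K: "L = w ` K" "K \<subseteq> {1..n}"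
        using L permutes_image[OF w] by (metis subset_imageE)
      have "coef (sperm w f) (w ` K) = (-1) ^ invs w K * pperm w (coef f K)"
        by (rule coef_sperm[OF permutes_bij[OF w] superspace_finite[OF f]])
      then show "coef (sperm w f) L = coef f L"
        using s w K by (simp add: sinv_def)
    qed
  qed
qed

text \<open>This makes contraction equivariant. Let \<open>?A\<close> be the elements below
  \<open>i\<close> mapped above \<open>w i\<close>, \<open>?B\<close> those above mapped below,
  \<open>?C\<close> those staying below. Apart from \<open>invs w K\<close>, the left side counts A
  + C and the right side A + 2B + C.\<close>

lemma invs_parity:
  assumes "finite K" "i \<notin> K" "inj w"
  shows "even (lt K i + invs w K) = even (invs w (insert i K) + lt (w ` K) (w i))"
proof -
  let ?A = "{a \<in> K. a < i \<and> w i < w a}" and ?B = "{b \<in> K. i < b \<and> w b < w i}" and ?C = "{a \<in> K. a < i \<and> w a < w i}"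
  have "{x \<in> w ` K. x < w i} = w ` (?B \<union> ?C)"
  proof -
    have "x \<in> K \<Longrightarrow> w x < w i \<longleftrightarrow> x \<in> ?B \<union> ?C" for x
      using assms(2) by (cases x i rule: linorder_cases) auto
    then show ?thesis by blast
  qed
  moreover have "card (?B \<union> ?C) = card ?B + card ?C" using assms(1) by (intro card_Un_disjoint) auto
  ultimately have 1: "lt (w ` K) (w i) = card ?B + card ?C"
    using assms(3) by (simp add: lt_def card_image inj_on_subset)
  have "w i \<noteq> w a" if "a \<in> K" for a using that assms by (auto dest: injD)
  then have "{k \<in> K. k < i} = ?A \<union> ?C" by (force simp: neq_iff)
  moreover have "card (?A \<union> ?C) = card ?A + card ?C" using assms(1) by (intro card_Un_disjoint) auto
  ultimately have 2: "lt K i = card ?A + card ?C" by (simp add: lt_def)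
  show ?thesis unfolding 1 2 invs_insert[OF assms(1,2)] by simp presburger
qed

lemma sinv_Dop:
  assumes f: "f \<in> superspace n" "sinv n f" shows "sinv n (Dop n j f)"
  unfolding sinv_def
proof (intro allI impI)
  fix w K assume w: "w permutes {1..n}" and K: "K \<subseteq> {1..n}"
  have b: "bij w" using w by (rule permutes_bij)
  have inj: "inj w" using b by (rule bij_is_inj)
  have fin: "finite K" using K by (rule finite_subset) auto
  have contr: "coef (contract (w i) f) (w ` K) = (-1) ^ invs w K * pperm w (coef (contract i f) K)"
    if i: "i \<in> {1..n}" for i
  proof (cases "i \<in> K")
    case True
    then show ?thesis by (simp add: coef_contract)
  next
    case False
    then have "w i \<notin> w ` K" using inj by (auto dest: injD)
    moreover have "coef f (insert (w i) (w ` K)) = (-1) ^ invs w (insert i K) * pperm w (coef f (insert i K))"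
      using f(2) w K i unfolding sinv_def by (metis image_insert insert_subset)
    ultimately have "coef (contract (w i) f) (w ` K)
        = (-1) ^ (lt (w ` K) (w i) + invs w (insert i K)) * pperm w (coef f (insert i K))"
      by (simp add: coef_contract power_add)
    also have "(-1 :: cpoly) ^ (lt (w ` K) (w i) + invs w (insert i K)) = (-1) ^ (invs w K + lt K i)"
      using invs_parity[OF fin False inj] by (intro neg1_cong) (simp add: add.commute)
    finally show ?thesis using False by (simp add: coef_contract pperm_sign[OF b] power_add)
  qed
  have "coef (Dop n j f) (w ` K) = (\<Sum>i=1..n. X (w i) ^ j * coef (contract (w i) f) (w ` K))"
    unfolding coef_Dop
    using sum.permute[OF w, of "\<lambda>i. X i ^ j * coef (contract i f) (w ` K)"] by (simp add: comp_def)
  also have "\<dots> = (\<Sum>i=1..n. (-1) ^ invs w K * pperm w (X i ^ j * coef (contract i f) K))"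
    by (intro sum.cong) (simp_all add: contr pperm_mult pperm_power pperm_X b mult.left_commute)
  also have "\<dots> = (-1) ^ invs w K * pperm w (coef (Dop n j f) K)"
    by (simp add: coef_Dop pperm_sum b sum_distrib_left)
  finally show "coef (Dop n j f) (w ` K) = (-1) ^ invs w K * pperm w (coef (Dop n j f) K)" .
qed

lemma sinv_eps:
  assumes "sinv n f" shows "sinv n (eps f)"
  unfolding sinv_def
proof (intro allI impI)
  fix w K assume w: "w permutes {1..n}" and K: "K \<subseteq> {1..n}"
  have b: "bij w" using w by (rule permutes_bij)
  have "card (w ` K) = card K" by (rule card_image[OF inj_on_subset[OF bij_is_inj[OF b] subset_UNIV]])
  then show "coef (eps f) (w ` K) = (-1) ^ invs w K * pperm w (coef (eps f) K)"
    using assms w K by (simp add: sinv_def pperm_sign[OF b] mult.left_commute)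
qed

section \<open>The ideal of invariants and the operators preserving it\<close>

definition SI_gens :: "nat \<Rightarrow> sform set" where
  "SI_gens n = {f \<in> superspace n. sinv n f \<and> coef (coef f {}) 0 = 0}"

lemma SI_eq: "SI n = is_super_ideal n hull SI_gens n"
  unfolding SI_def SI_gens_def by (rule arg_cong[where f = "\<lambda>S. is_super_ideal n hull S"]) (use sinv_iff[of _ n] in blast)

lemma superspace_super_ideal: "is_super_ideal n (superspace n)"
  by (auto simp: is_super_ideal_def)

lemma SI_super_ideal: "is_super_ideal n (SI n)"
proof -
  let ?F = "{t. is_super_ideal n t \<and> SI_gens n \<subseteq> t}"
  have "superspace n \<in> ?F" using superspace_super_ideal by (auto simp: SI_gens_def)
  then show ?thesis unfolding SI_eq hull_def is_super_ideal_def[of n "\<Inter>?F"]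
    by (auto simp: is_super_ideal_def)
qed

lemma SI_superspace: "f \<in> SI n \<Longrightarrow> f \<in> superspace n"
  and SI_0: "0 \<in> SI n"
  and SI_add: "f \<in> SI n \<Longrightarrow> g \<in> SI n \<Longrightarrow> f + g \<in> SI n"
  and SI_smult_left: "a \<in> superspace n \<Longrightarrow> f \<in> SI n \<Longrightarrow> a \<circledast> f \<in> SI n"
  and SI_smult_right: "a \<in> superspace n \<Longrightarrow> f \<in> SI n \<Longrightarrow> f \<circledast> a \<in> SI n"
  using SI_super_ideal[of n] by (auto simp: is_super_ideal_def)

lemma SI_sum: "(\<And>i. i \<in> A \<Longrightarrow> f i \<in> SI n) \<Longrightarrow> sum f A \<in> SI n"
  by (induction A rule: infinite_finite_induct) (auto simp: SI_0 SI_add)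

lemma SI_gen: "f \<in> SI_gens n \<Longrightarrow> f \<in> SI n"
  unfolding SI_eq by (rule hull_inc)

lemma SI_least:
  assumes "is_super_ideal n T" "SI_gens n \<subseteq> T" "f \<in> SI n" shows "f \<in> T"
  using assms hull_minimal[of "SI_gens n" T "is_super_ideal n"] unfolding SI_eq by blast

lemma eps_0 [simp]: "eps 0 = 0" by (simp add: eps_def)

lemma eps_add: "eps (f + g) = eps f + eps g"
  by (rule poly_mapping_eqI) (simp add: lookup_add algebra_simps)

text \<open>The automorphism is multiplicative and preserves invariants, so the elements with image
  in \<open>SI n\<close> form an ideal containing the generators. The Leibniz rule of
  \<open>Dop\<close> requires this.\<close>

lemma SI_eps:
  assumes "f \<in> SI n" shows "eps f \<in> SI n"
proof -
  let ?T = "{f \<in> superspace n. eps f \<in> SI n}"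
  have "is_super_ideal n ?T"
    unfolding is_super_ideal_def
  proof (intro conjI ballI subsetI)
    fix a t assume a: "a \<in> superspace n" and t: "t \<in> ?T"
    then show "a \<circledast> t \<in> ?T" "t \<circledast> a \<in> ?T"
      using SI_smult_left[OF superspace_eps[OF a], of "eps t"] SI_smult_right[OF superspace_eps[OF a], of "eps t"]
      by (auto simp: smult_eps)
  qed (auto simp: SI_0 SI_add eps_add)
  moreover have "SI_gens n \<subseteq> ?T"
    by (auto simp: SI_gens_def sinv_eps intro!: SI_gen)
  ultimately show ?thesis using SI_least[OF _ _ assms] by blast
qed

lemma contract_add: "contract i (f + g) = contract i f + contract i g"
  by (rule poly_mapping_eqI) (simp add: coef_contract lookup_add algebra_simps)

lemma Dop_add: "Dop n j (f + g) = Dop n j f + Dop n j g"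
  by (rule poly_mapping_eqI) (simp add: coef_Dop contract_add lookup_add algebra_simps sum.distrib)

lemma Dop_0 [simp]: "Dop n j 0 = 0"
  by (rule poly_mapping_eqI) (auto simp: coef_Dop coef_contract intro!: sum.neutral)

lemma coef_mult_0:
  fixes p q :: cpoly shows "coef (p * q) 0 = coef p 0 * coef q 0"
proof (induction p rule: poly_mapping_single_induct)
  case (single a c)
  show ?case
  proof (induction q rule: poly_mapping_single_induct)
    case (single b d)
    have "a + b = 0 \<longleftrightarrow> a = 0 \<and> b = 0"
    proof
      assume "a + b = 0"
      then have "supp (a + b) = {}" by simp
      then show "a = 0 \<and> b = 0" by (simp add: supp_add_nat)
    qed simp
    then show ?case by (auto simp: mult_single lookup_single when_def)
  qed (simp_all add: distrib_left lookup_add)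
qed (simp_all add: distrib_right lookup_add)

lemma coef_X_power_0: "j \<ge> 1 \<Longrightarrow> coef (X i ^ j) 0 = 0"
proof -
  assume "j \<ge> 1"
  have "coef (X i) 0 = 0"
    using lookup_single_eq[of i "1::nat"]
    by (auto simp: X_def lookup_single when_def dest: arg_cong[where f = "\<lambda>m. coef m i"])
  then show ?thesis using \<open>j \<ge> 1\<close> by (cases j) (auto simp: coef_mult_0)
qed

text \<open>By the Leibniz rule it suffices to treat generators. Their images are invariant, and
  \<open>1 \<le> j\<close> puts a positive power of some \<open>X i\<close> into every term of the
  theta-free part, so the constant term vanishes.\<close>

lemma SI_Dop:
  assumes "f \<in> SI n" and j: "j \<ge> 1" shows "Dop n j f \<in> SI n"
proof -
  \<comment> \<open>Membership of \<open>f\<close> itself is recorded too, because the Leibniz rule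
    leaves terms in which \<open>t\<close> is not differentiated.\<close>
  let ?T = "{f \<in> SI n. Dop n j f \<in> SI n}"
  have "is_super_ideal n ?T"
    unfolding is_super_ideal_def
  proof (intro conjI ballI subsetI)
    fix a t assume a: "a \<in> superspace n" and t: "t \<in> ?T"
    have ts: "t \<in> superspace n" using t SI_superspace by blast
    show "a \<circledast> t \<in> ?T" "t \<circledast> a \<in> ?T"
      using a t ts SI_eps[of t n] SI_smult_left[of _ n] SI_smult_right[of _ n]
      by (simp_all add: Dop_smult SI_add superspace_eps superspace_Dop)
  qed (auto simp: SI_0 SI_add Dop_add intro: SI_superspace)
  moreover have "SI_gens n \<subseteq> ?T"
  proof
    fix f assume f: "f \<in> SI_gens n"
    have "coef (coef (Dop n j f) {}) 0 = 0"
      by (simp add: coef_Dop lookup_sum coef_mult_0 coef_X_power_0[OF j])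
    then have "Dop n j f \<in> SI_gens n" using f by (auto simp: SI_gens_def sinv_Dop)
    then show "f \<in> ?T" using f by (simp add: SI_gen)
  qed
  ultimately show ?thesis using SI_least[OF _ _ assms(1)] by blast
qed

text \<open>Taking the theta-free part is a ring homomorphism that sends the generators of
  \<open>SI n\<close> to symmetric polynomials without constant term.\<close>

lemma SI_coef_empty:
  assumes "f \<in> SI n" shows "coef f {} \<in> coinv_ideal n"
proof -
  note I = coinv_ideal_ideal[of n]
  let ?T = "{f \<in> superspace n. coef f {} \<in> coinv_ideal n}"
  have "is_super_ideal n ?T"
    unfolding is_super_ideal_def
    by (simp add: lookup_add coef_smult superspace_coef superspace_add superspace_smult
        ideal_0[OF I] ideal_add[OF I] ideal_mult[OF I] ideal_mult_right[OF I])
  moreover have "SI_gens n \<subseteq> ?T"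
  proof
    fix f assume f: "f \<in> SI_gens n"
    have "pperm w (coef f {}) = coef f {}" if "w permutes {1..n}" for w
    proof -
      have "coef f (w ` {}) = (-1) ^ invs w {} * pperm w (coef f {})"
        using f that unfolding SI_gens_def sinv_def by blast
      then show ?thesis by (simp add: invs_def)
    qed
    then have "coef f {} \<in> coinv_ideal n"
      using f unfolding coinv_ideal_def by (intro hull_inc) (auto simp: SI_gens_def superspace_coef)
    then show "f \<in> ?T" using f by (simp add: SI_gens_def)
  qed
  ultimately show ?thesis using SI_least[OF _ _ assms] by blast
qed

lemma SI_of_poly:
  assumes "p \<in> coinv_ideal n" shows "of_poly p \<in> SI n"
proof -
  have "coinv_ideal n \<subseteq> {p \<in> polys n. of_poly p \<in> SI n}"
    unfolding coinv_ideal_def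
  proof (rule hull_minimal)
    show "is_poly_ideal n {p \<in> polys n. of_poly p \<in> SI n}"
      unfolding is_poly_ideal_def
    proof (intro conjI ballI subsetI)
      fix a t assume a: "a \<in> polys n" and t: "t \<in> {p \<in> polys n. of_poly p \<in> SI n}"
      have "of_poly (a * t) = of_poly a \<circledast> of_poly t" by (simp add: of_poly_def smult_single)
      then show "a * t \<in> {p \<in> polys n. of_poly p \<in> SI n}"
        using a t SI_smult_left[OF superspace_of_poly[OF a]] by auto
    qed (auto simp: SI_0 of_poly_def single_add intro: SI_add)
    show "{p \<in> polys n. (\<forall>w. w permutes {1..n} \<longrightarrow> pperm w p = p) \<and> coef p 0 = 0} \<subseteq> {p \<in> polys n. of_poly p \<in> SI n}"
    proof
      fix p assume p: "p \<in> {p \<in> polys n. (\<forall>w. w permutes {1..n} \<longrightarrow> pperm w p = p) \<and> coef p 0 = 0}"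
      have "sinv n (of_poly p)"
        using p by (auto simp: sinv_def of_poly_def lookup_single when_def invs_def)
      then have "of_poly p \<in> SI_gens n"
        using p by (auto simp: SI_gens_def of_poly_def)
      then show "p \<in> {p \<in> polys n. of_poly p \<in> SI n}" using p SI_gen by auto
    qed
  qed
  then show ?thesis using assms by blast
qed

text \<open>Up to scalars these are the exterior derivatives of the power sums. The case
  \<open>k = 0\<close> is included, as the condition on the constant term concerns only the
  theta-free part.\<close>

lemma SI_power_theta: "(\<Sum>i=1..n. sing {i} (X i ^ k)) \<in> SI n"
proof (rule SI_gen)
  let ?f = "\<Sum>i=1..n. sing {i} (X i ^ k) :: sform"
  have c: "coef ?f K = (if \<exists>i\<in>{1..n}. K = {i} then X (THE i. K = {i}) ^ k else 0)" for K
  proof (cases "\<exists>i\<in>{1..n}. K = {i}")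
    case True
    then obtain i where i: "i \<in> {1..n}" "K = {i}" by blast
    have "coef ?f K = (\<Sum>j=1..n. if j = i then X j ^ k else 0)"
      by (auto simp: lookup_sum lookup_single when_def i(2) intro!: sum.cong)
    then show ?thesis using i by auto
  next
    case False
    then have "coef ?f K = (\<Sum>j=1..n. 0)"
      unfolding lookup_sum by (intro sum.cong refl lookup_single_not_eq) blast
    then show ?thesis using False by simp
  qed
  have "sinv n ?f"
    unfolding sinv_def
  proof (intro allI impI)
    fix w K assume w: "w permutes {1..n}" and K: "K \<subseteq> {1..n}"
    have b: "bij w" using w by (rule permutes_bij)
    show "coef ?f (w ` K) = (-1) ^ invs w K * pperm w (coef ?f K)"
    proof (cases "\<exists>i\<in>{1..n}. K = {i}")
      case True
      then obtain i where i: "i \<in> {1..n}" "K = {i}" by blast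
      have "invs w {} = 0" by (simp add: invs_def)
      then have "invs w {i} = 0" using invs_insert[of "{}" i w] by simp
      moreover have "w i \<in> {1..n}" using permutes_in_image[OF w] i by blast
      ultimately show ?thesis using i unfolding c by (simp add: pperm_power pperm_X b)
    next
      case False
      have "\<not> (\<exists>i\<in>{1..n}. w ` K = {i})"
      proof
        assume "\<exists>i\<in>{1..n}. w ` K = {i}"
        then have "card K = 1" using b by (metis card_image bij_is_inj inj_on_subset subset_UNIV is_singletonI is_singleton_altdef)
        then show False using False K by (auto simp: card_1_singleton_iff)
      qed
      then show ?thesis using False unfolding c by simp
    qed
  qed
  moreover have "?f \<in> superspace n" by (intro superspace_sum superspace_single polys_power polys_X) auto
  moreover have "coef ?f {} = 0" unfolding c by simp
  ultimately show "?f \<in> SI_gens n" by (simp add: SI_gens_def)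
qed

section \<open>The contraction pairing and superharmonics\<close>

text \<open>The binomial coefficient r choose 2: contracting a product of r thetas by its own
  factors, last one first, costs r - 1, r - 2, ..., 0 signs.\<close>

definition c2 :: "nat \<Rightarrow> nat" where "c2 r = \<Sum>{..<r}"

lemma c2_0 [simp]: "c2 0 = 0" and c2_Suc: "c2 (Suc r) = c2 r + r"
  by (simp_all add: c2_def)

lemma c2_add: "c2 (a + b) = c2 a + c2 b + a * b"
  by (induction b) (simp_all add: c2_Suc)

lemma cr_swap:
  assumes "finite A" "finite B" "A \<inter> B = {}"
  shows "cr A B + cr B A = card A * card B"
  using assms
proof (induction A rule: finite_induct)
  case (insert i A)
  then have "lt B i + gt B i = card B" by (intro lt_gt) auto
  then show ?case using insert by (simp add: cr_insert_left cr_insert_right)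
qed simp

lemma coef_foldr_contract:
  assumes "sorted_wrt (<) ks" "finite L"
  shows "coef (foldr contract ks v) L =
    (if set ks \<inter> L = {} then (-1) ^ (cr (set ks) L + c2 (length ks)) * coef v (set ks \<union> L) else 0)"
  using assms
proof (induction ks arbitrary: L)
  case (Cons k ks)
  have k: "k \<notin> set ks" "\<And>l. l \<in> set ks \<Longrightarrow> k < l" using Cons.prems by auto
  have "gt (set ks) k = length ks"
  proof -
    have "{l \<in> set ks. k < l} = set ks" using k by auto
    moreover have "distinct ks" using Cons.prems(1) by (simp add: strict_sorted_iff)
    ultimately show ?thesis by (simp add: gt_def distinct_card)
  qed
  then have "cr (insert k (set ks)) L + c2 (length (k # ks)) = lt L k + (cr (set ks) (insert k L) + c2 (length ks))" if "k \<notin> L"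
    using k(1) Cons.prems(2) that by (simp add: cr_insert_left cr_insert_right c2_Suc)
  then show ?case
    using Cons.IH[of "insert k L"] Cons.prems k(1)
    by (auto simp: coef_contract power_add)
qed simp

lemma pdiff_0 [simp]: "pdiff i 0 = 0" by (simp add: pdiff_def)

lemma coef_sdiff: "coef (sdiff i f) K = pdiff i (coef f K)"
  by (simp add: sdiff_def map.rep_eq when_def)

lemma coef_sdiff_funpow: "coef ((sdiff i ^^ k) f) K = (pdiff i ^^ k) (coef f K)"
  by (induction k) (simp_all add: coef_sdiff)

lemma coef_mono_op: "coef (mono_op m K g) L = pmono_op m (coef (foldr contract (sorted_list_of_set K) g) L)"
proof -
  have "coef (foldr (\<lambda>i. sdiff i ^^ coef m i) is h) L = foldr (\<lambda>i. pdiff i ^^ coef m i) is (coef h L)" for "is" h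
    by (induction "is") (simp_all add: coef_sdiff_funpow)
  then show ?thesis by (simp add: mono_op_def pmono_op_def)
qed

lemma coef_sodot_contract:
  "coef (f \<Odot> g) L = (\<Sum>K\<in>supp f. act (coef f K) (coef (foldr contract (sorted_list_of_set K) g) L))"
  by (simp add: sodot_def lookup_sum lookup_sscale coef_mono_op act_def)

lemma coef_sodot:
  assumes f: "f \<in> superspace n" and L: "finite L"
  shows "coef (f \<Odot> g) L = (\<Sum>K\<in>Pow {1..n}. if K \<inter> L = {} then
    (-1) ^ (cr K L + c2 (card K)) * act (coef f K) (coef g (K \<union> L)) else 0)"
proof -
  have "coef (f \<Odot> g) L = (\<Sum>K\<in>supp f. if K \<inter> L = {} then
      (-1) ^ (cr K L + c2 (card K)) * act (coef f K) (coef g (K \<union> L)) else 0)"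
    unfolding coef_sodot_contract
  proof (rule sum.cong[OF refl])
    fix K assume "K \<in> supp f"
    then have "finite K" using superspace_finite[OF f] by blast
    then show "act (coef f K) (coef (foldr contract (sorted_list_of_set K) g) L) = (if K \<inter> L = {} then
      (-1) ^ (cr K L + c2 (card K)) * act (coef f K) (coef g (K \<union> L)) else 0)"
      using coef_foldr_contract[of "sorted_list_of_set K" L g] L
      by (simp add: strict_sorted_iff act_sign_right)
  qed
  also have "\<dots> = (\<Sum>K\<in>Pow {1..n}. if K \<inter> L = {} then
    (-1) ^ (cr K L + c2 (card K)) * act (coef f K) (coef g (K \<union> L)) else 0)"
    using f by (intro sum.mono_neutral_left) (auto simp: superspace_def in_keys_iff)
  finally show ?thesis .
qed

lemma superspace_sodot [intro]:
  assumes g: "g \<in> superspace n" shows "f \<Odot> g \<in> superspace n"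
proof -
  have c: "foldr contract ks g \<in> superspace n" for ks
    by (induction ks) (use g in auto)
  show ?thesis
    unfolding superspace_iff
  proof (intro allI impI conjI)
    fix L assume nz: "coef (f \<Odot> g) L \<noteq> 0"
    show "L \<subseteq> {1..n}"
    proof (rule ccontr)
      assume "\<not> L \<subseteq> {1..n}"
      then have "coef (f \<Odot> g) L = 0"
        unfolding coef_sodot_contract by (simp add: superspace_coef_0[OF c])
      then show False using nz by simp
    qed
    show "coef (f \<Odot> g) L \<in> polys n"
      unfolding coef_sodot_contract using c by (intro polys_sum polys_act superspace_coef)
  qed
qed

lemma coef_of_poly_sodot [simp]: "coef (of_poly q \<Odot> v) L = act q (coef v L)"
  by (cases "q = 0") (auto simp: coef_sodot_contract of_poly_def)

definition pair :: "sform \<Rightarrow> sform \<Rightarrow> cpoly" where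
  "pair f v = coef (f \<Odot> v) {}"

lemma pair_eq:
  "f \<in> superspace n \<Longrightarrow> pair f v = (\<Sum>K\<in>Pow {1..n}. (-1) ^ c2 (card K) * act (coef f K) (coef v K))"
  by (simp add: pair_def coef_sodot)

lemma pair_add_left:
  "f \<in> superspace n \<Longrightarrow> g \<in> superspace n \<Longrightarrow> pair (f + g) v = pair f v + pair g v"
  by (simp add: pair_eq[of _ n] superspace_add lookup_add act_add_left distrib_left sum.distrib)

lemma pair_sum_left:
  "(\<And>i. i \<in> A \<Longrightarrow> f i \<in> superspace n) \<Longrightarrow> pair (sum f A) v = (\<Sum>i\<in>A. pair (f i) v)"
  by (induction A rule: infinite_finite_induct)
    (auto simp: pair_add_left[of _ n] superspace_sum, simp_all add: pair_eq[of _ n])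

lemma pair_add_right: "f \<in> superspace n \<Longrightarrow> pair f (v + w) = pair f v + pair f w"
  by (simp add: pair_eq[of _ n] lookup_add act_add_right distrib_left sum.distrib)

lemma pair_sum_right: "f \<in> superspace n \<Longrightarrow> pair f (sum v A) = (\<Sum>i\<in>A. pair f (v i))"
  by (induction A rule: infinite_finite_induct)
    (auto simp: pair_add_right[of _ n], simp_all add: pair_eq[of _ n])

lemma pair_of_poly_left:
  "f \<in> superspace n \<Longrightarrow> q \<in> polys n \<Longrightarrow> pair (of_poly q \<circledast> f) v = act q (pair f v)"
  by (simp add: pair_eq[of _ n] superspace_smult superspace_of_poly act_sum_right act_sign_right act_mult)

lemma pair_act_right:
  "f \<in> superspace n \<Longrightarrow> (\<And>K. coef v' K = act q (coef v K)) \<Longrightarrow> pair f v' = act q (pair f v)"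
  by (simp add: pair_eq[of _ n] act_sum_right act_sign_right act_commute[of q])

text \<open>The pairing sees only the theta-free part of \<open>f \<Odot> v\<close>; multiplying
  \<open>f\<close> by \<open>\<theta>\<^sub>L\<close> exposes the coefficient at \<open>L\<close>.
  As \<open>SI n\<close> is closed under this multiplication, vanishing of the pairing suffices for
  \<open>SH n\<close>, see \<open>SH_I\<close>.\<close>

lemma pair_single_left:
  assumes L: "L \<subseteq> {1..n}" and f: "f \<in> superspace n"
  shows "pair (sing L 1 \<circledast> f) v = (-1) ^ c2 (card L) * coef (f \<Odot> v) L"
proof -
  have fin: "finite M" if "M \<subseteq> {1..n}" for M using that by (rule finite_subset) auto
  have c: "coef (sing L 1 \<circledast> f) M = (if L \<subseteq> M then (-1) ^ cr L (M - L) * coef f (M - L) else 0)"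
    if "M \<subseteq> {1..n}" for M
  proof -
    have "coef (sing L 1 \<circledast> f) M = (\<Sum>A\<in>Pow M. if A = L then (-1) ^ cr A (M - A) * coef f (M - A) else 0)"
      unfolding coef_smult[OF fin[OF that]] by (intro sum.cong) (auto simp: lookup_single when_def)
    then show ?thesis using fin[OF that] by (auto simp: sum.delta)
  qed
  have "pair (sing L 1 \<circledast> f) v = (\<Sum>M\<in>Pow {1..n}. (-1) ^ c2 (card M) * act (coef (sing L 1 \<circledast> f) M) (coef v M))"
    using L f by (intro pair_eq superspace_smult superspace_single) auto
  also have "\<dots> = (\<Sum>M\<in>{M\<in>Pow {1..n}. L \<subseteq> M}. (-1) ^ c2 (card M) * act ((-1) ^ cr L (M - L) * coef f (M - L)) (coef v M))"
    by (intro sum.mono_neutral_cong_right) (auto simp: c)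
  also have "\<dots> = (\<Sum>K\<in>{K\<in>Pow {1..n}. K \<inter> L = {}}. (-1) ^ c2 (card (K \<union> L)) * act ((-1) ^ cr L K * coef f K) (coef v (K \<union> L)))"
    using L by (intro sum.reindex_bij_witness[of _ "\<lambda>K. K \<union> L" "\<lambda>M. M - L"])
      (auto simp: Un_absorb1 Un_absorb2 Diff_triv Un_Diff)
  also have "\<dots> = (\<Sum>K\<in>{K\<in>Pow {1..n}. K \<inter> L = {}}. (-1) ^ c2 (card L) * ((-1) ^ (cr K L + c2 (card K)) * act (coef f K) (coef v (K \<union> L))))"
  proof (rule sum.cong[OF refl])
    fix K assume K: "K \<in> {K\<in>Pow {1..n}. K \<inter> L = {}}"
    have f': "finite K" "finite L" using K L fin by auto
    have "cr K L + cr L K = card K * card L" using K f' by (intro cr_swap) auto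
    moreover have "card (K \<union> L) = card K + card L" using K f' by (intro card_Un_disjoint) auto
    ultimately have "c2 (card (K \<union> L)) + cr L K = c2 (card K) + c2 (card L) + cr K L + 2 * cr L K"
      by (simp add: c2_add)
    then have "(-1 :: cpoly) ^ (c2 (card (K \<union> L)) + cr L K) = (-1) ^ (c2 (card L) + (cr K L + c2 (card K)))"
      by (intro neg1_cong) auto
    then show "(-1) ^ c2 (card (K \<union> L)) * act ((-1) ^ cr L K * coef f K) (coef v (K \<union> L)) =
      (-1) ^ c2 (card L) * ((-1) ^ (cr K L + c2 (card K)) * act (coef f K) (coef v (K \<union> L)))"
      by (simp add: act_sign_left power_add flip: mult.assoc)
  qed
  also have "\<dots> = (-1) ^ c2 (card L) * coef (f \<Odot> v) L"
    unfolding coef_sodot[OF f fin[OF L]] sum_distrib_left[symmetric]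
    by (subst sum.inter_filter) auto
  finally show ?thesis .
qed

section \<open>Superharmonics as the orthogonal complement of the ideal\<close>

lemma SH_superspace: "v \<in> SH n \<Longrightarrow> v \<in> superspace n" by (simp add: SH_def)

lemma SH_pair: "v \<in> SH n \<Longrightarrow> f \<in> SI n \<Longrightarrow> pair f v = 0"
  by (simp add: SH_def pair_def)

lemma SH_I:
  assumes v: "v \<in> superspace n" and p: "\<And>f. f \<in> SI n \<Longrightarrow> pair f v = 0"
  shows "v \<in> SH n"
proof -
  have "f \<Odot> v = 0" if f: "f \<in> SI n" for f
  proof (rule superspace_eqI)
    fix L assume L: "L \<subseteq> {1..n}"
    have "sing L 1 \<circledast> f \<in> SI n" using L f by (intro SI_smult_left superspace_single) auto
    then have "(-1) ^ c2 (card L) * coef (f \<Odot> v) L = 0"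
      using p pair_single_left[OF L SI_superspace[OF f]] by metis
    then show "coef (f \<Odot> v) L = coef 0 L" by simp
  qed (use v in auto)
  then show ?thesis using v by (simp add: SH_def)
qed

lemma SH_0: "0 \<in> SH n"
  by (rule SH_I) (auto simp: pair_eq[OF SI_superspace])

lemma SH_add: "v \<in> SH n \<Longrightarrow> w \<in> SH n \<Longrightarrow> v + w \<in> SH n"
  by (rule SH_I) (auto simp: SH_superspace SH_pair pair_add_right[OF SI_superspace])

lemma SH_sum: "(\<And>i. i \<in> A \<Longrightarrow> f i \<in> SH n) \<Longrightarrow> sum f A \<in> SH n"
  by (induction A rule: infinite_finite_induct) (auto simp: SH_0 SH_add)

lemma SH_of_poly: "v \<in> SH n \<Longrightarrow> of_poly q \<Odot> v \<in> SH n"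
  by (rule SH_I) (auto simp: SH_superspace SH_pair pair_act_right[OF SI_superspace, where q = q and v = v])

lemma act_const: "act (sing 0 c) q = pscale c q"
proof -
  have "sing 0 c = pscale c 1" by (simp add: pscale_def)
  then show ?thesis by (simp add: act_pscale_left)
qed

lemma SH_sscale: "v \<in> SH n \<Longrightarrow> sscale c v \<in> SH n"
  using SH_of_poly[of v n "sing 0 c"]
  by (metis (no_types, lifting) coef_of_poly_sodot act_const lookup_sscale poly_mapping_eqI)

lemma coef_smult_theta:
  assumes K: "finite K"
  shows "coef (v \<circledast> theta i) K = (if i \<in> K then (-1) ^ gt K i * coef v (K - {i}) else 0)"
proof -
  have iff: "K - A = {i} \<longleftrightarrow> i \<in> K \<and> A = K - {i}" if "A \<subseteq> K" for A using that by auto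
  have "coef (v \<circledast> theta i) K = (\<Sum>A\<in>Pow K. if K - A = {i} then (-1) ^ cr A {i} * coef v A else 0)"
    unfolding coef_smult[OF K] by (intro sum.cong) (auto simp: theta_def lookup_single when_def)
  also have "\<dots> = (\<Sum>A\<in>Pow K. if A = K - {i} then (if i \<in> K then (-1) ^ cr A {i} * coef v A else 0) else 0)"
    by (intro sum.cong refl) (auto simp: iff)
  also have "\<dots> = (if i \<in> K then (-1) ^ cr (K - {i}) {i} * coef v (K - {i}) else 0)"
    using K by (subst sum.delta) auto
  also have "cr (K - {i}) {i} = gt K i"
  proof -
    have "{k \<in> K - {i}. i < k} = {k \<in> K. i < k}" by auto
    then show ?thesis using K by (simp add: cr_single_right gt_def)
  qed
  finally show ?thesis .
qed

text \<open>Multiplication from the right counts the indices above \<open>i\<close>, contraction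
  those below. The two counts add up to \<open>card A\<close>, which is the increment of
  \<open>c2\<close> when \<open>i\<close> is added to \<open>A\<close>.\<close>

lemma pair_smult_theta:
  assumes f: "f \<in> superspace n" and i: "i \<in> {1..n}"
  shows "pair f (v \<circledast> theta i) = pair (contract i f) v"
proof -
  have fin: "finite M" if "M \<subseteq> {1..n}" for M using that by (rule finite_subset) auto
  have "pair f (v \<circledast> theta i) = (\<Sum>K\<in>{K\<in>Pow {1..n}. i \<in> K}. (-1) ^ c2 (card K) * act (coef f K) ((-1) ^ gt K i * coef v (K - {i})))"
    unfolding pair_eq[OF f] by (intro sum.mono_neutral_cong_right) (auto simp: coef_smult_theta fin)
  also have "\<dots> = (\<Sum>A\<in>{A\<in>Pow {1..n}. i \<notin> A}. (-1) ^ c2 (card (insert i A)) * act (coef f (insert i A)) ((-1) ^ gt (insert i A) i * coef v A))"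
    using i by (intro sum.reindex_bij_witness[of _ "insert i" "\<lambda>K. K - {i}"]) (auto simp: insert_absorb)
  also have "\<dots> = (\<Sum>A\<in>{A\<in>Pow {1..n}. i \<notin> A}. (-1) ^ c2 (card A) * act ((-1) ^ lt A i * coef f (insert i A)) (coef v A))"
  proof (rule sum.cong[OF refl])
    fix A assume A: "A \<in> {A\<in>Pow {1..n}. i \<notin> A}"
    have fA: "finite A" "i \<notin> A" using A fin by auto
    have "{k \<in> insert i A. i < k} = {k \<in> A. i < k}" by auto
    then have g: "gt (insert i A) i = gt A i" by (simp add: gt_def)
    have "card A = lt A i + gt A i" using fA by (simp add: lt_gt)
    then have "(-1 :: cpoly) ^ (c2 (card (insert i A)) + gt (insert i A) i) = (-1) ^ (c2 (card A) + lt A i)"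
      using fA g by (intro neg1_cong) (auto simp: c2_Suc)
    then show "(-1) ^ c2 (card (insert i A)) * act (coef f (insert i A)) ((-1) ^ gt (insert i A) i * coef v A)
       = (-1) ^ c2 (card A) * act ((-1) ^ lt A i * coef f (insert i A)) (coef v A)"
      by (simp add: act_sign_left act_sign_right power_add flip: mult.assoc)
  qed
  also have "\<dots> = pair (contract i f) v"
    unfolding pair_eq[OF superspace_contract[OF f]]
    by (intro sum.mono_neutral_cong_left) (auto simp: coef_contract)
  finally show ?thesis .
qed

lemma superspace_theta: "i \<in> {1..n} \<Longrightarrow> theta i \<in> superspace n"
  unfolding theta_def by (intro superspace_single) auto

lemma superspace_sdiff_funpow:
  assumes "v \<in> superspace n" shows "(sdiff i ^^ k) v \<in> superspace n"
  using assms unfolding superspace_iff coef_sdiff_funpow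
  by (metis act_0_right act_X_power polys_act)

lemma superspace_dj: "v \<in> superspace n \<Longrightarrow> dj n j v \<in> superspace n"
  unfolding dj_def by (intro superspace_sum superspace_smult superspace_theta superspace_sdiff_funpow)

lemma pair_dj:
  assumes f: "f \<in> superspace n"
  shows "pair f (dj n j v) = pair (Dop n j f) v"
proof -
  have "pair f (dj n j v) = (\<Sum>i=1..n. pair (contract i f) ((sdiff i ^^ j) v))"
    by (simp add: dj_def pair_sum_right[OF f] pair_smult_theta[OF f])
  also have "\<dots> = (\<Sum>i=1..n. pair (of_poly (X i ^ j) \<circledast> contract i f) v)"
  proof (rule sum.cong[OF refl])
    fix i assume i: "i \<in> {1..n}"
    have "pair (contract i f) ((sdiff i ^^ j) v) = act (X i ^ j) (pair (contract i f) v)"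
      using f by (intro pair_act_right[of _ n]) (auto simp: coef_sdiff_funpow act_X_power)
    then show "pair (contract i f) ((sdiff i ^^ j) v) = pair (of_poly (X i ^ j) \<circledast> contract i f) v"
      using f i by (subst pair_of_poly_left[of _ n]) auto
  qed
  also have "\<dots> = pair (Dop n j f) v"
    unfolding Dop_def using f
    by (intro pair_sum_left[symmetric, of _ _ n] superspace_smult superspace_of_poly polys_power polys_X superspace_contract)
  finally show ?thesis .
qed

lemma SH_dj:
  assumes "v \<in> SH n" "1 \<le> j" shows "dj n j v \<in> SH n"
  using assms
  by (intro SH_I) (simp_all add: superspace_dj SH_superspace pair_dj SI_superspace SH_pair SI_Dop)

lemma SH_vandermonde: "of_poly (vandermonde n) \<in> SH n"
proof (rule SH_I)
  fix f assume f: "f \<in> SI n"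
  have "pair f (of_poly (vandermonde n)) = (\<Sum>K\<in>Pow {1..n}. if K = {} then act (coef f {}) (vandermonde n) else 0)"
    unfolding pair_eq[OF SI_superspace[OF f]]
    by (intro sum.cong) (auto simp: of_poly_def lookup_single when_def)
  also have "\<dots> = act (coef f {}) (vandermonde n)" by (simp add: sum.delta)
  also have "\<dots> = 0"
    using SI_coef_empty[OF f] coinv_ideal_subset_ann by (auto simp: ann_def)
  finally show "pair f (of_poly (vandermonde n)) = 0" .
qed auto

lemma SH_dI:
  assumes "I \<subseteq> {1..n}" "v \<in> SH n" shows "dI n I v \<in> SH n"
proof -
  have "\<forall>j\<in>set js. 1 \<le> j \<Longrightarrow> foldr (dj n) js v \<in> SH n" for js
    by (induction js) (use assms(2) SH_dj in auto)
  moreover have "finite I" using assms(1) by (rule finite_subset) auto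
  ultimately show ?thesis using assms(1) unfolding dI_def by force
qed

lemma SH_D_op: "v \<in> SH n \<Longrightarrow> D_op n J v \<in> SH n"
  unfolding D_op_def by (intro SH_sum SH_sscale SH_of_poly SH_dI) auto

lemma coef_dj:
  assumes K: "K \<subseteq> {1..n}"
  shows "coef (dj n j v) K = (\<Sum>i\<in>K. (-1) ^ gt K i * act (X i ^ j) (coef v (K - {i})))"
proof -
  have fin: "finite K" using K by (rule finite_subset) auto
  have "coef (dj n j v) K = (\<Sum>i=1..n. if i \<in> K then (-1) ^ gt K i * act (X i ^ j) (coef v (K - {i})) else 0)"
    by (simp add: dj_def lookup_sum coef_smult_theta[OF fin] coef_sdiff_funpow act_X_power cong: if_cong)
  also have "\<dots> = (\<Sum>i\<in>K. (-1) ^ gt K i * act (X i ^ j) (coef v (K - {i})))"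
    using K by (intro sum.mono_neutral_cong_right) auto
  finally show ?thesis .
qed

section \<open>Determinants of lists of vectors\<close>

text \<open>The coefficient of \<open>\<theta>\<^sub>K\<close> in the product of the forms \<open>\<Sum>c. v c \<theta>\<^sub>c\<close>, taken in the order of the
  list.\<close>

fun dt :: "nat set \<Rightarrow> (nat \<Rightarrow> cpoly) list \<Rightarrow> cpoly" where
  "dt K [] = (if K = {} then 1 else 0)"
| "dt K (v # vs) = (\<Sum>c\<in>K. (-1) ^ lt K c * v c * dt (K - {c}) vs)"

lemma dt_card:
  assumes "finite K" "card K \<noteq> length vs" shows "dt K vs = 0"
  using assms
proof (induction vs arbitrary: K)
  case (Cons v vs)
  have "dt (K - {c}) vs = 0" if "c \<in> K" for c
    using that Cons.prems card_Suc_Diff1[of K c] by (intro Cons.IH) auto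
  then show ?case by simp
qed auto

text \<open>Generalized Laplace expansion: the columns \<open>K\<close> are distributed over the two
  blocks of vectors. The induction exchanges the choice of \<open>A\<close> with the choice of the
  column used by the first vector.\<close>

lemma dt_append:
  assumes "finite K"
  shows "dt K (us @ vs) = (\<Sum>A\<in>Pow K. (-1) ^ cr A (K - A) * dt A us * dt (K - A) vs)"
  using assms
proof (induction us arbitrary: K)
  case Nil
  have "(\<Sum>A\<in>Pow K. (-1) ^ cr A (K - A) * dt A [] * dt (K - A) vs)
      = (\<Sum>A\<in>Pow K. if A = {} then dt K vs else 0)"
    by (intro sum.cong) auto
  then show ?case using Nil by (simp add: sum.delta)
next
  case (Cons u us)
  have fin: "finite A" if "A \<subseteq> K" for A using that Cons.prems by (rule finite_subset)
  have "(\<Sum>A\<in>Pow K. (-1) ^ cr A (K - A) * dt A (u # us) * dt (K - A) vs)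
      = (\<Sum>(A, c)\<in>(SIGMA A:Pow K. A). (-1) ^ (cr A (K - A) + lt A c) * u c * dt (A - {c}) us * dt (K - A) vs)"
    by (subst sum.Sigma[symmetric]) (auto simp: fin Cons.prems sum_distrib_left sum_distrib_right
        power_add mult.assoc intro!: sum.cong)
  also have "\<dots> = (\<Sum>(c, A)\<in>(SIGMA c:K. Pow (K - {c})).
      (-1) ^ (lt K c + cr A (K - {c} - A)) * u c * dt A us * dt (K - {c} - A) vs)"
  proof (rule sum.reindex_bij_witness[of _ "\<lambda>(c, A). (insert c A, c)" "\<lambda>(A, c). (c, A - {c})"])
    fix x assume x: "x \<in> (SIGMA A:Pow K. A)"
    obtain A c where Ac: "x = (A, c)" "A \<subseteq> K" "c \<in> A" using x by auto
    define A' where "A' = A - {c}"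
    define B where "B = K - A"
    have B: "A = insert c A'" "c \<notin> A'" "K - {c} - A' = B" "c \<notin> B" "finite A'" "finite B" "K = insert c (A' \<union> B)" "A' \<inter> B = {}"
      using Ac Cons.prems fin[OF Ac(2)] by (auto simp: A'_def B_def)
    have "lt K c = lt A' c + lt B c" "lt A c = lt A' c"
      using B by (auto simp: lt_insert lt_Un)
    then have "(-1 :: cpoly) ^ (lt K c + cr A' B) = (-1) ^ (cr A B + lt A c)"
      using B by (intro neg1_cong) (auto simp: cr_insert_left)
    then show "(case (case x of (A, c) \<Rightarrow> (c, A - {c})) of
        (c, A) \<Rightarrow> (-1) ^ (lt K c + cr A (K - {c} - A)) * u c * dt A us * dt (K - {c} - A) vs) =
      (case x of (A, c) \<Rightarrow> (-1) ^ (cr A (K - A) + lt A c) * u c * dt (A - {c}) us * dt (K - A) vs)"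
      using B(3) by (simp add: Ac A'_def[symmetric] B_def[symmetric])
  qed (auto simp: insert_absorb)
  also have "\<dots> = (\<Sum>c\<in>K. (-1) ^ lt K c * u c * (\<Sum>A\<in>Pow (K - {c}). (-1) ^ cr A (K - {c} - A) * dt A us * dt (K - {c} - A) vs))"
    by (subst sum.Sigma[symmetric]) (auto simp: Cons.prems sum_distrib_left power_add mult.assoc mult.left_commute intro!: sum.cong)
  also have "\<dots> = dt K ((u # us) @ vs)"
    using Cons by simp
  finally show ?case by simp
qed

text \<open>Expansion along the last vector, which is the shape of the recursion in
  \<open>coef_dj\<close>.\<close>

lemma dt_snoc:
  assumes K: "finite K"
  shows "dt K (vs @ [v]) = (\<Sum>i\<in>K. (-1) ^ gt K i * v i * dt (K - {i}) vs)"
proof -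
  have "dt K (vs @ [v]) = (\<Sum>A\<in>Pow K. (-1) ^ cr A (K - A) * dt A vs * dt (K - A) [v])"
    by (rule dt_append[OF K])
  also have "\<dots> = (\<Sum>A\<in>(\<lambda>i. K - {i}) ` K. (-1) ^ cr A (K - A) * dt A vs * dt (K - A) [v])"
  proof (rule sum.mono_neutral_right)
    show "\<forall>A\<in>Pow K - (\<lambda>i. K - {i}) ` K. (-1) ^ cr A (K - A) * dt A vs * dt (K - A) [v] = 0"
    proof
      fix A assume A: "A \<in> Pow K - (\<lambda>i. K - {i}) ` K"
      have "card (K - A) \<noteq> 1"
      proof
        assume "card (K - A) = 1"
        then obtain i where "K - A = {i}" by (metis card_1_singletonE)
        then have "i \<in> K" "A = K - {i}" using A by auto
        then show False using A by blast
      qed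
      then have "dt (K - A) [v] = 0" using K by (intro dt_card) auto
      then show "(-1) ^ cr A (K - A) * dt A vs * dt (K - A) [v] = 0" by simp
    qed
  qed (use K in auto)
  also have "\<dots> = (\<Sum>i\<in>K. (-1) ^ cr (K - {i}) (K - (K - {i})) * dt (K - {i}) vs * dt (K - (K - {i})) [v])"
    by (rule sum.reindex_cong[of "\<lambda>i. K - {i}"]) (auto simp: inj_on_def)
  also have "\<dots> = (\<Sum>i\<in>K. (-1) ^ gt K i * v i * dt (K - {i}) vs)"
  proof (rule sum.cong[OF refl])
    fix i assume i: "i \<in> K"
    have "K - (K - {i}) = {i}" using i by auto
    moreover have "{k \<in> K - {i}. i < k} = {k \<in> K. i < k}" by auto
    moreover have "lt {i} i = 0" by (simp add: lt_def)
    ultimately show "(-1) ^ cr (K - {i}) (K - (K - {i})) * dt (K - {i}) vs * dt (K - (K - {i})) [v]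
        = (-1) ^ gt K i * v i * dt (K - {i}) vs"
      using K by (simp add: cr_single_right gt_def)
  qed
  finally show ?thesis .
qed

lemma dt_swap_head:
  assumes "finite K" shows "dt K (u # v # vs) = - dt K (v # u # vs)"
proof -
  have expand: "dt K (u # v # vs) = (\<Sum>(c, d)\<in>(SIGMA c:K. K - {c}).
      (-1) ^ (lt K c + lt (K - {c}) d) * u c * v d * dt (K - {c} - {d}) vs)" for u v
    using assms by (subst sum.Sigma[symmetric])
      (auto simp: sum_distrib_left power_add mult.assoc mult.left_commute intro!: sum.cong)
  have "dt K (u # v # vs) = (\<Sum>(c, d)\<in>(SIGMA c:K. K - {c}).
      - ((-1) ^ (lt K c + lt (K - {c}) d) * v c * u d * dt (K - {c} - {d}) vs))"
    unfolding expand
  proof (rule sum.reindex_bij_witness[of _ "\<lambda>(c, d). (d, c)" "\<lambda>(c, d). (d, c)"])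
    fix x assume "x \<in> (SIGMA c:K. K - {c})"
    then obtain c d where x: "x = (c, d)" "c \<in> K" "d \<in> K" "c \<noteq> d" by auto
    have c: "lt K d = lt (K - {c}) d + (if c < d then 1 else 0)" "lt K c = lt (K - {d}) c + (if d < c then 1 else 0)"
      using lt_insert[of "K - {c}" c d] lt_insert[of "K - {d}" d c] x assms by (simp_all add: insert_absorb)
    have "(-1 :: cpoly) ^ (lt K d + lt (K - {d}) c) = - ((-1) ^ (lt K c + lt (K - {c}) d))"
      unfolding c using x by (auto simp: power_add)
    moreover have "K - {d} - {c} = K - {c} - {d}" by auto
    ultimately show "(case (case x of (c, d) \<Rightarrow> (d, c)) of (c, d) \<Rightarrow>
         - ((-1) ^ (lt K c + lt (K - {c}) d) * v c * u d * dt (K - {c} - {d}) vs))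
       = (case x of (c, d) \<Rightarrow> (-1) ^ (lt K c + lt (K - {c}) d) * u c * v d * dt (K - {c} - {d}) vs)"
      by (simp add: x mult.assoc mult.left_commute)
  qed auto
  also have "\<dots> = - dt K (v # u # vs)"
    unfolding expand by (simp add: sum_negf case_prod_beta)
  finally show ?thesis .
qed

lemma dt_swap:
  assumes "finite K" shows "dt K (ws @ u # v # vs) = - dt K (ws @ v # u # vs)"
  using assms
proof (induction ws arbitrary: K)
  case Nil
  then show ?case using dt_swap_head by (metis append_Nil)
next
  case (Cons w ws)
  then show ?case by (simp add: sum_negf)
qed

lemma eq_neg_imp_0:
  fixes x :: cpoly assumes "x = - x" shows "x = 0"
proof (rule poly_mapping_eqI)
  fix m
  have "coef x m = - coef x m"
    using arg_cong[OF assms, of "\<lambda>p. coef p m"] by (simp only: lookup_uminus)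
  then show "coef x m = coef 0 m" by (simp add: eq_neg_iff_add_eq_0 flip: mult_2)
qed

lemma dt_repeat:
  assumes "finite K" "v \<in> set vs" shows "dt K (ws @ v # vs) = 0"
  using assms(2)
proof (induction vs arbitrary: ws)
  case (Cons u vs)
  show ?case
  proof (cases "u = v")
    case True
    have "dt K (ws @ v # v # vs) = 0" by (rule eq_neg_imp_0) (rule dt_swap[OF assms(1)])
    then show ?thesis using True by simp
  next
    case False
    then have "dt K ((ws @ [u]) @ v # vs) = 0" using Cons by (intro Cons.IH) auto
    then show ?thesis using dt_swap[OF assms(1), of ws v u vs] by simp
  qed
qed simp

lemma dt_not_distinct:
  assumes "finite K" "\<not> distinct xs" shows "dt K (map f xs) = 0"
proof -
  obtain as x bs cs where "xs = as @ [x] @ bs @ [x] @ cs" using not_distinct_decomp[OF assms(2)] by blast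
  then show ?thesis using dt_repeat[OF assms(1), of "f x" "map f (bs @ x # cs)" "map f as"] by simp
qed

text \<open>The sign is left unspecified, because the diagonal coefficients of \<open>D_op\<close>
  are needed only up to sign.\<close>

lemma dt_insort:
  assumes "finite K"
  shows "\<exists>s. dt K (map f (ws @ x # xs)) = (-1) ^ s * dt K (map f (ws @ insort x xs))"
proof (induction xs arbitrary: ws)
  case Nil
  then show ?case by (intro exI[of _ 0]) simp
next
  case (Cons y xs)
  show ?case
  proof (cases "x \<le> y")
    case True
    then show ?thesis by (intro exI[of _ 0]) simp
  next
    case False
    obtain s where "dt K (map f ((ws @ [y]) @ x # xs)) = (-1) ^ s * dt K (map f ((ws @ [y]) @ insort x xs))"
      using Cons by blast
    then show ?thesis
      using dt_swap[OF assms, of "map f ws" "f x" "f y" "map f xs"] False by (intro exI[of _ "Suc s"]) simp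
  qed
qed

lemma dt_sort:
  assumes "finite K"
  shows "\<exists>s. dt K (map f (ws @ xs)) = (-1) ^ s * dt K (map f (ws @ sort xs))"
proof (induction xs arbitrary: ws)
  case Nil
  then show ?case by (intro exI[of _ 0]) simp
next
  case (Cons x xs)
  obtain s where s: "dt K (map f ((ws @ [x]) @ xs)) = (-1) ^ s * dt K (map f ((ws @ [x]) @ sort xs))"
    using Cons by blast
  obtain t where "dt K (map f (ws @ x # sort xs)) = (-1) ^ t * dt K (map f (ws @ insort x (sort xs)))"
    using dt_insort[OF assms] by blast
  then show ?case using s by (intro exI[of _ "s + t"]) (simp add: power_add)
qed

lemma dt_cong:
  assumes "list_all2 (\<lambda>u v. \<forall>c\<in>K. u c = v c) us vs" shows "dt K us = dt K vs"
proof -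
  have "L \<subseteq> K \<Longrightarrow> dt L us = dt L vs" for L
    using assms
  proof (induction us vs arbitrary: L rule: list_all2_induct)
    case (Cons u us v vs)
    have "dt (L - {c}) us = dt (L - {c}) vs" for c using Cons.prems by (intro Cons.IH) auto
    moreover have "u c = v c" if "c \<in> L" for c using that Cons.prems Cons.hyps by auto
    ultimately show ?case by simp
  qed simp
  then show ?thesis by simp
qed

lemma dt_linear:
  assumes "finite B" "finite K"
  shows "dt K (ws @ (\<lambda>c. \<Sum>b\<in>B. a b * v b c) # vs) = (\<Sum>b\<in>B. a b * dt K (ws @ v b # vs))"
  using assms(2)
proof (induction ws arbitrary: K)
  case Nil
  then show ?case
    by (simp add: sum_distrib_left sum_distrib_right mult.assoc mult.left_commute)
      (subst sum.swap, simp)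
next
  case (Cons w ws)
  then show ?case
    by (simp add: sum_distrib_left sum_distrib_right mult.assoc mult.left_commute)
      (subst sum.swap, simp)
qed

lemma lt_nth:
  assumes "sorted_wrt (<) xs" "i < length xs" shows "lt (set xs) (xs ! i) = i"
proof -
  have m: "j < k \<Longrightarrow> k < length xs \<Longrightarrow> xs ! j < xs ! k" for j k
    using assms(1) by (simp add: sorted_wrt_nth_less)
  have "{k \<in> set xs. k < xs ! i} = (\<lambda>j. xs ! j) ` {..<i}"
  proof (intro equalityI subsetI)
    fix k assume "k \<in> {k \<in> set xs. k < xs ! i}"
    then obtain j where "k = xs ! j" "j < length xs" "xs ! j < xs ! i" by (auto simp: in_set_conv_nth)
    moreover from this have "j < i" using m[of i j] by (metis linorder_neqE_nat order_less_asym less_irrefl)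
    ultimately show "k \<in> (\<lambda>j. xs ! j) ` {..<i}" by blast
  qed (use m assms(2) in auto)
  moreover have "inj_on (\<lambda>j. xs ! j) {..<i}"
    using assms by (intro inj_on_nth) (auto simp: strict_sorted_iff)
  ultimately show ?thesis by (simp add: lt_def card_image)
qed

text \<open>The link to the matrix determinant, needed for \<open>minor\<close> and for exchanging
  rows and columns in \<open>dt_transpose\<close>.\<close>

lemma dt_det:
  assumes "sorted_wrt (<) cs" "length us = length cs"
  shows "dt (set cs) us = Determinant.det (mat (length cs) (length cs) (\<lambda>(i, j). (us ! i) (cs ! j)))"
  using assms
proof (induction us arbitrary: cs)
  case Nil
  then show ?case by (simp add: det_dim_zero)
next
  case (Cons u us)
  let ?r = "length cs"
  let ?A = "mat ?r ?r (\<lambda>(i, j). ((u # us) ! i) (cs ! j))"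
  have r: "?r = Suc (length us)" using Cons.prems by simp
  have d: "distinct cs" using Cons.prems(1) by (simp add: strict_sorted_iff)
  have "Determinant.det ?A = (\<Sum>j<?r. ?A $$ (0, j) * cofactor ?A 0 j)"
    using r by (intro laplace_expansion_row) auto
  also have "\<dots> = (\<Sum>j<?r. (-1) ^ lt (set cs) (cs ! j) * u (cs ! j) * dt (set cs - {cs ! j}) us)"
  proof (rule sum.cong[OF refl])
    fix j assume "j \<in> {..<?r}"
    then have j: "j < ?r" by simp
    let ?cs = "take j cs @ drop (Suc j) cs"
    have cs: "cs = take j cs @ cs ! j # drop (Suc j) cs" using j by (rule id_take_nth_drop)
    have s: "sorted_wrt (<) ?cs"
      using Cons.prems(1) by (subst (asm) cs) (auto simp: sorted_wrt_append)
    have "set cs = insert (cs ! j) (set ?cs)" by (subst cs) auto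
    moreover have "cs ! j \<notin> set ?cs"
      using d by (subst (asm) cs) auto
    ultimately have set: "set cs - {cs ! j} = set ?cs" by auto
    have len: "length ?cs = length us" using j r by auto
    have nth: "?cs ! k = cs ! (if k < j then k else Suc k)" if "k < length us" for k
      using that j r by (auto simp: nth_append)
    have "mat_delete ?A 0 j = mat (length ?cs) (length ?cs) (\<lambda>(i, k). (us ! i) (?cs ! k))"
      unfolding mat_delete_def len using r nth by (intro eq_matI) auto
    then have "Determinant.det (mat_delete ?A 0 j) = dt (set cs - {cs ! j}) us"
      unfolding set using Cons.IH[OF s] len by simp
    then show "?A $$ (0, j) * cofactor ?A 0 j = (-1) ^ lt (set cs) (cs ! j) * u (cs ! j) * dt (set cs - {cs ! j}) us"
      using j r by (simp add: cofactor_def lt_nth[OF Cons.prems(1)] mult.left_commute mult.assoc)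
  qed
  also have "\<dots> = (\<Sum>c\<in>set cs. (-1) ^ lt (set cs) c * u c * dt (set cs - {c}) us)"
    using d by (intro sum.reindex_bij_betw bij_betw_nth) auto
  finally show ?case by simp
qed

lemma dt_transpose:
  assumes "sorted_wrt (<) xs" "sorted_wrt (<) ys" "length xs = length ys"
  shows "dt (set xs) (map (\<lambda>y x. f x y) ys) = dt (set ys) (map f xs)"
proof -
  let ?r = "length xs"
  let ?A = "mat ?r ?r (\<lambda>(i, j). f (xs ! j) (ys ! i))"
  have "dt (set xs) (map (\<lambda>y x. f x y) ys) = Determinant.det ?A"
    using assms by (subst dt_det) (auto intro!: arg_cong[where f = Determinant.det] eq_matI)
  also have "\<dots> = Determinant.det (?A\<^sup>T)"
    by (rule det_transpose[symmetric]) auto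
  also have "\<dots> = dt (set ys) (map f xs)"
    using assms by (subst dt_det) (auto intro!: arg_cong[where f = Determinant.det] eq_matI)
  finally show ?thesis .
qed

text \<open>An element is picked out by the number of smaller ones. Since \<open>R\<close> avoids 0,
  the shift by one is strictly monotone on \<open>R\<close> and preserves this number.\<close>

lemma pick_eq_nth:
  assumes R: "finite R" "i < card R" and z: "0 \<notin> R"
  shows "pick ((\<lambda>k. k - 1) ` R) i = sorted_list_of_set R ! i - 1"
proof -
  let ?xs = "sorted_list_of_set R"
  let ?x = "?xs ! i"
  have len: "length ?xs = card R" by simp
  have x: "?x \<in> R" using R len nth_mem[of i ?xs] by simp
  have pos: "1 \<le> k" if "k \<in> R" for k using that z by (cases k) auto
  have inj: "inj_on (\<lambda>k. k - 1) R"
  proof (rule inj_onI)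
    fix k l assume "k \<in> R" "l \<in> R" "k - 1 = l - 1"
    then show "k = l" using pos[of k] pos[of l] by linarith
  qed
  have "k - 1 < ?x - 1 \<longleftrightarrow> k < ?x" if "k \<in> R" for k
    using pos[OF that] pos[OF x] by linarith
  then have "{a \<in> (\<lambda>k. k - 1) ` R. a < ?x - 1} = (\<lambda>k. k - 1) ` {a \<in> R. a < ?x}" by blast
  then have "card {a \<in> (\<lambda>k. k - 1) ` R. a < ?x - 1} = card {a \<in> R. a < ?x}"
    using inj by (simp add: card_image[OF inj_on_subset])
  also have "\<dots> = i"
    using lt_nth[of ?xs i] R len by (simp add: lt_def strict_sorted_iff)
  finally show ?thesis
    using pick_card_in_set[of "?x - 1" "(\<lambda>k. k - 1) ` R"] x by auto
qed

section \<open>The coefficients of \<open>\<DD>\<^sub>J(\<delta>\<^sub>n)\<close>\<close>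

definition eta :: "nat \<Rightarrow> nat \<Rightarrow> nat \<Rightarrow> cpoly" where
  "eta n a c = complete_hom n (int a - int c) a"

text \<open>The columns are reversed, so that column \<open>c\<close> carries the power whose
  exponent is the star of \<open>c\<close>.\<close>

definition xi :: "nat \<Rightarrow> nat \<Rightarrow> nat \<Rightarrow> cpoly" where
  "xi n k c = X k ^ (n + 1 - c)"

lemma minor_dt:
  assumes R: "R \<subseteq> {1..n}" and C: "C \<subseteq> {1..n}" and card: "card R = card C"
  shows "minor (H_mat n) R C = dt C (map (eta n) (sorted_list_of_set R))"
proof -
  let ?d = "\<lambda>k::nat. k - 1"
  have fin: "finite R" "finite C" using R C by (auto intro: finite_subset)
  have dim: "card {i. i < n \<and> i \<in> ?d ` S} = card S" if S: "S \<subseteq> {1..n}" for S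
  proof -
    have "{i. i < n \<and> i \<in> ?d ` S} = ?d ` S" using S by force
    moreover have "inj_on ?d S"
    proof (rule inj_onI)
      fix x y assume "x \<in> S" "y \<in> S" "x - 1 = y - 1"
      moreover from this have "x \<ge> 1" "y \<ge> 1" using S by auto
      ultimately show "x = y" by linarith
    qed
    ultimately show ?thesis by (simp add: card_image)
  qed
  have z: "0 \<notin> R" "0 \<notin> C" using R C by auto
  have mem: "sorted_list_of_set S ! i \<in> S" if "finite S" "i < card S" for S i
    using that nth_mem[of i "sorted_list_of_set S"] by simp
  have "submatrix (H_mat n) (?d ` R) (?d ` C) = mat (card C) (card C)
      (\<lambda>(i, j). (map (eta n) (sorted_list_of_set R) ! i) (sorted_list_of_set C ! j))"
  proof (rule eq_matI)
    fix i j
    assume "i < dim_row (mat (card C) (card C)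
      (\<lambda>(i, j). (map (eta n) (sorted_list_of_set R) ! i) (sorted_list_of_set C ! j)))"
      "j < dim_col (mat (card C) (card C)
      (\<lambda>(i, j). (map (eta n) (sorted_list_of_set R) ! i) (sorted_list_of_set C ! j)))"
    then have ij: "i < card R" "j < card C" by (auto simp: card)
    let ?x = "sorted_list_of_set R ! i" and ?y = "sorted_list_of_set C ! j"
    have xy: "?x \<in> {1..n}" "?y \<in> {1..n}" using mem[OF fin(1) ij(1)] mem[OF fin(2) ij(2)] R C by auto
    have "submatrix (H_mat n) (?d ` R) (?d ` C) $$ (i, j) = H_mat n $$ (?x - 1, ?y - 1)"
      using ij by (subst submatrix_index) (simp_all add: H_mat_def dim R C pick_eq_nth fin z del: One_nat_def)
    also have "\<dots> = eta n ?x ?y"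
      using xy by (auto simp: H_mat_def eta_def of_nat_diff)
    finally show "submatrix (H_mat n) (?d ` R) (?d ` C) $$ (i, j) = mat (card C) (card C)
      (\<lambda>(i, j). (map (eta n) (sorted_list_of_set R) ! i) (sorted_list_of_set C ! j)) $$ (i, j)"
      using ij card by simp
  qed (simp_all add: dim_submatrix H_mat_def dim R C card del: One_nat_def)
  then have "minor (H_mat n) R C = Determinant.det (mat (card C) (card C)
      (\<lambda>(i, j). (map (eta n) (sorted_list_of_set R) ! i) (sorted_list_of_set C ! j)))"
    by (simp add: minor_def)
  also have "\<dots> = dt (set (sorted_list_of_set C)) (map (eta n) (sorted_list_of_set R))"
    using fin card by (subst dt_det) (simp_all add: strict_sorted_iff)
  finally show ?thesis using fin by simp
qed

lemma act_sign: "act ((- 1) ^ k) q = (- 1) ^ k * q"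
  using act_sign_left[of k 1 q] by simp

text \<open>Each \<open>dj\<close> multiplies by its thetas from the right, so the operator applied
  first, the last of the list, supplies the leftmost form; hence the reversal.\<close>

lemma coef_foldr_dj:
  assumes "K \<subseteq> {1..n}"
  shows "coef (foldr (dj n) js (of_poly q)) K = act (dt K (map (\<lambda>j k. X k ^ j) (rev js))) q"
  using assms
proof (induction js arbitrary: K)
  case Nil
  then show ?case by (auto simp: of_poly_def lookup_single when_def)
next
  case (Cons j js)
  have fin: "finite K" using Cons.prems by (rule finite_subset) auto
  have "coef (foldr (dj n) js (of_poly q)) (K - {i}) = act (dt (K - {i}) (map (\<lambda>j k. X k ^ j) (rev js))) q" for i
    using Cons.prems by (intro Cons.IH) auto
  then show ?case
    by (simp add: coef_dj[OF Cons.prems] dt_snoc[OF fin] act_sum_left act_mult act_sign mult.assoc)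
qed

lemma star_sorted:
  assumes "I \<subseteq> {1..n}"
  shows "rev (sorted_list_of_set I) = map (\<lambda>c. n + 1 - c) (sorted_list_of_set (star n I))"
proof -
  let ?f = "\<lambda>c. n + 1 - c"
  have fin: "finite I" using assms by (rule finite_subset) auto
  have st: "star n I = ?f ` I"
    unfolding star_def
  proof (rule image_cong[OF refl])
    fix k assume "k \<in> I"
    then have "k \<in> {1..n}" using assms by blast
    then show "n - k + 1 = n + 1 - k" by auto
  qed
  have "sorted_list_of_set (star n I) = map ?f (rev (sorted_list_of_set I))"
  proof (rule sorted_distinct_set_unique)
    have "sorted_wrt (\<lambda>x y. ?f x \<le> ?f y) (rev (sorted_list_of_set I))"
      unfolding sorted_wrt_rev by (rule sorted_wrt_mono_rel[of _ "(\<le>)"]) auto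
    then show "sorted (map ?f (rev (sorted_list_of_set I)))" by (simp add: sorted_wrt_map)
    show "distinct (map ?f (rev (sorted_list_of_set I)))"
      using assms fin by (auto simp: distinct_map inj_on_def dest!: subsetD)
  qed (use fin in \<open>auto simp: st\<close>)
  moreover have "map (?f \<circ> ?f) (rev (sorted_list_of_set I)) = rev (sorted_list_of_set I)"
    using assms fin by (intro map_idI) auto
  ultimately show ?thesis by simp
qed

lemma star_star:
  assumes "I \<subseteq> {1..n}" shows "star n (star n I) = I"
proof -
  have "n - (n - k + 1) + 1 = k" if "k \<in> I" for k
  proof -
    have "k \<in> {1..n}" using assms that by blast
    then show ?thesis by auto
  qed
  then show ?thesis unfolding star_def image_image by simp
qed

lemma star_subset: "I \<subseteq> {1..n} \<Longrightarrow> star n I \<subseteq> {1..n}"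
proof
  fix x assume I: "I \<subseteq> {1..n}" and "x \<in> star n I"
  then obtain k where k: "k \<in> I" "x = n - k + 1" by (auto simp: star_def)
  then have "k \<in> {1..n}" using I by blast
  then show "x \<in> {1..n}" using k(2) by auto
qed

lemma star_inj: "inj_on (\<lambda>k. n - k + 1) {1..n::nat}"
proof (rule inj_onI)
  fix x y assume "x \<in> {1..n}" "y \<in> {1..n}" "n - x + 1 = n - y + 1"
  then show "x = y" unfolding atLeastAtMost_iff by arith
qed

lemma card_star: "I \<subseteq> {1..n} \<Longrightarrow> card (star n I) = card I"
  unfolding star_def by (intro card_image inj_on_subset[OF star_inj])

lemma star_Compl: "I \<subseteq> {1..n} \<Longrightarrow> star n ({1..n} - I) = {1..n} - star n I"
proof -
  assume I: "I \<subseteq> {1..n}"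
  have "star n ({1..n} - I) = star n {1..n} - star n I"
    unfolding star_def using I by (intro inj_on_image_set_diff[OF star_inj]) auto
  moreover have "star n {1..n} = {1..n}"
    using star_star[of "{1..n}" n] star_subset[of "{1..n}" n] star_subset[OF star_subset, of "{1..n}" n]
    by (metis card_star card_subset_eq finite_atLeastAtMost order_refl)
  ultimately show ?thesis by simp
qed

lemma sum_gt: "finite C \<Longrightarrow> (\<Sum>c\<in>C. gt C c) = c2 (card C)"
proof (induction C rule: finite_linorder_max_induct)
  case (insert b A)
  have b: "b \<notin> A" using insert by auto
  have "gt (insert b A) c = gt A c + 1" if "c \<in> A" for c
  proof -
    have "{k \<in> insert b A. c < k} = insert b {k \<in> A. c < k}" using insert that by auto
    then show ?thesis using insert b by (simp add: gt_def)
  qed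
  moreover have "{k \<in> insert b A. b < k} = {}" using insert by auto
  then have "gt (insert b A) b = 0" by (metis card.empty gt_def)
  ultimately show ?case using insert b by (simp add: sum_Suc c2_Suc)
qed simp

text \<open>The number n - c counts the elements of [n] above c. Those outside \<open>C\<close> add
  up to the crossings of the complement with \<open>C\<close>, those inside to
  \<open>c2 (card C)\<close>. Thus the sign prescribed in \<open>D_op\<close> is, up to a constant,
  the Laplace sign.\<close>

lemma star_sum_parity:
  assumes C: "C \<subseteq> {1..n}"
  shows "(-1 :: cpoly) ^ (\<Sum>i\<in>star n C. i) = (-1) ^ (card C + c2 (card C)) * (-1) ^ cr ({1..n} - C) C"
proof -
  let ?A = "{1..n} - C"
  have fin: "finite C" using C by (rule finite_subset) auto
  have "cr ?A C = (\<Sum>a\<in>?A. lt C a)" using fin by (intro cr_eq_sum) auto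
  also have "\<dots> = (\<Sum>a\<in>?A. \<Sum>c\<in>C. if c < a then 1 else 0)"
    unfolding lt_def using fin by (intro sum.cong refl) (subst sum.inter_filter[symmetric], auto)
  also have "\<dots> = (\<Sum>c\<in>C. gt ?A c)"
    by (subst sum.swap) (simp add: gt_eq_sum)
  finally have "cr ?A C + c2 (card C) = (\<Sum>c\<in>C. gt ?A c + gt C c)"
    using sum_gt[OF fin] by (simp add: sum.distrib)
  also have "\<dots> = (\<Sum>c\<in>C. n - c)"
  proof (rule sum.cong[OF refl])
    fix c assume c: "c \<in> C"
    have "gt ?A c + gt C c = gt (?A \<union> C) c" using fin by (intro gt_Un[symmetric]) auto
    also have "{k \<in> ?A \<union> C. c < k} = {c<..n}" using C by auto
    then have "gt (?A \<union> C) c = n - c" by (simp add: gt_def)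
    finally show "gt ?A c + gt C c = n - c" .
  qed
  finally have "(\<Sum>c\<in>C. n - c) = cr ?A C + c2 (card C)" by simp
  moreover have "(\<Sum>i\<in>star n C. i) = (\<Sum>c\<in>C. n - c + 1)"
    unfolding star_def using C by (subst sum.reindex[OF inj_on_subset[OF star_inj]]) auto
  ultimately have "(\<Sum>i\<in>star n C. i) = card C + c2 (card C) + cr ?A C"
    by (simp add: sum_Suc)
  then show ?thesis by (simp add: power_add)
qed

lemma sscale_sign: "coef (sscale ((-1) ^ k) f) K = (-1) ^ k * coef f K"
  by (cases "even k") (auto simp: lookup_sscale)

text \<open>With the sign of \<open>star_sum_parity\<close>, the sum over \<open>I\<close> is the
  Laplace expansion of one n by n determinant: the rows of \<open>H_mat\<close> outside
  \<open>J\<close>, followed by the rows of powers of \<open>X k\<close> for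
  \<open>k \<in> K\<close>.\<close>

lemma coef_D_op:
  assumes J: "J \<subseteq> {1..n}" and K: "K \<subseteq> {1..n}"
  shows "coef (D_op n J (of_poly q)) K = (if card K = card J then
    (-1) ^ (card J + c2 (card J)) * act (dt {1..n} (map (eta n) (sorted_list_of_set ({1..n} - J))
      @ map (xi n) (sorted_list_of_set K))) q else 0)"
proof -
  let ?N = "{1..n}" and ?e = "card J + c2 (card J)"
  let ?H = "map (eta n) (sorted_list_of_set (?N - J))" and ?V = "map (xi n) (sorted_list_of_set K)"
  let ?S = "{I. I \<subseteq> ?N \<and> card I = card J}"
  have finJ: "finite J" and finK: "finite K" using J K by (auto intro: finite_subset)
  have fin: "finite I" if "I \<subseteq> ?N" for I using that by (rule finite_subset) auto
  have D: "coef (D_op n J (of_poly q)) K = (\<Sum>I\<in>?S. (-1) ^ (\<Sum>i\<in>I. i) *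
      act (minor (H_mat n) (?N - J) (star n (?N - I)) * dt K (map (\<lambda>j k. X k ^ j) (rev (sorted_list_of_set I)))) q)"
    by (simp add: D_op_def lookup_sum sscale_sign dI_def coef_foldr_dj[OF K] act_mult)
  show ?thesis
  proof (cases "card K = card J")
    case False
    then have "dt K (map (\<lambda>j k. X k ^ j) (rev (sorted_list_of_set I))) = 0" if "I \<in> ?S" for I
      using that finK by (intro dt_card) auto
    then show ?thesis using False unfolding D by simp
  next
    case True
    have "coef (D_op n J (of_poly q)) K = (\<Sum>C\<in>?S. (-1) ^ (\<Sum>i\<in>star n C. i) *
      act (dt (?N - C) ?H * dt C ?V) q)"
      unfolding D
    \<comment> \<open>The new index is the star of \<open>I\<close>; the minor then uses exactly the
      columns outside it.\<close>
    proof (rule sum.reindex_bij_witness[of _ "star n" "star n"])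
      fix I assume I: "I \<in> ?S"
      then have s: "star n (star n I) = I" "card (star n I) = card J" "star n I \<subseteq> ?N" "star n (?N - I) = ?N - star n I"
        using star_star card_star star_subset star_Compl by auto
      show "star n (star n I) = I" "star n I \<in> ?S" using s by auto
      have "minor (H_mat n) (?N - J) (star n (?N - I)) = dt (?N - star n I) ?H"
        using s J by (subst minor_dt) (auto simp: card_Compl_interval simp del: One_nat_def)
      moreover have "dt K (map (\<lambda>j k. X k ^ j) (rev (sorted_list_of_set I))) = dt (star n I) ?V"
      proof -
        have "map (\<lambda>j k. X k ^ j) (rev (sorted_list_of_set I)) = map (\<lambda>c k. xi n k c) (sorted_list_of_set (star n I))"
          using star_sorted[of I n] I by (simp add: xi_def comp_def)
        then show ?thesis
          using dt_transpose[of "sorted_list_of_set K" "sorted_list_of_set (star n I)" "xi n"] s True finK fin[OF s(3)]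
          by (simp add: strict_sorted_iff)
      qed
      ultimately show "(-1) ^ (\<Sum>i\<in>star n (star n I). i) * act (dt (?N - star n I) ?H * dt (star n I) ?V) q
        = (-1) ^ (\<Sum>i\<in>I. i) * act (minor (H_mat n) (?N - J) (star n (?N - I)) * dt K (map (\<lambda>j k. X k ^ j) (rev (sorted_list_of_set I)))) q"
        unfolding s by simp
    next
      fix I assume I: "I \<in> ?S"
      then show "star n (star n I) = I" "star n I \<in> ?S" using star_star card_star star_subset by auto
    qed
    also have "\<dots> = (\<Sum>C\<in>?S. (-1) ^ ?e * act ((-1) ^ cr (?N - C) C * dt (?N - C) ?H * dt C ?V) q)"
      by (intro sum.cong refl) (auto simp: star_sum_parity act_sign_left mult.assoc simp del: One_nat_def)
    also have "\<dots> = (-1) ^ ?e * act (\<Sum>C\<in>?S. (-1) ^ cr (?N - C) C * dt (?N - C) ?H * dt C ?V) q"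
      by (simp add: act_sum_left sum_distrib_left)
    also have "(\<Sum>C\<in>?S. (-1) ^ cr (?N - C) C * dt (?N - C) ?H * dt C ?V)
        = (\<Sum>C\<in>Pow ?N. (-1) ^ cr (?N - C) C * dt (?N - C) ?H * dt C ?V)"
    proof (rule sum.mono_neutral_left)
      show "\<forall>C\<in>Pow ?N - ?S. (-1) ^ cr (?N - C) C * dt (?N - C) ?H * dt C ?V = 0"
      proof
        fix C assume C: "C \<in> Pow ?N - ?S"
        then have "dt C ?V = 0" using True finK fin by (intro dt_card) auto
        then show "(-1) ^ cr (?N - C) C * dt (?N - C) ?H * dt C ?V = 0" by simp
      qed
    qed auto
    also have "\<dots> = (\<Sum>A\<in>Pow ?N. (-1) ^ cr A (?N - A) * dt A ?H * dt (?N - A) ?V)"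
      by (rule sum.reindex_bij_witness[of _ "\<lambda>A. ?N - A" "\<lambda>A. ?N - A"]) (auto simp: double_diff)
    also have "\<dots> = dt ?N (?H @ ?V)" by (rule dt_append[symmetric]) simp
    finally show ?thesis using True by simp
  qed
qed

section \<open>Complete homogeneous polynomials and Newton interpolation\<close>

lemma complete_hom_neg [simp]: "k < 0 \<Longrightarrow> complete_hom n k i = 0"
  by (simp add: complete_hom_def)

abbreviation mons :: "nat \<Rightarrow> nat \<Rightarrow> nat \<Rightarrow> (nat \<Rightarrow>\<^sub>0 nat) set" where
  "mons n d i \<equiv> {m. supp m \<subseteq> {i..n} \<and> wt (\<lambda>_. 1) m = d}"

lemma complete_hom_nat: "complete_hom n (int d) i = (\<Sum>m\<in>mons n d i. sing m 1)"
  by (simp add: complete_hom_def wt_def)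

lemma finite_mons: "finite (mons n d i)"
proof -
  have "inj_on coef (mons n d i)"
  proof (rule inj_onI)
    fix m m' assume "coef m = coef m'"
    then show "m = m'" by (simp only: poly_mapping_eq_iff)
  qed
  moreover have "coef ` mons n d i \<subseteq> {f. \<forall>x. (x \<in> {i..n} \<longrightarrow> f x \<in> {..d}) \<and> (x \<notin> {i..n} \<longrightarrow> f x = 0)}"
  proof clarify
    fix m x assume m: "supp m \<subseteq> {i..n}" "d = wt (\<lambda>_. 1) m"
    have "coef m x \<le> wt (\<lambda>_. 1) m"
      using member_le_sum[of x "supp m" "coef m"] by (cases "x \<in> supp m") (auto simp: wt_def in_keys_iff)
    then show "(x \<in> {i..n} \<longrightarrow> coef m x \<in> {..wt (\<lambda>_. 1) m}) \<and> (x \<notin> {i..n} \<longrightarrow> coef m x = 0)"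
      using m by (auto simp: in_keys_iff)
  qed
  then have "finite (coef ` mons n d i)"
    by (rule finite_subset) (rule finite_set_of_finite_funs, auto)
  ultimately show ?thesis by (rule finite_imageD[rotated])
qed

lemma complete_hom_0: "complete_hom n 0 i = 1"
proof -
  have "mons n 0 i = {0}" by (auto simp: wt_def in_keys_iff intro!: poly_mapping_eqI)
  then show ?thesis using complete_hom_nat[of n 0 i] by simp
qed

lemma complete_hom_last:
  assumes "i > n" "k \<noteq> 0" shows "complete_hom n k i = 0"
proof (cases "k < 0")
  case False
  then obtain d where d: "k = int d" using nonneg_int_cases[of k] by auto
  have "mons n d i = {}" using assms d by (auto simp: wt_def)
  then show ?thesis unfolding d complete_hom_nat by (simp only: sum.empty)
qed simp

text \<open>The monomials are split according to divisibility by \<open>X i\<close>.\<close>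

lemma complete_hom_step:
  assumes i: "i \<le> n"
  shows "complete_hom n k i = complete_hom n k (Suc i) + X i * complete_hom n (k - 1) i"
proof (cases "k \<le> 0")
  case True
  then show ?thesis by (cases "k = 0") (auto simp: complete_hom_0)
next
  case False
  then obtain d where d: "k = int (Suc d)" by (metis int_nat_eq not_le_imp_less gr0_conv_Suc zero_less_nat_eq nat_0_le less_imp_le)
  have k1: "k - 1 = int d" using d by simp
  have split: "mons n (Suc d) i = mons n (Suc d) (Suc i) \<union> (\<lambda>m. sing i 1 + m) ` mons n d i"
  proof (intro equalityI subsetI)
    fix m assume m: "m \<in> mons n (Suc d) i"
    show "m \<in> mons n (Suc d) (Suc i) \<union> (\<lambda>m. sing i 1 + m) ` mons n d i"
    proof (cases "coef m i = 0")
      case True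
      then have "i \<notin> supp m" by (simp add: in_keys_iff)
      then have "supp m \<subseteq> {Suc i..n}" using m by (force simp: le_eq_less_or_eq Suc_le_eq)
      then show ?thesis using m by auto
    next
      case False
      then have e: "m = sing i 1 + (m - sing i 1)"
        by (intro poly_mapping_eqI) (auto simp: lookup_add lookup_minus lookup_single when_def)
      have "wt (\<lambda>_. 1) m = 1 + wt (\<lambda>_. 1) (m - sing i 1)" by (subst e) (simp add: wt_add wt_single)
      moreover have "supp (m - sing i 1) \<subseteq> {i..n}" using m by (auto simp: in_keys_iff lookup_minus)
      ultimately have "m - sing i 1 \<in> mons n d i" using m by simp
      then show ?thesis using e by (intro UnI2 image_eqI[of _ _ "m - sing i 1"])
    qed
  qed (use i in \<open>auto simp: supp_add_nat wt_add wt_single split: if_splits\<close>)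
  have disj: "mons n (Suc d) (Suc i) \<inter> (\<lambda>m. sing i 1 + m) ` mons n d i = {}"
    by (auto simp: supp_add_nat)
  have "complete_hom n k i = (\<Sum>m\<in>mons n (Suc d) (Suc i). sing m 1) + (\<Sum>m\<in>(\<lambda>m. sing i 1 + m) ` mons n d i. sing m 1)"
    unfolding d complete_hom_nat split by (intro sum.union_disjoint disj finite_mons finite_imageI)
  also have "(\<Sum>m\<in>(\<lambda>m. sing i 1 + m) ` mons n d i. sing m 1) = X i * complete_hom n (k - 1) i"
    unfolding k1 complete_hom_nat
    by (subst sum.reindex) (auto simp: inj_on_def sum_distrib_left X_def mult_single)
  finally show ?thesis unfolding d complete_hom_nat .
qed

text \<open>\<open>X k\<close> times the Newton basis polynomial with nodes \<open>X n\<close>, ...,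
  \<open>X (b + 1)\<close>, evaluated at \<open>X k\<close>. For \<open>b = k\<close> this is
  \<open>fj n k\<close>.\<close>

definition newton :: "nat \<Rightarrow> nat \<Rightarrow> nat \<Rightarrow> cpoly" where
  "newton n k b = X k * (\<Prod>i=b+1..n. X k - X i)"

text \<open>\<open>h\<^sub>m\<close> of \<open>x\<^sub>k, x\<^bsub>s+1\<^esub>, \<dots>, x\<^sub>n\<close>: the divided difference of a power at these points.\<close>

definition hom_with :: "nat \<Rightarrow> nat \<Rightarrow> nat \<Rightarrow> nat \<Rightarrow> cpoly" where
  "hom_with n k s m = (\<Sum>a\<le>m. X k ^ a * complete_hom n (int (m - a)) (Suc s))"

lemma hom_with_Suc: "hom_with n k s (Suc m) = complete_hom n (int (Suc m)) (Suc s) + X k * hom_with n k s m"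
  unfolding hom_with_def
  by (subst sum.atMost_Suc_shift) (simp add: sum_distrib_left mult.assoc)

lemma hom_with_0 [simp]: "hom_with n k s 0 = 1"
  by (simp add: hom_with_def complete_hom_0)

text \<open>The recursion of divided differences: exchanging the node \<open>X s\<close> for
  \<open>X k\<close> changes the value by \<open>X k - X s\<close> times the difference that has
  both nodes.\<close>

lemma hom_with_step:
  assumes "1 \<le> s" "s \<le> n"
  shows "hom_with n k s (Suc m) = complete_hom n (int (Suc m)) s + (X k - X s) * hom_with n k (s - 1) m"
proof (induction m)
  case 0
  have "complete_hom n 1 s = complete_hom n 1 (Suc s) + X s"
    using complete_hom_step[OF assms(2), of 1] by (simp add: complete_hom_0)
  then show ?case by (simp add: hom_with_Suc)
next
  case (Suc m)
  have h: "complete_hom n (int (Suc (Suc m))) s = complete_hom n (int (Suc (Suc m))) (Suc s) + X s * complete_hom n (int (Suc m)) s"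
    using complete_hom_step[OF assms(2), of "int (Suc (Suc m))"] by simp
  have s: "Suc (s - 1) = s" using assms by simp
  have "hom_with n k s (Suc (Suc m)) = complete_hom n (int (Suc (Suc m))) (Suc s) + X k * hom_with n k s (Suc m)"
    by (rule hom_with_Suc)
  also have "\<dots> = complete_hom n (int (Suc (Suc m))) s - X s * complete_hom n (int (Suc m)) s
      + X k * (complete_hom n (int (Suc m)) s + (X k - X s) * hom_with n k (s - 1) m)"
  proof -
    have "complete_hom n (int (Suc (Suc m))) (Suc s) = complete_hom n (int (Suc (Suc m))) s - X s * complete_hom n (int (Suc m)) s"
      using h by simp
    then show ?thesis by (simp only: Suc.IH)
  qed
  also have "\<dots> = complete_hom n (int (Suc (Suc m))) s + (X k - X s) * hom_with n k (s - 1) (Suc m)"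
    unfolding hom_with_Suc[of n k "s - 1" m] s by (simp add: algebra_simps)
  finally show ?case .
qed

lemma hom_with_last: "hom_with n k n m = X k ^ m"
proof (induction m)
  case (Suc m)
  then show ?case by (simp add: hom_with_Suc complete_hom_last)
qed simp

lemma hom_with_self:
  assumes "1 \<le> k" "k \<le> n" shows "hom_with n k k m = complete_hom n (int m) k"
proof (cases m)
  case (Suc m')
  then show ?thesis using hom_with_step[OF assms, of k m'] by simp
qed (simp add: complete_hom_0)

text \<open>Newton interpolation of t^(n - c) at \<open>X n\<close>, \<open>X (n - 1)\<close>, ...,
  evaluated at \<open>X k\<close>. The divided difference at \<open>X n\<close>, ...,
  \<open>X b\<close> is \<open>eta n b c\<close>, and the expansion stops at \<open>b = k\<close>,
  where the evaluation point itself becomes a node. The factor \<open>X k\<close> in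
  \<open>newton\<close> raises the exponent to n + 1 - c.\<close>

lemma newton_expansion:
  assumes k: "1 \<le> k" "k \<le> n" and c: "c \<in> {1..n}"
  shows "xi n k c = (\<Sum>b\<in>{k..n}. newton n k b * eta n b c)"
proof -
  \<comment> \<open>After \<open>d\<close> nodes the remainder is the divided difference with
    \<open>X k\<close> as an additional node.\<close>
  have *: "X k ^ (n - c) = (\<Sum>b\<in>{n - d<..n}. (\<Prod>i=b+1..n. X k - X i) * eta n b c)
      + (\<Prod>i=n-d+1..n. X k - X i) * (if c \<le> n - d then hom_with n k (n - d) (n - d - c) else 0)"
    if "k + d \<le> n" for d
    using that
  proof (induction d)
    case 0
    then show ?case using c by (simp add: hom_with_last)
  next
    case (Suc d)
    define s where "s = n - d"
    have s: "1 \<le> s" "s \<le> n" "n - Suc d = s - 1" "k < s" using Suc.prems k by (auto simp: s_def)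
    have iv: "{s - 1<..n} = insert s {s<..n}" "{s - 1 + 1..n} = insert s {s+1..n}" using s by auto
    define H where "H = (if c \<le> s then hom_with n k s (s - c) else 0)"
    define H' where "H' = (if c \<le> s - 1 then hom_with n k (s - 1) (s - 1 - c) else 0)"
    have key: "H = eta n s c + (X k - X s) * H'"
    proof (cases c s rule: linorder_cases)
      case less
      then obtain m where m: "s - c = Suc m" "s - 1 - c = m" "int s - int c = int (Suc m)"
        by (metis Suc_diff_Suc diff_Suc_eq_diff_pred of_nat_diff less_imp_le)
      moreover have "c \<le> s - 1" using less by simp
      ultimately show ?thesis using less hom_with_step[OF s(1,2), of k m] by (simp add: eta_def H_def H'_def)
    next
      case equal
      then have "\<not> c \<le> s - 1" using s by simp
      then show ?thesis using equal by (simp add: eta_def complete_hom_0 H_def H'_def)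
    next
      case greater
      then have "\<not> c \<le> s - 1" by simp
      then show ?thesis using greater by (simp add: eta_def H_def H'_def)
    qed
    define S where "S = (\<Sum>b\<in>{s<..n}. (\<Prod>i=b+1..n. X k - X i) * eta n b c)"
    define Q where "Q = (\<Prod>i=s+1..n. X k - X i)"
    have "X k ^ (n - c) = S + Q * H"
      using Suc.IH Suc.prems unfolding s_def[symmetric] S_def Q_def H_def by simp
    also have "\<dots> = (Q * eta n s c + S) + ((X k - X s) * Q) * H'"
      unfolding key by (simp add: algebra_simps)
    also have "Q * eta n s c + S = (\<Sum>b\<in>{s - 1<..n}. (\<Prod>i=b+1..n. X k - X i) * eta n b c)"
      unfolding iv S_def Q_def by simp
    also have "(X k - X s) * Q = (\<Prod>i=s-1+1..n. X k - X i)"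
      unfolding iv Q_def by simp
    finally show ?case unfolding s(3) H'_def .
  qed
  have nk: "n - (n - k) = k" using k by simp
  have eq: "(if c \<le> k then hom_with n k k (k - c) else 0) = eta n k c"
    using hom_with_self[OF k, of "k - c"] by (auto simp: eta_def of_nat_diff)
  have "X k ^ (n - c) = (\<Sum>b\<in>{k<..n}. (\<Prod>i=b+1..n. X k - X i) * eta n b c) + (\<Prod>i=k+1..n. X k - X i) * eta n k c"
    using *[of "n - k"] k(2) unfolding nk eq by simp
  also have "\<dots> = (\<Sum>b\<in>{k..n}. (\<Prod>i=b+1..n. X k - X i) * eta n b c)"
  proof -
    have "{k..n} = insert k {k<..n}" using k by auto
    then show ?thesis by (simp add: add.commute)
  qed
  finally have "X k * X k ^ (n - c) = (\<Sum>b\<in>{k..n}. newton n k b * eta n b c)"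
    by (simp add: newton_def sum_distrib_left mult.assoc)
  moreover have "n + 1 - c = Suc (n - c)" using c by auto
  ultimately show ?thesis by (simp add: xi_def)
qed

text \<open>Each row of powers expands into rows \<open>eta n b\<close> with
  \<open>b \<ge> k\<close>. A nonzero determinant requires distinct row numbers, whose sum is then
  that of [n]. As the sum is already that large for \<open>b = k\<close>, every larger
  \<open>b\<close> drops out.\<close>

lemma dt_eta_xi:
  assumes "set P \<subseteq> {1..n}" "set ks \<subseteq> {1..n}" "length P + length ks = n"
    "sum_list P + sum_list ks \<ge> \<Sum>{1..n}"
  shows "dt {1..n} (map (eta n) P @ map (xi n) ks) = (\<Prod>k\<leftarrow>ks. fj n k) * dt {1..n} (map (eta n) (P @ ks))"
  using assms
proof (induction ks arbitrary: P)
  case (Cons k ks)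
  have k: "1 \<le> k" "k \<le> n" using Cons.prems by auto
  have "dt {1..n} (map (eta n) P @ map (xi n) (k # ks))
     = dt {1..n} (map (eta n) P @ (\<lambda>c. \<Sum>b\<in>{k..n}. newton n k b * eta n b c) # map (xi n) ks)"
    by (rule dt_cong) (auto simp: list_all2_append list_all2_same newton_expansion[OF k] intro!: list_all2_appendI)
  also have "\<dots> = (\<Sum>b\<in>{k..n}. newton n k b * dt {1..n} (map (eta n) (P @ [b]) @ map (xi n) ks))"
    by (subst dt_linear) auto
  also have "\<dots> = (\<Sum>b\<in>{k..n}. newton n k b * ((\<Prod>k\<leftarrow>ks. fj n k) * dt {1..n} (map (eta n) ((P @ [b]) @ ks))))"
  proof (rule sum.cong[OF refl])
    fix b assume b: "b \<in> {k..n}"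
    show "newton n k b * dt {1..n} (map (eta n) (P @ [b]) @ map (xi n) ks) =
      newton n k b * ((\<Prod>k\<leftarrow>ks. fj n k) * dt {1..n} (map (eta n) ((P @ [b]) @ ks)))"
      using b Cons.prems by (subst Cons.IH) auto
  qed
  also have "\<dots> = (\<Sum>b\<in>{k}. newton n k b * ((\<Prod>k\<leftarrow>ks. fj n k) * dt {1..n} (map (eta n) ((P @ [b]) @ ks))))"
  proof (rule sum.mono_neutral_right)
    show "\<forall>b\<in>{k..n} - {k}. newton n k b * ((\<Prod>k\<leftarrow>ks. fj n k) * dt {1..n} (map (eta n) ((P @ [b]) @ ks))) = 0"
    proof
      fix b assume b: "b \<in> {k..n} - {k}"
      let ?l = "(P @ [b]) @ ks"
      have "\<not> distinct ?l"
      proof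
        assume d: "distinct ?l"
        have "set ?l \<subseteq> {1..n}" using Cons.prems b by auto
        moreover have "card (set ?l) = card {1..n}" using d Cons.prems by (simp only: distinct_card) simp
        ultimately have "set ?l = {1..n}" by (intro card_subset_eq) auto
        then have "sum_list ?l = \<Sum>{1..n}" using sum_list_distinct_conv_sum_set[OF d, of id] by simp
        then show False using Cons.prems b by auto
      qed
      then have "dt {1..n} (map (eta n) ?l) = 0" by (intro dt_not_distinct) auto
      then show "newton n k b * ((\<Prod>k\<leftarrow>ks. fj n k) * dt {1..n} (map (eta n) ?l)) = 0" by simp
    qed
  qed (use k in auto)
  also have "\<dots> = (\<Prod>k\<leftarrow>k # ks. fj n k) * dt {1..n} (map (eta n) (P @ k # ks))"
    by (simp add: newton_def fj_eq mult.assoc)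
  finally show ?case .
qed simp

text \<open>\<open>H_mat\<close> is lower unitriangular. The induction runs over the lower right
  blocks, in whose first row only the diagonal entry is nonzero.\<close>

lemma dt_eta_unit: "dt {1..n} (map (eta n) [1..<Suc n]) = 1"
proof -
  have "dt {Suc n - d..n} (map (eta n) [Suc n - d..<Suc n]) = 1" if "d \<le> n" for d
    using that
  proof (induction d)
    case (Suc d)
    define s where "s = n - d"
    have s: "Suc n - Suc d = s" "Suc n - d = Suc s" "1 \<le> s" "s \<le> n" using Suc by (auto simp: s_def)
    have iv: "{s..n} - {s} = {Suc s..n}" by auto
    have lt: "lt {s..n} s = 0" by (auto simp: lt_def)
    have "[s..<Suc n] = s # [Suc s..<Suc n]" using s by (simp add: upt_conv_Cons)
    then have "dt {s..n} (map (eta n) [s..<Suc n])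
      = (\<Sum>c\<in>{s..n}. (-1) ^ lt {s..n} c * eta n s c * dt ({s..n} - {c}) (map (eta n) [Suc s..<Suc n]))"
      by (simp only: list.map dt.simps)
    also have "\<dots> = (\<Sum>c\<in>{s}. (-1) ^ lt {s..n} c * eta n s c * dt ({s..n} - {c}) (map (eta n) [Suc s..<Suc n]))"
      using s by (intro sum.mono_neutral_right) (auto simp: eta_def)
    also have "\<dots> = 1"
    proof -
      have "eta n s s = 1" by (simp add: eta_def complete_hom_0)
      moreover have "dt {Suc s..n} (map (eta n) [Suc s..<Suc n]) = 1" using Suc s by simp
      ultimately show ?thesis by (simp add: lt iv del: upt_Suc)
    qed
    finally show ?case unfolding s .
  qed simp
  from this[of n] show ?thesis by simp
qed

text \<open>If the sum of \<open>K\<close> is at least that of \<open>J\<close>,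
  \<open>dt_eta_xi\<close> leaves the determinant of the rows of \<open>H_mat\<close> indexed by the
  complement of \<open>J\<close> followed by \<open>K\<close>. It has a repeated row unless
  \<open>K = J\<close>, where it is a rearrangement of the unit determinant.\<close>

theorem D_op_vandermonde_coef:
  assumes J: "J \<subseteq> {1..n}" and K: "K \<subseteq> {1..n}"
  shows "K \<noteq> J \<Longrightarrow> coef (D_op n J (of_poly q)) K \<noteq> 0 \<Longrightarrow> \<Sum>K < \<Sum>J"
    and "coef (D_op n J (of_poly q)) K \<noteq> 0 \<Longrightarrow> card K = card J"
    and "\<exists>s. coef (D_op n J (of_poly q)) J = (-1) ^ s * act (fJ n J) q"
proof -
  let ?P = "sorted_list_of_set ({1..n} - J)"
  show c: "card K = card J" if "coef (D_op n J (of_poly q)) K \<noteq> 0"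
    by (rule ccontr) (use that coef_D_op[OF J K, of q] in simp)
  have fin: "finite L" if "L \<subseteq> {1..n}" for L using that by (rule finite_subset) auto
  have eval: "dt {1..n} (map (eta n) ?P @ map (xi n) (sorted_list_of_set L))
      = fJ n L * dt {1..n} (map (eta n) (?P @ sorted_list_of_set L))"
    if L: "L \<subseteq> {1..n}" "card L = card J" "\<Sum>J \<le> \<Sum>L" for L
  proof -
    have sl: "sum_list (sorted_list_of_set S) = \<Sum>S" if "finite S" for S :: "nat set"
      using sum_list_distinct_conv_sum_set[of "sorted_list_of_set S" id] that by simp
    have "\<Sum>{1..n} = \<Sum>({1..n} - J) + \<Sum>J" using J by (intro sum.subset_diff) auto
    moreover have "card J \<le> n" using card_mono[OF _ J] by simp
    moreover have "(\<Prod>k\<leftarrow>sorted_list_of_set L. fj n k) = fJ n L"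
      unfolding fJ_eq using fin[OF L(1)] by (subst prod.distinct_set_conv_list[symmetric]) auto
    ultimately show ?thesis
      using L fin[OF J] fin[OF L(1)] card_Compl_interval[OF J]
      by (subst dt_eta_xi) (auto simp: sl simp del: One_nat_def)
  qed
  show "\<Sum>K < \<Sum>J" if ne: "K \<noteq> J" and nz: "coef (D_op n J (of_poly q)) K \<noteq> 0"
  proof (rule ccontr)
    assume "\<not> \<Sum>K < \<Sum>J"
    have "\<not> K \<subseteq> J" using ne c[OF nz] fin[OF J] by (metis card_subset_eq)
    then have "\<not> distinct (?P @ sorted_list_of_set K)" using K fin[OF K] by auto
    then have "dt {1..n} (map (eta n) (?P @ sorted_list_of_set K)) = 0" by (intro dt_not_distinct) auto
    then have "dt {1..n} (map (eta n) ?P @ map (xi n) (sorted_list_of_set K)) = 0"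
      using eval[OF K c[OF nz]] \<open>\<not> \<Sum>K < \<Sum>J\<close> by simp
    then show False using nz coef_D_op[OF J K, of q] c[OF nz] by simp
  qed
  have "sort (?P @ sorted_list_of_set J) = [1..<Suc n]"
    using J fin[OF J] by (intro sorted_distinct_set_unique) (auto simp del: upt_Suc)
  then obtain t where t: "dt {1..n} (map (eta n) (?P @ sorted_list_of_set J)) = (-1) ^ t"
    using dt_sort[of "{1..n}" "eta n" "[]" "?P @ sorted_list_of_set J"] dt_eta_unit[of n] by auto
  have "coef (D_op n J (of_poly q)) J = (-1) ^ (card J + c2 (card J)) * act ((-1) ^ t * fJ n J) q"
    using coef_D_op[OF J J, of q] eval[OF J] t by (simp add: mult.commute)
  then have "coef (D_op n J (of_poly q)) J = (-1) ^ (card J + c2 (card J) + t) * act (fJ n J) q"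
    by (simp add: act_sign_left power_add mult.assoc)
  then show "\<exists>s. coef (D_op n J (of_poly q)) J = (-1) ^ s * act (fJ n J) q" by blast
qed

lemma sign_sign: "(- 1) ^ k * ((- 1) ^ k * x) = (x :: cpoly)"
  by (cases "even k") simp_all

section \<open>Leading coefficients of \<open>SI\<^sub>n\<close>\<close>

text \<open>The initial ideal of \<open>SI n\<close> at \<open>\<theta>\<^sub>J\<close>, for the
  order in which smaller sums lead.\<close>

definition lead :: "nat \<Rightarrow> nat set \<Rightarrow> cpoly set" where
  "lead n J = {g \<in> polys n. \<exists>F\<in>SI n. coef F J = g \<and> (\<forall>K. coef F K \<noteq> 0 \<longrightarrow> K = J \<or> \<Sum>J < \<Sum>K)}"

lemma leadI:
  assumes "F \<in> SI n" "coef F J = g" "\<And>K. coef F K \<noteq> 0 \<Longrightarrow> K = J \<or> \<Sum>J < \<Sum>K"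
  shows "g \<in> lead n J"
  using assms superspace_coef[OF SI_superspace[OF assms(1)], of J] unfolding lead_def by blast

lemma lead_ideal: "is_poly_ideal n (lead n J)"
  unfolding is_poly_ideal_def
proof (intro conjI ballI subsetI)
  show "0 \<in> lead n J" by (rule leadI[OF SI_0]) auto
  show "x \<in> polys n" if "x \<in> lead n J" for x using that by (simp add: lead_def)
next
  fix s t assume "s \<in> lead n J" "t \<in> lead n J"
  then obtain F G where "F \<in> SI n" "coef F J = s" "G \<in> SI n" "coef G J = t"
    and F: "\<And>K. coef F K \<noteq> 0 \<Longrightarrow> K = J \<or> \<Sum>J < \<Sum>K"
    and G: "\<And>K. coef G K \<noteq> 0 \<Longrightarrow> K = J \<or> \<Sum>J < \<Sum>K"
    unfolding lead_def by blast
  moreover have "K = J \<or> \<Sum>J < \<Sum>K" if "coef (F + G) K \<noteq> 0" for K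
    using that F[of K] G[of K] by (cases "coef F K = 0") (auto simp: lookup_add)
  ultimately show "s + t \<in> lead n J" by (intro leadI[of "F + G"]) (auto simp: lookup_add SI_add)
next
  fix a t assume a: "a \<in> polys n" and "t \<in> lead n J"
  then obtain F where "F \<in> SI n" "coef F J = t" "\<And>K. coef F K \<noteq> 0 \<Longrightarrow> K = J \<or> \<Sum>J < \<Sum>K"
    unfolding lead_def by blast
  then show "a * t \<in> lead n J"
    by (intro leadI[of "of_poly a \<circledast> F"] SI_smult_left superspace_of_poly a) auto
qed

text \<open>The counterpart of \<open>psum_combination_mem\<close> for the forms of
  \<open>SI_power_theta\<close>.\<close>

lemma SI_combination:
  assumes "finite A" "A \<subseteq> {1..n}"
  shows "(\<Sum>i=1..n. sing {i} (X i ^ e * (\<Prod>a\<in>A. X i - X a))) \<in> SI n"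
  using assms
proof (induction A arbitrary: e rule: finite_induct)
  case empty
  then show ?case using SI_power_theta by simp
next
  case (insert a A)
  let ?w = "\<lambda>e. \<Sum>i=1..n. sing {i} (X i ^ e * (\<Prod>a\<in>A. X i - X a)) :: sform"
  have eq: "(\<Sum>i=1..n. sing {i} (X i ^ e * (\<Prod>a\<in>insert a A. X i - X a))) = ?w (Suc e) + of_poly (- X a) \<circledast> ?w e"
  proof (rule poly_mapping_eqI)
    fix K
    show "coef (\<Sum>i=1..n. sing {i} (X i ^ e * (\<Prod>a\<in>insert a A. X i - X a))) K
        = coef (?w (Suc e) + of_poly (- X a) \<circledast> ?w e) K"
      using insert.hyps unfolding lookup_add coef_of_poly_smult lookup_sum sum_distrib_left sum.distrib[symmetric]
      by (intro sum.cong) (auto simp: lookup_single when_def algebra_simps)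
  qed
  have "- X a \<in> polys n" using insert.prems by (intro polys_uminus polys_X) auto
  moreover have "A \<subseteq> {1..n}" using insert.prems by simp
  ultimately show ?case
    unfolding eq by (intro SI_add SI_smult_left superspace_of_poly insert.IH)
qed

lemma EJ_lead:
  assumes J: "J \<subseteq> {1..n}" shows "EJ n J \<subseteq> lead n J"
proof (rule EJ_least[OF lead_ideal])
  fix k :: nat assume "1 \<le> k"
  then have "of_poly (psum n k) \<in> SI n" by (intro SI_of_poly psum_coinv)
  then have "of_poly (psum n k) \<circledast> sing J 1 \<in> SI n" using J by (intro SI_smult_right superspace_single) auto
  then show "psum n k \<in> lead n J"
    by (rule leadI) (auto simp: lookup_single when_def split: if_splits)
next
  fix j assume j: "j \<in> J"
  let ?A = "{1..<j} - J" and ?L = "J - {j}"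
  let ?q = "\<lambda>i. X i ^ 0 * (\<Prod>a\<in>?A. X i - X a)"
  let ?F = "(\<Sum>i=1..n. sing {i} (?q i)) \<circledast> sing ?L 1"
  have fin: "finite J" using J by (rule finite_subset) auto
  have jn: "j \<in> {1..n}" using j J by blast
  have "(\<Sum>i=1..n. sing {i} (?q i)) \<in> SI n" using jn by (intro SI_combination) auto
  then have F: "?F \<in> SI n" using J by (intro SI_smult_right superspace_single) auto
  have c: "coef ?F K = (\<Sum>i=1..n. if i \<notin> ?L \<and> insert i ?L = K then (-1) ^ lt ?L i * ?q i else 0)" for K
    unfolding smult_sum_left smult_single lookup_sum
    using fin by (intro sum.cong) (auto simp: lookup_single when_def cr_single_left)
  have "coef ?F J = (\<Sum>i=1..n. if i = j then (-1) ^ lt ?L j * gJ J j else 0)"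
    unfolding c using j by (intro sum.cong) (auto simp: gJ_def)
  then have cJ: "coef ?F J = (-1) ^ lt ?L j * gJ J j" using jn by (simp add: sum.delta)
  have "(-1) ^ lt ?L j * gJ J j \<in> lead n J"
  proof (rule leadI[OF F cJ])
    fix K assume "coef ?F K \<noteq> 0"
    then obtain i where "i \<in> {1..n}" "(if i \<notin> ?L \<and> insert i ?L = K then (-1) ^ lt ?L i * ?q i else 0) \<noteq> 0"
      unfolding c by (rule sum.not_neutral_contains_not_neutral)
    then have i: "i \<notin> ?L" "insert i ?L = K" "?q i \<noteq> 0" "i \<in> {1..n}"
      by (auto split: if_splits)
    have "i \<notin> ?A" using i(3) by (auto simp: prod_zero_iff)
    then have "i = j \<or> j < i" using i by auto
    moreover have "\<Sum>K = i + \<Sum>?L" using i fin by (auto simp flip: i(2))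
    moreover have "\<Sum>J = j + \<Sum>?L" using j fin by (simp add: sum.remove)
    ultimately show "K = J \<or> \<Sum>J < \<Sum>K" using i j by auto
  qed
  then have "(-1) ^ lt ?L j * ((-1) ^ lt ?L j * gJ J j) \<in> lead n J"
    by (rule ideal_mult[OF lead_ideal polys_sign])
  then show "gJ J j \<in> lead n J" unfolding sign_sign .
qed

section \<open>Macaulay duality\<close>

text \<open>The apolar bilinear form, for which monomials are orthogonal.\<close>

definition ev :: "cpoly \<Rightarrow> cpoly \<Rightarrow> complex" where "ev f v = dcoef (act f v) 0"

lemma ev_diff_left: "ev (f - g) v = ev f v - ev g v"
  by (simp add: ev_def act_diff_left dcoef_def lookup_minus)

lemma ev_diff_right: "ev f (v - w) = ev f v - ev f w"
  by (simp add: ev_def act_diff_right dcoef_def lookup_minus)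

lemma ev_add_right: "ev f (v + w) = ev f v + ev f w"
  by (simp add: ev_def act_add_right dcoef_add)

lemma ev_pscale_left: "ev (pscale c f) v = c * ev f v"
  by (simp add: ev_def act_pscale_left dcoef_pscale)

lemma ev_pscale_right: "ev f (pscale c v) = c * ev f v"
  by (simp add: ev_def act_pscale_right dcoef_pscale)

lemma dcoef_ev: "dcoef v m = ev (sing m 1) v"
  by (simp add: ev_def act_single dcoef_pmono_op)

lemma ev_nondegenerate:
  assumes "v \<in> polys n" "\<And>f. f \<in> polys n \<Longrightarrow> ev f v = 0" shows "v = 0"
proof (rule dcoef_eqI)
  fix m show "dcoef v m = dcoef 0 m"
  proof (cases "supp m \<subseteq> {1..n}")
    case True
    then have "sing m 1 \<in> polys n" by (simp add: polys_single)
    then show ?thesis using assms(2) by (simp add: dcoef_ev[of v m])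
  next
    case False
    then show ?thesis using assms(1) by (auto simp: polys_dcoef)
  qed
qed

text \<open>A finite-dimensional span is its own double orthogonal. When a form \<open>f0\<close>
  kills \<open>S\<close> but not \<open>w\<close>, subtracting multiples of \<open>w\<close> and of
  \<open>f0\<close> reduces the claim to \<open>S\<close>; otherwise \<open>w\<close> imposes no new
  condition.\<close>

lemma double_perp:
  assumes "finite S" "S \<subseteq> polys n" "v \<in> polys n"
    and "\<And>f. f \<in> polys n \<Longrightarrow> (\<And>w. w \<in> S \<Longrightarrow> ev f w = 0) \<Longrightarrow> ev f v = 0"
  shows "v \<in> P.span S"
  using assms
proof (induction S arbitrary: v rule: finite_induct)
  case empty
  then show ?case using ev_nondegenerate[of v n] by (simp add: P.span_zero)
next
  case (insert w S)
  have mono: "P.span S \<subseteq> P.span (insert w S)" by (rule P.span_mono) auto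
  show ?case
  proof (cases "\<exists>f0\<in>polys n. (\<forall>s\<in>S. ev f0 s = 0) \<and> ev f0 w \<noteq> 0")
    case True
    then obtain f0 where f0: "f0 \<in> polys n" "\<And>s. s \<in> S \<Longrightarrow> ev f0 s = 0" "ev f0 w \<noteq> 0" by blast
    define v' where "v' = v - pscale (ev f0 v / ev f0 w) w"
    have "v' \<in> P.span S"
    proof (rule insert.IH)
      show "S \<subseteq> polys n" "v' \<in> polys n" using insert.prems by (auto simp: v'_def)
      fix f assume f: "f \<in> polys n" "\<And>s. s \<in> S \<Longrightarrow> ev f s = 0"
      \<comment> \<open>The correction makes the form vanish on \<open>w\<close> as well, so that
        the hypothesis on \<open>v\<close> applies.\<close>
      define f' where "f' = f - pscale (ev f w / ev f0 w) f0"
      have "f' \<in> polys n" using f f0 by (auto simp: f'_def)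
      moreover have "ev f' s = 0" if "s \<in> insert w S" for s
        using that f(2) f0 by (auto simp: f'_def ev_diff_left ev_pscale_left)
      ultimately have "ev f' v = 0" using insert.prems(3) by blast
      then show "ev f v' = 0"
        using f0(3) by (simp add: f'_def v'_def ev_diff_left ev_pscale_left ev_diff_right ev_pscale_right mult.commute)
    qed
    then have "v' \<in> P.span (insert w S)" using mono by blast
    moreover have "pscale (ev f0 v / ev f0 w) w \<in> P.span (insert w S)"
      by (intro P.span_scale P.span_base) simp
    ultimately have "v' + pscale (ev f0 v / ev f0 w) w \<in> P.span (insert w S)"
      by (rule P.span_add)
    then show ?thesis by (simp add: v'_def)
  next
    case False
    have "v \<in> P.span S"
    proof (rule insert.IH)
      fix f assume f: "f \<in> polys n" "\<And>s. s \<in> S \<Longrightarrow> ev f s = 0"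
      then have "ev f w = 0" using False by blast
      then show "ev f v = 0" using f insert.prems(3)[of f] by auto
    qed (use insert.prems in auto)
    then show ?thesis using mono by blast
  qed
qed

text \<open>The cyclic module generated by \<open>h\<close>, which is Macaulay's inverse system of
  \<open>ann n h\<close>.\<close>

definition derivs :: "nat \<Rightarrow> cpoly \<Rightarrow> cpoly set" where
  "derivs n h = (\<lambda>p. act p h) ` polys n"

lemma derivs_subspace: "P.subspace (derivs n h)"
proof (rule P.subspaceI)
  show "0 \<in> derivs n h" unfolding derivs_def by (rule image_eqI[of _ _ 0]) auto
  show "x + y \<in> derivs n h" if "x \<in> derivs n h" "y \<in> derivs n h" for x y
    using that by (auto simp: derivs_def simp flip: act_add_left)
  show "pscale c x \<in> derivs n h" if "x \<in> derivs n h" for c x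
    using that by (auto simp: derivs_def simp flip: act_pscale_left)
qed

text \<open>Derivatives of \<open>h\<close> have degree at most that of \<open>h\<close> and so lie
  in a finite-dimensional space.\<close>

lemma derivs_basis:
  assumes h: "h \<in> polys n"
  obtains B where "finite B" "B \<subseteq> derivs n h" "P.independent B" "derivs n h = P.span B"
proof -
  obtain B where B: "B \<subseteq> derivs n h" "P.independent B" "derivs n h \<subseteq> P.span B"
    using P.maximal_independent_subset[of "derivs n h"] by blast
  \<comment> \<open>The inserted 0 provides for \<open>h = 0\<close>, whose support is
    empty.\<close>
  define d where "d = Max (insert 0 (wt (\<lambda>_. 1) ` supp h))"
  let ?M = "\<Union>e\<le>d. mons n e 1"
  have "x \<in> P.span ((\<lambda>m. sing m 1) ` ?M)" if x: "x \<in> derivs n h" for x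
  proof -
    have xp: "x \<in> polys n" using x h by (auto simp: derivs_def)
    have "m \<in> ?M" if m: "m \<in> supp x" for m
    proof -
      obtain p where p: "x = act p h" using x by (auto simp: derivs_def)
      have "dcoef x m \<noteq> 0" using m by (simp add: dcoef_def in_keys_iff)
      then have "\<exists>a. dcoef h (m + a) \<noteq> 0" by (rule contrapos_np) (simp add: p dcoef_act)
      then obtain a where "m + a \<in> supp h" by (auto simp: dcoef_def in_keys_iff)
      then have "wt (\<lambda>_. 1) (m + a) \<le> d" unfolding d_def by (intro Max_ge) auto
      then have "wt (\<lambda>_. 1) m \<le> d" by (simp add: wt_add)
      then show ?thesis using m xp by (auto simp: polys_def)
    qed
    moreover have "sing m c \<in> P.span ((\<lambda>m. sing m 1) ` ?M)" if "m \<in> ?M" for m c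
    proof -
      have "sing m c = pscale c (sing m 1)" by (simp add: pscale_single)
      then show ?thesis using P.span_scale[OF P.span_base[OF imageI[OF that]]] by simp
    qed
    ultimately have "(\<Sum>m\<in>supp x. sing m (coef x m)) \<in> P.span ((\<lambda>m. sing m 1) ` ?M)"
      by (intro P.span_sum) blast
    then show ?thesis by (simp flip: poly_mapping_decompose)
  qed
  then have "B \<subseteq> P.span ((\<lambda>m. sing m 1) ` ?M)" using B(1) by blast
  moreover have "finite ((\<lambda>m. sing m (1::complex)) ` ?M)" by (intro finite_imageI finite_UN_I finite_mons) auto
  ultimately have "finite B" using P.independent_span_bound[OF _ B(2)] by blast
  moreover have "derivs n h = P.span B"
    using B(1,3) P.span_minimal[OF B(1) derivs_subspace] by blast
  ultimately show ?thesis by (rule that[OF _ B(1,2)])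
qed

text \<open>A form orthogonal to all derivatives of \<open>h\<close> annihilates \<open>h\<close>,
  because its values on the monomial derivatives are the coefficients
  \<open>dcoef (act f h) m\<close>. The claim is then \<open>double_perp\<close>.\<close>

lemma derivs_double_ann:
  assumes h: "h \<in> polys n" and v: "v \<in> polys n" and g: "\<And>g. g \<in> ann n h \<Longrightarrow> act g v = 0"
  shows "v \<in> derivs n h"
proof -
  obtain B where B: "finite B" "B \<subseteq> derivs n h" "derivs n h = P.span B" by (rule derivs_basis[OF h])
  have sub: "derivs n h \<subseteq> polys n" using h by (auto simp: derivs_def)
  have "v \<in> P.span B"
  proof (rule double_perp[OF B(1) _ v])
    show "B \<subseteq> polys n" using B(2) sub by blast
    fix f assume f: "f \<in> polys n" "\<And>w. w \<in> B \<Longrightarrow> ev f w = 0"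
    have e: "ev f w = 0" if "w \<in> P.span B" for w
      using that
    proof (induction rule: P.span_induct_alt)
      case base
      then show ?case by (simp add: ev_def)
    qed (auto simp: ev_add_right ev_pscale_right f(2))
    have "act f h = 0"
    proof (rule dcoef_eqI)
      fix m
      show "dcoef (act f h) m = dcoef 0 m"
      proof (cases "supp m \<subseteq> {1..n}")
        case True
        then have "act (sing m 1) h \<in> derivs n h" unfolding derivs_def by (intro imageI) (simp add: polys_single)
        then have "ev f (act (sing m 1) h) = 0" using e B(3) by blast
        then show ?thesis unfolding dcoef_ev[of "act f h"] by (simp add: ev_def act_commute[of f])
      next
        case False
        have "act f h \<in> polys n" using h by auto
        then show ?thesis using False by (auto simp: polys_dcoef)
      qed
    qed
    then have "act f v = 0" using f g by (simp add: ann_def)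
    then show "ev f v = 0" by (simp add: ev_def)
  qed
  then show ?thesis using B by simp
qed

section \<open>Complex conjugation and positivity\<close>

definition cj :: "cpoly \<Rightarrow> cpoly" where "cj p = Poly_Mapping.map cnj p"

lemma coef_cj [simp]: "coef (cj p) m = cnj (coef p m)"
  by (simp add: cj_def map.rep_eq when_def)

lemma supp_cj [simp]: "supp (cj p) = supp p" by (auto simp: in_keys_iff)

lemma cj_add: "cj (p + q) = cj p + cj q"
  by (rule poly_mapping_eqI) (simp add: lookup_add)

lemma cj_diff: "cj (p - q) = cj p - cj q"
  by (rule poly_mapping_eqI) (simp add: lookup_minus)

lemma cj_single: "cj (sing m c) = sing m (cnj c)"
  by (rule poly_mapping_eqI) (simp add: lookup_single when_def)

lemma cj_0 [simp]: "cj 0 = 0" by (rule poly_mapping_eqI) simp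

lemma cj_mult: "cj (p * q) = cj p * cj q"
proof (induction p rule: poly_mapping_single_induct)
  case (single a c)
  show ?case
    by (induction q rule: poly_mapping_single_induct) (simp_all add: cj_single mult_single distrib_left cj_add)
qed (simp_all add: distrib_right cj_add)

lemma cj_1 [simp]: "cj 1 = 1" using cj_single[of 0 1] by simp

lemma cj_prod: "cj (prod f A) = (\<Prod>a\<in>A. cj (f a))"
  by (induction A rule: infinite_finite_induct) (simp_all add: cj_mult)

lemma cj_X [simp]: "cj (X i) = X i" by (simp add: X_def cj_single)

lemma mfact_cnj [simp]: "cnj (mfact m) = mfact m" by (simp add: mfact_def)

lemma dcoef_cj: "dcoef (cj p) m = cnj (dcoef p m)" by (simp add: dcoef_def)

lemma cj_act: "cj (act p q) = act (cj p) (cj q)"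
  by (rule dcoef_eqI) (simp add: dcoef_cj dcoef_act)

lemma mfact_pos: "mfact m = of_real (\<Prod>i\<in>supp m. fact (coef m i))" "(\<Prod>i\<in>supp m. fact (coef m i) :: real) > 0"
  by (simp_all add: mfact_def prod_pos)

text \<open>Write w = q \<odot> h. As h is real, conjugating w \<odot> h = 0 gives cj w \<odot> h =
  0, hence cj w \<odot> w = q \<odot> (cj w \<odot> h) = 0. Its constant term is the sum of the
  squared moduli of the coefficients of w, weighted by factorials.\<close>

lemma act_derivs_injective:
  assumes h: "cj h = h" and w: "w \<in> derivs n h" "act w h = 0"
  shows "w = 0"
proof -
  obtain q where q: "w = act q h" using w(1) by (auto simp: derivs_def)
  have "act (cj w) h = cj (act w h)" by (simp add: cj_act h)
  moreover have "act (cj w) w = act q (act (cj w) h)" by (subst (2) q) (rule act_commute)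
  ultimately have "act (cj w) w = 0" using w(2) by simp
  then have "0 = dcoef (act (cj w) w) 0" by simp
  also have "\<dots> = (\<Sum>a\<in>supp w. of_real ((\<Prod>i\<in>supp a. fact (coef a i)) * (cmod (coef w a))\<^sup>2))"
    unfolding dcoef_act supp_cj
  proof (rule sum.cong[OF refl])
    fix a
    have "of_real ((cmod (coef w a))\<^sup>2) = coef w a * cnj (coef w a)" by (simp only: complex_norm_square)
    then show "coef (cj w) a * dcoef w (0 + a) = of_real ((\<Prod>i\<in>supp a. fact (coef a i)) * (cmod (coef w a))\<^sup>2)"
      unfolding dcoef_def mfact_pos(1) coef_cj of_real_mult by (simp add: mult.left_commute mult.commute del: of_real_prod of_real_power)
  qed
  finally have "of_real (\<Sum>a\<in>supp w. (\<Prod>i\<in>supp a. fact (coef a i)) * (cmod (coef w a))\<^sup>2) = (0 :: complex)"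
    unfolding of_real_sum by (rule sym)
  then have "(\<Sum>a\<in>supp w. (\<Prod>i\<in>supp a. fact (coef a i)) * (cmod (coef w a))\<^sup>2) = 0"
    by (simp only: of_real_eq_0_iff)
  then have "\<forall>a\<in>supp w. (\<Prod>i\<in>supp a. fact (coef a i)) * (cmod (coef w a))\<^sup>2 = 0"
    by (subst (asm) sum_nonneg_eq_0_iff) (auto intro!: mult_nonneg_nonneg prod_nonneg)
  then have "coef w a = 0" if "a \<in> supp w" for a
    using that mfact_pos(2)[of a] by fastforce
  then show ?thesis by (metis in_keys_iff keys_eq_empty all_not_in_conv)
qed

text \<open>An injective endomorphism of the finite-dimensional space \<open>derivs n h\<close> is
  surjective.\<close>

lemma act_derivs_surjective:
  assumes h: "cj h = h" "h \<in> polys n" and w: "w \<in> derivs n h"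
  shows "\<exists>w'\<in>derivs n h. w = act w' h"
proof -
  obtain B where B: "finite B" "B \<subseteq> derivs n h" "P.independent B" "derivs n h = P.span B"
    by (rule derivs_basis[OF h(2)])
  let ?T = "\<lambda>b. act b h"
  have sub: "derivs n h \<subseteq> polys n" using h by (auto simp: derivs_def)
  have sum_B: "(\<Sum>b\<in>B. pscale (c b) b) \<in> derivs n h" for c
    unfolding B(4) by (intro P.span_sum P.span_scale P.span_base)
  have lin: "(\<Sum>b\<in>B. pscale (c b) (?T b)) = ?T (\<Sum>b\<in>B. pscale (c b) b)" for c
    by (simp add: act_sum_left act_pscale_left)
  have T: "inj_on ?T B \<and> P.independent (?T ` B)"
  proof (rule family_independent[OF _ B(1)])
    fix c assume "(\<Sum>b\<in>B. pscale (c b) (?T b)) = 0"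
    then have "(\<Sum>b\<in>B. pscale (c b) b) = 0"
      unfolding lin using act_derivs_injective[OF h(1) sum_B] by blast
    then show "\<forall>b\<in>B. c b = 0" using P.independentD[OF B(3,1)] by blast
  qed
  have "B \<subseteq> polys n" using B(2) sub by (rule subset_trans)
  then have TB: "?T ` B \<subseteq> derivs n h" unfolding derivs_def by (rule image_mono)
  have "w \<in> P.span (?T ` B)"
  proof (rule ccontr)
    assume nw: "w \<notin> P.span (?T ` B)"
    then have "P.independent (insert w (?T ` B))" using T by (simp add: P.independent_insert)
    moreover have "insert w (?T ` B) \<subseteq> P.span B"
      using TB w unfolding B(4) by (rule insert_subsetI[rotated])
    ultimately have "card (insert w (?T ` B)) \<le> card B"
      using P.independent_span_bound[OF B(1)] by simp
    moreover have "w \<notin> ?T ` B" using nw P.span_base[of w "?T ` B"] by (rule contrapos_nn)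
    ultimately show False using T B(1) by (simp add: card_image)
  qed
  then obtain u where "w = (\<Sum>x\<in>?T ` B. pscale (u x) x)"
    using P.span_finite[of "?T ` B"] B(1) by auto
  then have "w = ?T (\<Sum>b\<in>B. pscale (u (?T b)) b)"
    using T by (simp add: sum.reindex lin)
  then show ?thesis using sum_B[of "\<lambda>b. u (?T b)"] by blast
qed

section \<open>Bases of superharmonics and of \<open>SR\<^sub>n\<close>\<close>

lemma quotient_family_basisD:
  assumes "quotient_family_basis scale V W I b"
  shows quotient_family_basis_independent:
      "finite F \<Longrightarrow> F \<subseteq> I \<Longrightarrow> (\<Sum>i\<in>F. scale (c i) (b i)) \<in> W \<Longrightarrow> \<forall>i\<in>F. c i = 0"
    and quotient_family_basis_span:
      "v \<in> V \<Longrightarrow> \<exists>F c. finite F \<and> F \<subseteq> I \<and> v - (\<Sum>i\<in>F. scale (c i) (b i)) \<in> W"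
proof -
  note c = assms[unfolded quotient_family_basis_def, THEN conjunct2]
  show "\<forall>i\<in>F. c i = 0" if "finite F" "F \<subseteq> I" "(\<Sum>i\<in>F. scale (c i) (b i)) \<in> W"
    using c[THEN conjunct1, THEN spec[of _ F], THEN spec[of _ c]] that by simp
  show "\<exists>F c. finite F \<and> F \<subseteq> I \<and> v - (\<Sum>i\<in>F. scale (c i) (b i)) \<in> W" if "v \<in> V"
    by (rule bspec[OF c[THEN conjunct2] that])
qed

text \<open>Regarding a basis of \<open>V\<close> as a basis of \<open>V/0\<close> brings all three
  conditions into the same form.\<close>

lemma family_basis_iff:
  assumes V: "vector_space scale" and sub: "Modules.module.subspace scale V"
  shows "family_basis scale V I b \<longleftrightarrow> quotient_family_basis scale V {0} I b"
proof -
  interpret V: vector_space scale by (rule V)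
  show ?thesis
  proof
    assume fb: "family_basis scale V I b"
    then have inj: "inj_on b I" and ind: "V.independent (b ` I)" and span: "V.span (b ` I) = V"
      by (auto simp: family_basis_def)
    have "\<forall>i\<in>F. c i = 0" if F: "finite F" "F \<subseteq> I" "(\<Sum>i\<in>F. scale (c i) (b i)) = 0" for F c
    proof
      fix i assume i: "i \<in> F"
      have injF: "inj_on b F" using inj F(2) by (rule inj_on_subset)
      have "(\<Sum>v\<in>b ` F. scale (c (inv_into F b v)) v) = 0"
        using F(3) injF by (simp add: sum.reindex)
      then have "c (inv_into F b (b i)) = 0"
        using V.independentD[OF ind, of "b ` F" "\<lambda>v. c (inv_into F b v)" "b i"] F i by auto
      then show "c i = 0" using injF i by simp
    qed
    moreover have "\<exists>F c. finite F \<and> F \<subseteq> I \<and> v = (\<Sum>i\<in>F. scale (c i) (b i))" if "v \<in> V" for v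
    proof -
      have "v \<in> V.span (b ` I)" using that span by simp
      then obtain t r where t: "finite t" "t \<subseteq> b ` I" "v = (\<Sum>a\<in>t. scale (r a) a)"
        unfolding V.span_explicit by auto
      obtain F where F: "F \<subseteq> I" "finite F" "t = b ` F" using finite_subset_image[OF t(1,2)] by blast
      have "inj_on b F" using inj F(1) by (rule inj_on_subset)
      then have "v = (\<Sum>i\<in>F. scale (r (b i)) (b i))" using t(3) F(3) by (simp add: sum.reindex)
      then show ?thesis using F(1,2) by (intro exI[of _ F] exI[of _ "\<lambda>i. r (b i)"]) simp
    qed
    moreover have "b ` I \<subseteq> V" using V.span_superset span by blast
    ultimately show "quotient_family_basis scale V {0} I b"
      unfolding quotient_family_basis_def singleton_iff right_minus_eq by (intro conjI allI impI ballI) auto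
  next
    assume qfb: "quotient_family_basis scale V {0} I b"
    then have bV: "b ` I \<subseteq> V"
      and ind: "\<And>F c. finite F \<Longrightarrow> F \<subseteq> I \<Longrightarrow> (\<Sum>i\<in>F. scale (c i) (b i)) = 0 \<Longrightarrow> \<forall>i\<in>F. c i = 0"
      and span: "\<And>v. v \<in> V \<Longrightarrow> \<exists>F c. finite F \<and> F \<subseteq> I \<and> v = (\<Sum>i\<in>F. scale (c i) (b i))"
      by (auto simp: quotient_family_basis_def)
    have inj: "inj_on b I"
    proof (rule inj_onI, rule ccontr)
      fix i j assume ij: "i \<in> I" "j \<in> I" "b i = b j" "i \<noteq> j"
      have "(\<Sum>k\<in>{i, j}. scale ((if k = i then 1 else -1)) (b k)) = 0" using ij by simp
      then have "\<forall>k\<in>{i, j}. (if k = i then 1 else -1) = (0::complex)" using ij by (intro ind) auto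
      then show False by simp
    qed
    moreover have "V.independent (b ` I)"
    proof
      assume "V.dependent (b ` I)"
      then obtain t u where t: "finite t" "t \<subseteq> b ` I" "(\<Sum>v\<in>t. scale (u v) v) = 0" "\<exists>v\<in>t. u v \<noteq> 0"
        unfolding V.dependent_explicit by auto
      obtain F where F: "F \<subseteq> I" "finite F" "t = b ` F" using finite_subset_image[OF t(1,2)] by blast
      have "inj_on b F" using inj F(1) by (rule inj_on_subset)
      then have "(\<Sum>i\<in>F. scale (u (b i)) (b i)) = 0" using t(3) F(3) by (simp add: sum.reindex)
      then have "\<forall>i\<in>F. u (b i) = 0" using F by (intro ind) auto
      then show False using t(4) F(3) by auto
    qed
    moreover have "V.span (b ` I) = V"
    proof
      show "V.span (b ` I) \<subseteq> V" by (rule V.span_minimal[OF bV sub])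
      show "V \<subseteq> V.span (b ` I)"
      proof
        fix v assume "v \<in> V"
        then obtain F c where F: "F \<subseteq> I" and v: "v = (\<Sum>i\<in>F. scale (c i) (b i))" using span by blast
        show "v \<in> V.span (b ` I)"
          unfolding v by (rule V.span_sum, rule V.span_scale, rule V.span_base) (use F in blast)
      qed
    qed
    ultimately show "family_basis scale V I b" by (simp add: family_basis_def)
  qed
qed

lemma SH_subspace: "Modules.module.subspace sscale (SH n)"
proof -
  interpret S: vector_space sscale by (rule vector_space_sscale)
  show ?thesis by (rule S.subspaceI) (auto simp: SH_0 SH_add SH_sscale)
qed

section \<open>The two triangular systems\<close>

context
  fixes n :: nat
begin

abbreviation (input) Js :: "nat set set" where "Js \<equiv> Pow {1..n}"

definition hh :: "nat set \<Rightarrow> cpoly" where "hh J = act (fJ n J) (vandermonde n)"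

definition DD :: "nat set \<Rightarrow> sform" where "DD J = D_op n J (of_poly (vandermonde n))"

definition UU :: "nat set \<Rightarrow> cpoly \<Rightarrow> sform" where "UU J p = (sing J p \<Odot> DD J) \<Odot> DD J"

lemma hh_polys [simp]: "hh J \<in> polys n" unfolding hh_def by auto

text \<open>Both \<open>fJ\<close> and \<open>vandermonde\<close> are products of forms with real
  coefficients; positivity depends on this.\<close>

lemma hh_cj: "cj (hh J) = hh J"
  unfolding hh_def cj_act by (simp add: fJ_def vandermonde_def cj_prod cj_mult cj_diff)

lemma DD_SH: "DD J \<in> SH n" unfolding DD_def by (intro SH_D_op SH_vandermonde)

lemma DD_superspace: "DD J \<in> superspace n" by (rule SH_superspace[OF DD_SH])

lemma DD_coef:
  assumes "J \<in> Js" "coef (DD J) K \<noteq> 0" shows "card K = card J" "K = J \<or> \<Sum>K < \<Sum>J"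
proof -
  have K: "K \<subseteq> {1..n}" using assms(2) DD_superspace superspace_coef_0 by blast
  show "card K = card J" "K = J \<or> \<Sum>K < \<Sum>J"
    using D_op_vandermonde_coef(1,2)[OF _ K, of J] assms unfolding DD_def by auto
qed

lemma DD_coef_self: "J \<in> Js \<Longrightarrow> \<exists>s. coef (DD J) J = (-1) ^ s * hh J"
  using D_op_vandermonde_coef(3)[of J n J] unfolding DD_def hh_def by auto

lemma single_superspace: "J \<in> Js \<Longrightarrow> p \<in> polys n \<Longrightarrow> sing J p \<in> superspace n"
  by (intro superspace_single) auto

text \<open>All terms of \<open>DD J\<close> have exactly \<open>card J\<close> theta factors, so
  contraction by \<open>\<theta>\<^sub>J\<close> sees only the coefficient at \<open>J\<close>. The
  exponent \<open>t\<close> is chosen before \<open>p\<close>, which makes \<open>UU J\<close>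
  linear in \<open>p\<close>.\<close>

lemma single_DD:
  assumes J: "J \<in> Js"
  shows "\<exists>t. \<forall>p\<in>polys n. sing J p \<Odot> DD J = of_poly ((-1) ^ t * act p (hh J))"
proof -
  obtain s where s: "coef (DD J) J = (-1) ^ s * hh J" using DD_coef_self[OF J] by blast
  have finJ: "finite J" using J by (auto intro: finite_subset)
  have "sing J p \<Odot> DD J = of_poly ((-1) ^ (c2 (card J) + s) * act p (hh J))" if p: "p \<in> polys n" for p
  proof (rule superspace_eqI[of _ n])
    show "of_poly ((-1) ^ (c2 (card J) + s) * act p (hh J)) \<in> superspace n"
      by (intro superspace_of_poly polys_mult) auto
    fix L assume L: "L \<subseteq> {1..n}"
    have finL: "finite L" using L by (rule finite_subset) auto
    have "coef (sing J p \<Odot> DD J) L = (\<Sum>K\<in>Pow {1..n}. if K = J then (if J \<inter> L = {} then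
        (-1) ^ (cr J L + c2 (card J)) * act p (coef (DD J) (J \<union> L)) else 0) else 0)"
      unfolding coef_sodot[OF single_superspace[OF J p] finL]
      by (intro sum.cong) (auto simp: lookup_single when_def)
    also have "\<dots> = (if J \<inter> L = {} then (-1) ^ (cr J L + c2 (card J)) * act p (coef (DD J) (J \<union> L)) else 0)"
      using J by (simp add: sum.delta)
    also have "\<dots> = coef (of_poly ((-1) ^ (c2 (card J) + s) * act p (hh J))) L"
    proof (cases "L = {}")
      case True
      then show ?thesis by (simp add: of_poly_def s act_sign_right power_add mult.assoc)
    next
      case False
      have "coef (DD J) (J \<union> L) = 0" if "J \<inter> L = {}"
      proof (rule ccontr)
        assume "coef (DD J) (J \<union> L) \<noteq> 0"
        then have "card (J \<union> L) = card J" by (rule DD_coef(1)[OF J])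
        then show False using that False finJ finL by (simp add: card_Un_disjoint)
      qed
      then show ?thesis using False by (simp add: of_poly_def lookup_single when_def)
    qed
    finally show "coef (sing J p \<Odot> DD J) L = coef (of_poly ((-1) ^ (c2 (card J) + s) * act p (hh J))) L" .
  qed (use DD_superspace in auto)
  then show ?thesis by blast
qed

lemma UU_coef:
  assumes J: "J \<in> Js"
  shows "\<exists>t. \<forall>p\<in>polys n. \<forall>K. coef (UU J p) K = (-1) ^ t * act (act p (hh J)) (coef (DD J) K)"
  using single_DD[OF J] unfolding UU_def by (force simp: act_sign_left)

lemma UU_coef_self:
  assumes J: "J \<in> Js"
  shows "\<exists>t. \<forall>p\<in>polys n. coef (UU J p) J = (-1) ^ t * act (act p (hh J)) (hh J)"
proof -
  obtain s where s: "coef (DD J) J = (-1) ^ s * hh J" using DD_coef_self[OF J] by blast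
  obtain t where t: "\<And>p K. p \<in> polys n \<Longrightarrow> coef (UU J p) K = (-1) ^ t * act (act p (hh J)) (coef (DD J) K)"
    using UU_coef[OF J] by blast
  have "coef (UU J p) J = (-1) ^ (t + s) * act (act p (hh J)) (hh J)" if "p \<in> polys n" for p
    using t[OF that, of J] by (simp add: s act_sign_right power_add mult.assoc)
  then show ?thesis by blast
qed

lemma UU_support:
  assumes "J \<in> Js" "p \<in> polys n" "coef (UU J p) K \<noteq> 0" shows "K = J \<or> \<Sum>K < \<Sum>J"
proof -
  have "coef (DD J) K \<noteq> 0" using UU_coef[OF assms(1)] assms(2,3) by fastforce
  then show ?thesis by (rule DD_coef(2)[OF assms(1)])
qed

lemma UU_0: "J \<in> Js \<Longrightarrow> p \<in> polys n \<Longrightarrow> act p (hh J) = 0 \<Longrightarrow> UU J p = 0"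
  using UU_coef[of J] by (intro poly_mapping_eqI) auto

lemma UU_add:
  assumes J: "J \<in> Js" and "p \<in> polys n" "q \<in> polys n" shows "UU J (p + q) = UU J p + UU J q"
proof (rule poly_mapping_eqI)
  fix K
  obtain t where t: "\<And>p K. p \<in> polys n \<Longrightarrow> coef (UU J p) K = (-1) ^ t * act (act p (hh J)) (coef (DD J) K)"
    using UU_coef[OF J] by blast
  have "p + q \<in> polys n" using assms by auto
  then show "coef (UU J (p + q)) K = coef (UU J p + UU J q) K"
    using assms by (simp add: t lookup_add act_add_left distrib_left)
qed

lemma UU_pscale:
  assumes J: "J \<in> Js" and "p \<in> polys n" shows "UU J (pscale c p) = sscale c (UU J p)"
proof (rule poly_mapping_eqI)
  fix K
  obtain t where t: "\<And>p K. p \<in> polys n \<Longrightarrow> coef (UU J p) K = (-1) ^ t * act (act p (hh J)) (coef (DD J) K)"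
    using UU_coef[OF J] by blast
  have "pscale c p \<in> polys n" using assms by auto
  then show "coef (UU J (pscale c p)) K = coef (sscale c (UU J p)) K"
    using assms by (simp add: t lookup_sscale act_pscale_left pscale_mult_right)
qed

lemma UU_SH: "J \<in> Js \<Longrightarrow> p \<in> polys n \<Longrightarrow> UU J p \<in> SH n"
  using single_DD[of J] unfolding UU_def by (metis SH_of_poly DD_SH)

abbreviation (input) AA :: "nat set \<Rightarrow> cpoly set" where "AA J \<equiv> ann n (hh J)"

lemma AA_eq: "J \<in> Js \<Longrightarrow> colon n (coinv_ideal n) (fJ n J) = AA J"
  using colon_coinv_ideal[of J n] by (auto simp: hh_def)

lemma AA_lead: "J \<in> Js \<Longrightarrow> AA J \<subseteq> lead n J"
  using colon_coinv_ideal(2)[of J n] EJ_lead[of J n] by (auto simp: hh_def)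

lemma ex_max_rank:
  fixes r :: "'a \<Rightarrow> nat"
  assumes "finite S" "S \<noteq> {}" shows "\<exists>L\<in>S. \<forall>K\<in>S. r K \<le> r L"
proof -
  have "Max (r ` S) \<in> r ` S" using assms by (intro Max_in) auto
  then obtain L where "L \<in> S" "r L = Max (r ` S)" by auto
  then show ?thesis using assms(1) by (auto intro!: bexI[of _ L])
qed

text \<open>Among the \<open>J\<close> with \<open>act (p J) (hh J) \<noteq> 0\<close> take
  \<open>L\<close> of largest rank. No other summand reaches \<open>\<theta>\<^sub>L\<close>, so the
  coefficient there is that of \<open>UU L (p L)\<close>, and \<open>act_derivs_injective\<close>
  forbids its vanishing.\<close>

lemma UU_sum_zero:
  assumes p: "\<And>J. J \<in> Js \<Longrightarrow> p J \<in> polys n" and z: "(\<Sum>J\<in>Js. UU J (p J)) = 0" and J: "J \<in> Js"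
  shows "p J \<in> AA J"
proof (rule ccontr)
  assume "p J \<notin> AA J"
  then have "act (p J) (hh J) \<noteq> 0" using p[OF J] by (simp add: ann_def)
  then have J': "J \<in> {J\<in>Js. act (p J) (hh J) \<noteq> 0}" (is "_ \<in> ?S") using J by simp
  have "finite ?S" by simp
  then have "\<exists>L\<in>?S. \<forall>K\<in>?S. \<Sum>K \<le> \<Sum>L" using J' by (intro ex_max_rank) (simp, blast)
  then obtain L where LS: "L \<in> ?S" and maxS: "\<forall>K\<in>?S. \<Sum>K \<le> \<Sum>L" by (rule bexE)
  have L: "L \<in> Js" "act (p L) (hh L) \<noteq> 0" using LS by simp_all
  have max: "\<Sum>K \<le> \<Sum>L" if "K \<in> Js" "act (p K) (hh K) \<noteq> 0" for K
    using bspec[OF maxS, of K] that by simp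
  have "0 = coef (\<Sum>J\<in>Js. UU J (p J)) L" using z by simp
  also have "\<dots> = (\<Sum>J\<in>Js. if J = L then coef (UU L (p L)) L else 0)"
    unfolding lookup_sum
  proof (rule sum.cong[OF refl])
    fix K assume K: "K \<in> Js"
    have "coef (UU K (p K)) L = 0" if "K \<noteq> L"
    proof (rule ccontr)
      assume nz: "coef (UU K (p K)) L \<noteq> 0"
      then have "\<Sum>L < \<Sum>K" using UU_support[OF K p[OF K]] that by blast
      moreover have "act (p K) (hh K) \<noteq> 0" using nz UU_0[OF K p[OF K]] by auto
      ultimately show False using max[OF K] by simp
    qed
    then show "coef (UU K (p K)) L = (if K = L then coef (UU L (p L)) L else 0)" by auto
  qed
  also have "\<dots> = coef (UU L (p L)) L" using L by (simp add: sum.delta)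
  finally have "act (act (p L) (hh L)) (hh L) = 0" using UU_coef_self[OF L(1)] p[OF L(1)] by auto
  moreover have "act (p L) (hh L) \<in> derivs n (hh L)" using p L by (auto simp: derivs_def)
  ultimately show False using L(2) act_derivs_injective[OF hh_cj] by blast
qed

text \<open>At a set \<open>J\<close> of top rank, pair \<open>v\<close> with elements of
  \<open>SI n\<close> led by \<open>g \<in> AA J\<close>: their other terms have larger rank, where
  \<open>v\<close> vanishes, so \<open>g\<close> annihilates the coefficient of \<open>v\<close> at
  \<open>J\<close>. By duality this coefficient is a derivative of \<open>hh J\<close>, and by
  surjectivity it is the leading coefficient of some \<open>UU J q\<close>, which can be
  subtracted.\<close>

lemma UU_span:
  assumes "v \<in> SH n" "\<And>K. coef v K \<noteq> 0 \<Longrightarrow> \<Sum>K < k"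
  shows "\<exists>p. (\<forall>J\<in>Js. p J \<in> polys n) \<and> v = (\<Sum>J\<in>Js. UU J (p J))"
  using assms
proof (induction k arbitrary: v)
  case 0
  then have "v = 0" by - (rule poly_mapping_eqI, force)
  moreover have "UU J 0 = 0" if "J \<in> Js" for J using that by (intro UU_0) auto
  ultimately show ?case by (intro exI[of _ "\<lambda>_. 0"]) auto
next
  case (Suc k)
  have vs: "v \<in> superspace n" using Suc.prems(1) by (rule SH_superspace)
  have "\<exists>q\<in>polys n. coef (UU J q) J = coef v J" if J: "J \<in> Js" and k: "\<Sum>J = k" for J
  proof -
    have "act g (coef v J) = 0" if g: "g \<in> AA J" for g
    proof -
      obtain F where F: "F \<in> SI n" "coef F J = g" "\<And>K. coef F K \<noteq> 0 \<Longrightarrow> K = J \<or> \<Sum>J < \<Sum>K"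
        using AA_lead[OF J] g unfolding lead_def by blast
      have "0 = pair F v" using SH_pair[OF Suc.prems(1) F(1)] by simp
      also have "\<dots> = (\<Sum>K\<in>Js. if K = J then (-1) ^ c2 (card J) * act g (coef v J) else 0)"
        unfolding pair_eq[OF SI_superspace[OF F(1)]]
      proof (rule sum.cong[OF refl])
        fix K
        have "act (coef F K) (coef v K) = 0" if ne: "K \<noteq> J"
        proof (rule ccontr)
          assume "act (coef F K) (coef v K) \<noteq> 0"
          then have "coef F K \<noteq> 0" "coef v K \<noteq> 0" by auto
          then have "\<Sum>J < \<Sum>K" "\<Sum>K < Suc k" using F(3)[of K] Suc.prems(2)[of K] ne by simp_all
          then show False using k by simp
        qed
        then show "(-1) ^ c2 (card K) * act (coef F K) (coef v K) = (if K = J then (-1) ^ c2 (card J) * act g (coef v J) else 0)"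
          by (auto simp: F(2))
      qed
      also have "\<dots> = (-1) ^ c2 (card J) * act g (coef v J)" using J by (simp add: sum.delta)
      finally show ?thesis by simp
    qed
    then have "coef v J \<in> derivs n (hh J)" using superspace_coef[OF vs] by (intro derivs_double_ann) auto
    from act_derivs_surjective[OF hh_cj hh_polys this]
    obtain w q where w: "coef v J = act w (hh J)" "w = act q (hh J)" "q \<in> polys n"
      unfolding derivs_def by blast
    obtain t where t: "\<And>p. p \<in> polys n \<Longrightarrow> coef (UU J p) J = (-1) ^ t * act (act p (hh J)) (hh J)"
      using UU_coef_self[OF J] by blast
    have q': "(-1) ^ t * q \<in> polys n" using w by (intro polys_mult) auto
    have "coef (UU J ((-1) ^ t * q)) J = coef v J"
      unfolding t[OF q'] w(1,2) by (simp add: act_sign_left flip: mult.assoc power_add mult_2)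
    then show ?thesis using q' by blast
  qed
  then obtain q where q: "\<And>J. J \<in> Js \<Longrightarrow> \<Sum>J = k \<Longrightarrow> q J \<in> polys n \<and> coef (UU J (q J)) J = coef v J" by metis
  \<comment> \<open>Only the sets of rank \<open>k\<close> are corrected in this round; what the
    correction adds elsewhere has smaller rank.\<close>
  define q' where "q' J = (if \<Sum>J = k then q J else 0)" for J
  have q'p: "q' J \<in> polys n" if "J \<in> Js" for J using q that by (auto simp: q'_def)
  have U0: "UU J 0 = 0" if "J \<in> Js" for J using that by (intro UU_0) auto
  define v' where "v' = v + sscale (-1) (\<Sum>J\<in>Js. UU J (q' J))"
  have v'c: "coef v' K = coef v K - (\<Sum>J\<in>Js. coef (UU J (q' J)) K)" for K
    by (simp add: v'_def lookup_add lookup_sscale lookup_sum)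
  have "v' \<in> SH n" unfolding v'_def using Suc.prems(1) q'p by (intro SH_add SH_sscale SH_sum UU_SH) auto
  moreover have "\<Sum>K < k" if nz: "coef v' K \<noteq> 0" for K
  proof (rule ccontr)
    assume "\<not> \<Sum>K < k"
    have K: "K \<in> Js" using nz superspace_coef_0[OF SH_superspace[OF \<open>v' \<in> SH n\<close>]] by blast
    have "(\<Sum>J\<in>Js. coef (UU J (q' J)) K) = (\<Sum>J\<in>Js. if J = K then coef (UU K (q' K)) K else 0)"
    proof (rule sum.cong[OF refl])
      fix J assume J: "J \<in> Js"
      have "coef (UU J (q' J)) K = 0" if "J \<noteq> K"
      proof (rule ccontr)
        assume "coef (UU J (q' J)) K \<noteq> 0"
        moreover from this have "\<Sum>J = k" using U0[OF J] by (auto simp: q'_def split: if_splits)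
        ultimately show False using UU_support[OF J q'p[OF J]] that \<open>\<not> \<Sum>K < k\<close> by blast
      qed
      then show "coef (UU J (q' J)) K = (if J = K then coef (UU K (q' K)) K else 0)" by auto
    qed
    then have "coef v' K = coef v K - coef (UU K (q' K)) K" using K by (simp add: v'c sum.delta)
    moreover have "coef v K = 0" if "\<Sum>K \<noteq> k" using Suc.prems(2)[of K] that \<open>\<not> \<Sum>K < k\<close> by force
    ultimately show False using nz q[OF K] U0[OF K] by (cases "\<Sum>K = k") (auto simp: q'_def)
  qed
  ultimately obtain p where p: "\<And>J. J \<in> Js \<Longrightarrow> p J \<in> polys n" "v' = (\<Sum>J\<in>Js. UU J (p J))"
    using Suc.IH by blast
  have "v = v' + (\<Sum>J\<in>Js. UU J (q' J))"
    by (intro poly_mapping_eqI) (simp add: lookup_add v'c lookup_sum)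
  also have "\<dots> = (\<Sum>J\<in>Js. UU J (p J + q' J))"
    using p q'p by (simp add: UU_add sum.distrib)
  finally show ?case using p q'p by (intro exI[of _ "\<lambda>J. p J + q' J"]) auto
qed

text \<open>Let \<open>L\<close> be of least rank with \<open>p L \<noteq> 0\<close> and pair with
  the superharmonic \<open>DD L\<close>. Its other terms have smaller rank, where \<open>p\<close>
  vanishes, so \<open>p L\<close> annihilates \<open>hh L\<close> and is 0 by the assumption on
  \<open>AA L\<close>.\<close>

lemma SI_single_sum_zero:
  assumes p: "\<And>J. J \<in> Js \<Longrightarrow> p J \<in> polys n" and z: "(\<Sum>J\<in>Js. sing J (p J)) \<in> SI n"
    and A: "\<And>J. J \<in> Js \<Longrightarrow> p J \<in> AA J \<Longrightarrow> p J = 0" and J: "J \<in> Js"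
  shows "p J = 0"
proof (rule ccontr)
  assume "p J \<noteq> 0"
  then have "J \<in> Js \<and> p J \<noteq> 0" using J by simp
  then have "\<exists>L. (L \<in> Js \<and> p L \<noteq> 0) \<and> (\<forall>K. K \<in> Js \<and> p K \<noteq> 0 \<longrightarrow> \<Sum>L \<le> \<Sum>K)"
    by (rule ex_has_least_nat)
  then obtain L where LS: "L \<in> Js \<and> p L \<noteq> 0" and minS: "\<forall>K. K \<in> Js \<and> p K \<noteq> 0 \<longrightarrow> \<Sum>L \<le> \<Sum>K"
    by (elim exE conjE) simp
  have L: "L \<in> Js" "p L \<noteq> 0" using LS by simp_all
  have min: "\<Sum>L \<le> \<Sum>K" if "K \<in> Js" "p K \<noteq> 0" for K
    using minS that by simp
  let ?f = "\<Sum>J\<in>Js. sing J (p J)"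
  have c: "coef ?f K = (if K \<in> Js then p K else 0)" for K
    by (simp add: lookup_sum lookup_single when_def sum.delta)
  obtain s where s: "coef (DD L) L = (-1) ^ s * hh L" using DD_coef_self[OF L(1)] by blast
  have "0 = pair ?f (DD L)" using SH_pair[OF DD_SH z] by simp
  also have "\<dots> = (\<Sum>K\<in>Js. if K = L then (-1) ^ c2 (card L) * act (p L) (coef (DD L) L) else 0)"
    unfolding pair_eq[OF SI_superspace[OF z]]
  proof (rule sum.cong[OF refl])
    fix K assume K: "K \<in> Js"
    have "act (p K) (coef (DD L) K) = 0" if "K \<noteq> L"
      using that min[OF K] DD_coef(2)[OF L(1), of K] by (cases "p K = 0"; cases "coef (DD L) K = 0") auto
    then show "(-1) ^ c2 (card K) * act (coef ?f K) (coef (DD L) K) =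
        (if K = L then (-1) ^ c2 (card L) * act (p L) (coef (DD L) L) else 0)"
      using c[of K] K by (cases "K = L") simp_all
  qed
  also have "\<dots> = (-1) ^ c2 (card L) * act (p L) (coef (DD L) L)" using L by (simp add: sum.delta)
  finally have "act (p L) (hh L) = 0" by (simp add: s act_sign_right)
  then show False using A[OF L(1)] p[OF L(1)] L(2) by (simp add: ann_def)
qed

text \<open>The sweep runs upwards, as elements of \<open>SI n\<close> have their other terms in
  larger rank. The parameter \<open>k\<close> counts the ranks still to be treated, from the sum of
  [n] downwards, in additive form to avoid truncated subtraction.\<close>

lemma SI_single_span:
  assumes R: "\<And>J. J \<in> Js \<Longrightarrow> P.subspace (R J)"
    and ex: "\<And>J v. J \<in> Js \<Longrightarrow> v \<in> polys n \<Longrightarrow> \<exists>r\<in>R J. v - r \<in> AA J"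
    and Rp: "\<And>J. J \<in> Js \<Longrightarrow> R J \<subseteq> polys n"
    and v: "v \<in> superspace n" "\<And>K. coef v K \<noteq> 0 \<Longrightarrow> \<Sum>{1..n} < \<Sum>K + k"
  shows "\<exists>p. (\<forall>J\<in>Js. p J \<in> R J) \<and> v - (\<Sum>J\<in>Js. sing J (p J)) \<in> SI n"
  using v
proof (induction k arbitrary: v)
  case 0
  have "coef v K = 0" for K
  proof (rule ccontr)
    assume nz: "coef v K \<noteq> 0"
    then have "K \<subseteq> {1..n}" using superspace_coef_0[OF 0(1)] by blast
    then have "\<Sum>K \<le> \<Sum>{1..n}" by (intro sum_mono2) auto
    then show False using 0(2)[OF nz] by simp
  qed
  then have "v = 0" by (intro poly_mapping_eqI) simp
  then show ?case using R by (intro exI[of _ "\<lambda>_. 0"]) (auto simp: SI_0 P.subspace_0)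
next
  case (Suc k)
  let ?P = "\<lambda>J. \<Sum>{1..n} = \<Sum>J + k"
  have "\<exists>r F. r \<in> R J \<and> F \<in> SI n \<and> coef F J = coef v J - r \<and> (\<forall>K. coef F K \<noteq> 0 \<longrightarrow> K = J \<or> \<Sum>J < \<Sum>K)"
    if J: "J \<in> Js" for J
  proof -
    obtain r where r: "r \<in> R J" "coef v J - r \<in> AA J" using ex[OF J superspace_coef[OF Suc.prems(1)]] by blast
    then have "coef v J - r \<in> lead n J" using AA_lead[OF J] by blast
    then show ?thesis using r(1) unfolding lead_def by blast
  qed
  then obtain r F where rF: "\<And>J. J \<in> Js \<Longrightarrow> r J \<in> R J" "\<And>J. J \<in> Js \<Longrightarrow> F J \<in> SI n"
      "\<And>J. J \<in> Js \<Longrightarrow> coef (F J) J = coef v J - r J"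
      "\<And>J K. J \<in> Js \<Longrightarrow> coef (F J) K \<noteq> 0 \<Longrightarrow> K = J \<or> \<Sum>J < \<Sum>K"
    by metis
  let ?S = "{J\<in>Js. ?P J}"
  have finS: "finite ?S" by simp
  define f where "f = (\<Sum>J\<in>?S. F J)"
  define g where "g = (\<Sum>J\<in>?S. sing J (r J))"
  have fSI: "f \<in> SI n" unfolding f_def using rF by (intro SI_sum) auto
  have gs: "g \<in> superspace n" unfolding g_def
    by (intro superspace_sum superspace_single) (use rF(1) Rp in blast)+
  define v' where "v' = v + of_poly (-1) \<circledast> (f + g)"
  have v'c: "coef v' K = coef v K - coef f K - coef g K" for K
    by (simp add: v'_def lookup_add)
  have v's: "v' \<in> superspace n"
    unfolding v'_def using gs SI_superspace[OF fSI] Suc.prems(1)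
    by (intro superspace_add superspace_smult superspace_of_poly polys_uminus polys_1)
  have "\<Sum>{1..n} < \<Sum>K + k" if nz: "coef v' K \<noteq> 0" for K
  proof (rule ccontr)
    assume nlt: "\<not> \<Sum>{1..n} < \<Sum>K + k"
    have K: "K \<in> Js" using nz superspace_coef_0[OF v's] by blast
    have "coef f K = (\<Sum>J\<in>?S. if J = K then coef (F K) K else 0)"
      unfolding f_def lookup_sum
    proof (rule sum.cong[OF refl])
      fix J assume J: "J \<in> ?S"
      have "coef (F J) K = 0" if "J \<noteq> K"
        using rF(4)[of J K] J that nlt by (cases "coef (F J) K = 0") auto
      then show "coef (F J) K = (if J = K then coef (F K) K else 0)" by auto
    qed
    then have fK: "coef f K = (if K \<in> ?S then coef v K - r K else 0)"
      using finS rF(3)[OF K] by (simp add: sum.delta)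
    have gK: "coef g K = (if K \<in> ?S then r K else 0)"
      unfolding g_def lookup_sum using finS by (simp add: lookup_single when_def sum.delta)
    show False
    proof (cases "K \<in> ?S")
      case True
      then show False using nz by (simp add: v'c fK gK)
    next
      case False
      then have "coef v K = 0" using Suc.prems(2)[of K] nlt K by force
      moreover have "coef f K = 0" "coef g K = 0" using False unfolding fK gK by (simp_all only: if_False)
      ultimately show False using nz by (simp add: v'c)
    qed
  qed
  then obtain p where p: "\<And>J. J \<in> Js \<Longrightarrow> p J \<in> R J" "v' - (\<Sum>J\<in>Js. sing J (p J)) \<in> SI n"
    using Suc.IH[OF v's] by blast
  define p' where "p' J = p J + (if ?P J then r J else 0)" for J
  have "(\<Sum>J\<in>Js. sing J (p' J)) = (\<Sum>J\<in>Js. sing J (p J)) + (\<Sum>J\<in>Js. if ?P J then sing J (r J) else 0)"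
    unfolding p'_def sum.distrib[symmetric] by (intro sum.cong) (auto simp: single_add)
  also have "(\<Sum>J\<in>Js. if ?P J then sing J (r J) else 0) = g"
    unfolding g_def by (subst sum.inter_filter) auto
  finally have "v - (\<Sum>J\<in>Js. sing J (p' J)) = (v' - (\<Sum>J\<in>Js. sing J (p J))) + f"
    by (intro poly_mapping_eqI) (simp add: lookup_add lookup_minus v'c)
  then have "v - (\<Sum>J\<in>Js. sing J (p' J)) \<in> SI n" using SI_add[OF p(2) fSI] by simp
  moreover have "p' J \<in> R J" if "J \<in> Js" for J
    using p(1)[OF that] rF(1)[OF that] R[OF that] by (auto simp: p'_def P.subspace_add P.subspace_0)
  ultimately show ?case by blast
qed

text \<open>The part at \<open>J\<close> of a linear combination indexed by pairs; it reduces
  statements on the whole family to one polynomial for each \<open>J\<close>.\<close>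

definition comb :: "(nat set \<times> cpoly) set \<Rightarrow> (nat set \<times> cpoly \<Rightarrow> complex) \<Rightarrow> nat set \<Rightarrow> cpoly" where
  "comb F c J = (\<Sum>b\<in>{b. (J, b) \<in> F}. pscale (c (J, b)) b)"

text \<open>Stated for any family of maps that are linear in the polynomial, since it is applied to
  \<open>UU\<close> as well as to \<open>sing\<close>.\<close>

lemma sum_comb:
  fixes G :: "nat set \<Rightarrow> cpoly \<Rightarrow> sform"
  assumes B: "\<And>J. J \<in> Js \<Longrightarrow> B J \<subseteq> polys n" and F: "finite F" "F \<subseteq> (SIGMA J:Js. B J)"
    and add: "\<And>J p q. J \<in> Js \<Longrightarrow> p \<in> polys n \<Longrightarrow> q \<in> polys n \<Longrightarrow> G J (p + q) = G J p + G J q"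
    and scale: "\<And>J p c. J \<in> Js \<Longrightarrow> p \<in> polys n \<Longrightarrow> G J (pscale c p) = sscale c (G J p)"
  shows "(\<Sum>i\<in>F. sscale (c i) (case i of (J, b) \<Rightarrow> G J b)) = (\<Sum>J\<in>Js. G J (comb F c J))"
proof -
  have G0: "G J 0 = 0" if "J \<in> Js" for J using add[OF that, of 0 0] by simp
  have Gsum: "G J (\<Sum>b\<in>S. pscale (c (J, b)) b) = (\<Sum>b\<in>S. sscale (c (J, b)) (G J b))"
    if "J \<in> Js" "finite S" "S \<subseteq> B J" for J S
    using that(2,3)
  proof (induction S rule: finite_induct)
    case empty
    then show ?case using G0[OF that(1)] by simp
  next
    case (insert b S)
    have "b \<in> polys n" "(\<Sum>b\<in>S. pscale (c (J, b)) b) \<in> polys n" using insert B[OF that(1)] by auto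
    then show ?case using insert that by (simp add: add scale polys_pscale)
  qed
  have fin: "finite {b. (J, b) \<in> F}" for J
    using finite_imageI[OF F(1), of snd] by (rule finite_subset[rotated]) force
  have "F = (SIGMA J:Js. {b. (J, b) \<in> F})" using F by auto
  then have "(\<Sum>i\<in>F. sscale (c i) (case i of (J, b) \<Rightarrow> G J b))
      = (\<Sum>i\<in>(SIGMA J:Js. {b. (J, b) \<in> F}). sscale (c i) (case i of (J, b) \<Rightarrow> G J b))" by simp
  also have "\<dots> = (\<Sum>J\<in>Js. \<Sum>b\<in>{b. (J, b) \<in> F}. sscale (c (J, b)) (G J b))"
    using fin by (subst sum.Sigma) (auto simp: case_prod_beta intro!: sum.cong)
  also have "\<dots> = (\<Sum>J\<in>Js. G J (comb F c J))"
    unfolding comb_def using F fin by (intro sum.cong refl Gsum[symmetric]) auto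
  finally show ?thesis .
qed

lemma comb_polys:
  "(\<And>J. J \<in> Js \<Longrightarrow> B J \<subseteq> polys n) \<Longrightarrow> F \<subseteq> (SIGMA J:Js. B J) \<Longrightarrow> J \<in> Js \<Longrightarrow> comb F c J \<in> polys n"
  unfolding comb_def by (intro polys_sum polys_pscale) auto

lemma span_comb:
  assumes "\<And>J. J \<in> Js \<Longrightarrow> p J \<in> P.span (B J)"
  shows "\<exists>F c. finite F \<and> F \<subseteq> (SIGMA J:Js. B J) \<and> (\<forall>J\<in>Js. comb F c J = p J)"
proof -
  have "\<exists>f. finite (fst f) \<and> fst f \<subseteq> B J \<and> p J = (\<Sum>b\<in>fst f. pscale (snd f b) b)"
    if J: "J \<in> Js" for J
  proof -
    obtain t r where "finite t" "t \<subseteq> B J" "p J = (\<Sum>b\<in>t. pscale (r b) b)"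
      using assms[OF J] unfolding P.span_explicit by auto
    then show ?thesis by (intro exI[of _ "(t, r)"]) simp
  qed
  then have "\<forall>J\<in>Js. \<exists>f. finite (fst f) \<and> fst f \<subseteq> B J \<and> p J = (\<Sum>b\<in>fst f. pscale (snd f b) b)"
    by (rule ballI)
  from bchoice[OF this] obtain f where
    f: "\<forall>J\<in>Js. finite (fst (f J)) \<and> fst (f J) \<subseteq> B J \<and> p J = (\<Sum>b\<in>fst (f J). pscale (snd (f J) b) b)" ..
  define t r where "t J = fst (f J)" and "r J = snd (f J)" for J
  have t: "finite (t J) \<and> t J \<subseteq> B J \<and> p J = (\<Sum>b\<in>t J. pscale (r J b) b)" if "J \<in> Js" for J
    using bspec[OF f that] by (simp add: t_def r_def)
  let ?F = "SIGMA J:Js. t J" and ?c = "\<lambda>(J, b). r J b"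
  have "comb ?F ?c J = p J" if "J \<in> Js" for J
    using t[OF that] that by (simp add: comb_def)
  moreover have "finite ?F" "?F \<subseteq> (SIGMA J:Js. B J)" using t by (auto intro!: finite_SigmaI)
  ultimately show ?thesis by blast
qed

lemma sing_pscale: "sing J (pscale c p) = sscale c (sing J p)"
  by (rule poly_mapping_eqI) (auto simp: lookup_sscale lookup_single when_def)

section \<open>The three conditions and the implications between them\<close>

context
  fixes B :: "nat set \<Rightarrow> cpoly set"
  assumes B: "\<And>J. J \<in> Js \<Longrightarrow> B J \<subseteq> polys n"
begin

abbreviation (input) cond1 where
  "cond1 \<equiv> \<forall>J\<in>Js. quotient_family_basis pscale (polys n) (AA J) (B J) (\<lambda>b. b)"

abbreviation (input) cond2 where
  "cond2 \<equiv> quotient_family_basis sscale (SH n) {0} (SIGMA J:Js. B J) (\<lambda>(J, b). UU J b)"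

abbreviation (input) cond3 where
  "cond3 \<equiv> quotient_family_basis sscale (superspace n) (SI n) (SIGMA J:Js. B J) (\<lambda>(J, b). sing J b)"

lemma cond1_span:
  assumes "cond1" "J \<in> Js" "v \<in> polys n" shows "\<exists>q\<in>P.span (B J). v - q \<in> AA J"
proof -
  obtain F c where F: "finite F" "F \<subseteq> B J" "v - (\<Sum>i\<in>F. pscale (c i) i) \<in> AA J"
    using quotient_family_basis_span[OF bspec[OF assms(1,2)] assms(3)] by (elim exE conjE) simp
  have "(\<Sum>i\<in>F. pscale (c i) i) \<in> P.span (B J)"
    using F(2) by (intro P.span_sum P.span_scale P.span_base) auto
  then show ?thesis using F(3) by blast
qed

lemma cond1_comb:
  assumes "cond1" and F: "finite F" "F \<subseteq> (SIGMA J:Js. B J)" and J: "J \<in> Js" and c: "comb F c J \<in> AA J"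
  shows "\<forall>b. (J, b) \<in> F \<longrightarrow> c (J, b) = 0"
proof -
  have fin: "finite {b. (J, b) \<in> F}"
    using finite_imageI[OF F(1), of snd] by (rule finite_subset[rotated]) force
  have "{b. (J, b) \<in> F} \<subseteq> B J" using F(2) by auto
  then have "\<forall>b\<in>{b. (J, b) \<in> F}. c (J, b) = 0"
    using c unfolding comb_def by (rule quotient_family_basis_independent[OF bspec[OF assms(1) J] fin])
  then show ?thesis by simp
qed

text \<open>Relations are separated by \<open>UU_sum_zero\<close>. For spanning, the polynomials of
  \<open>UU_span\<close> are replaced by combinations of \<open>B J\<close> modulo
  \<open>AA J\<close>, a change that \<open>UU J\<close> does not see.\<close>

lemma cond1_imp_cond2:
  assumes 1: cond1 shows cond2
  unfolding quotient_family_basis_def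
proof (intro conjI allI impI ballI)
  show "(\<lambda>(J, b). UU J b) ` (SIGMA J:Js. B J) \<subseteq> SH n"
    using UU_SH[OF _ subsetD[OF B]] by (simp add: image_subset_iff)
next
  fix F c i assume a: "finite F \<and> F \<subseteq> (SIGMA J:Js. B J) \<and> (\<Sum>i\<in>F. sscale (c i) (case i of (J, b) \<Rightarrow> UU J b)) \<in> {0}"
    and i: "i \<in> F"
  then have F: "finite F" "F \<subseteq> (SIGMA J:Js. B J)" by auto
  have "(\<Sum>J\<in>Js. UU J (comb F c J)) = 0"
    using a sum_comb[OF B F, of UU c] UU_add UU_pscale by simp
  then have "comb F c J \<in> AA J" if "J \<in> Js" for J
    using that comb_polys[OF B F(2)] by (intro UU_sum_zero[of "comb F c"]) auto
  moreover obtain J b where "i = (J, b)" "J \<in> Js" using i F by auto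
  ultimately show "c i = 0" using cond1_comb[OF 1 F] i by blast
next
  fix v assume v: "v \<in> SH n"
  have "\<exists>p. (\<forall>J\<in>Js. p J \<in> polys n) \<and> v = (\<Sum>J\<in>Js. UU J (p J))"
  proof (rule UU_span[OF v, of "Suc (\<Sum>{1..n})"])
    fix K assume "coef v K \<noteq> 0"
    then have "K \<subseteq> {1..n}" using superspace_coef_0[OF SH_superspace[OF v]] by blast
    then have "\<Sum>K \<le> \<Sum>{1..n}" by (intro sum_mono2) auto
    then show "\<Sum>K < Suc (\<Sum>{1..n})" by simp
  qed
  then obtain p where p: "\<And>J. J \<in> Js \<Longrightarrow> p J \<in> polys n" "v = (\<Sum>J\<in>Js. UU J (p J))" by blast
  obtain q where q: "\<And>J. J \<in> Js \<Longrightarrow> q J \<in> P.span (B J) \<and> p J - q J \<in> AA J"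
  proof -
    have "\<forall>J\<in>Js. \<exists>q. q \<in> P.span (B J) \<and> p J - q \<in> AA J"
      using cond1_span[OF 1 _ p(1)] by (simp add: Bex_def)
    from bchoice[OF this] show ?thesis using that by blast
  qed
  have "\<exists>F c. finite F \<and> F \<subseteq> (SIGMA J:Js. B J) \<and> (\<forall>J\<in>Js. comb F c J = q J)"
    by (rule span_comb) (rule conjunct1[OF q])
  then obtain F c where F: "finite F" "F \<subseteq> (SIGMA J:Js. B J)" and Fc: "\<forall>J\<in>Js. comb F c J = q J"
    by (elim exE conjE)
  have F3: "comb F c J = q J" if "J \<in> Js" for J by (rule bspec[OF Fc that])
  have "UU J (p J) = UU J (q J)" if J: "J \<in> Js" for J
  proof -
    have "q J \<in> polys n" using comb_polys[OF B F(2) J, of c] F3[OF J] by simp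
    moreover have "p J - q J \<in> polys n" "act (p J - q J) (hh J) = 0" using q[OF J] by (auto simp: ann_def)
    ultimately have "UU J ((p J - q J) + q J) = UU J (q J)"
      using J by (subst UU_add) (auto simp: UU_0)
    then show ?thesis by simp
  qed
  then have "v = (\<Sum>J\<in>Js. UU J (comb F c J))" unfolding p(2) by (intro sum.cong refl) (simp only: F3)
  also have "\<dots> = (\<Sum>i\<in>F. sscale (c i) (case i of (J, b) \<Rightarrow> UU J b))"
    using sum_comb[OF B F(1,2), of UU c] UU_add UU_pscale by simp
  finally show "\<exists>F c. finite F \<and> F \<subseteq> (SIGMA J:Js. B J) \<and> v - (\<Sum>i\<in>F. sscale (c i) (case i of (J, b) \<Rightarrow> UU J b)) \<in> {0}"
    using F by (intro exI[of _ F] exI[of _ c]) simp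
qed

text \<open>A relation modulo \<open>AA J\<close> is killed by \<open>UU J\<close> and so becomes a
  relation in the family. To represent \<open>v\<close>, expand \<open>UU J v\<close> in the family;
  by \<open>UU_sum_zero\<close> the part of the expansion at \<open>J\<close> agrees with
  \<open>v\<close> modulo \<open>AA J\<close>.\<close>

lemma cond2_imp_cond1:
  assumes 2: cond2 shows cond1
proof
  fix J assume J: "J \<in> Js"
  have ind: "finite F \<Longrightarrow> F \<subseteq> (SIGMA J:Js. B J) \<Longrightarrow> (\<Sum>i\<in>F. sscale (c i) (case i of (J, b) \<Rightarrow> UU J b)) = 0 \<Longrightarrow> \<forall>i\<in>F. c i = 0" for F c
    by (rule quotient_family_basis_independent[OF 2]) simp_all
  show "quotient_family_basis pscale (polys n) (AA J) (B J) (\<lambda>b. b)"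
    unfolding quotient_family_basis_def
  proof (intro conjI allI impI ballI)
    show "(\<lambda>b. b) ` B J \<subseteq> polys n" using B[OF J] by simp
  next
    fix F c b assume a: "finite F \<and> F \<subseteq> B J \<and> (\<Sum>i\<in>F. pscale (c i) i) \<in> AA J" and b: "b \<in> F"
    let ?F = "{J} \<times> F" and ?c = "\<lambda>(J, b). c b"
    have F: "finite ?F" "?F \<subseteq> (SIGMA J:Js. B J)" using a J by auto
    have "UU K (comb ?F ?c K) = 0" if K: "K \<in> Js" for K
    proof (cases "K = J")
      case True
      then have "comb ?F ?c K = (\<Sum>i\<in>F. pscale (c i) i)" by (simp add: comb_def)
      then show ?thesis using a True K by (auto simp: ann_def intro!: UU_0)
    next
      case False
      then have "comb ?F ?c K = 0" by (simp add: comb_def)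
      then show ?thesis using K by (simp add: UU_0)
    qed
    then have "(\<Sum>i\<in>?F. sscale (?c i) (case i of (J, b) \<Rightarrow> UU J b)) = 0"
      using sum_comb[OF B F, of UU ?c] UU_add UU_pscale by simp
    then have "\<forall>i\<in>?F. ?c i = 0" by (rule ind[OF F])
    then show "c b = 0" using b by auto
  next
    fix v assume v: "v \<in> polys n"
    then have "UU J v \<in> SH n" by (rule UU_SH[OF J])
    then have "\<exists>F c. finite F \<and> F \<subseteq> (SIGMA J:Js. B J) \<and>
        UU J v - (\<Sum>i\<in>F. sscale (c i) (case i of (J, b) \<Rightarrow> UU J b)) \<in> {0}"
      by (rule quotient_family_basis_span[OF 2])
    then obtain F c where F: "finite F" "F \<subseteq> (SIGMA J:Js. B J)"
        "UU J v = (\<Sum>i\<in>F. sscale (c i) (case i of (J, b) \<Rightarrow> UU J b))"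
      by (elim exE conjE) simp
    have v_eq: "UU J v = (\<Sum>K\<in>Js. UU K (comb F c K))"
      using F sum_comb[OF B F(1,2), of UU c] UU_add UU_pscale by simp
    \<comment> \<open>The expansion of \<open>UU J v\<close> minus \<open>UU J v\<close> itself,
      written as one vanishing sum.\<close>
    define p where "p K = comb F c K - (if K = J then v else 0)" for K
    have pp: "p K \<in> polys n" if "K \<in> Js" for K
      using that comb_polys[OF B F(2)] v by (auto simp: p_def)
    have "UU K (p K) + (if K = J then UU J v else 0) = UU K (comb F c K)" if K: "K \<in> Js" for K
    proof (cases "K = J")
      case True
      then have "UU J (p J + v) = UU J (p J) + UU J v" using J pp v by (intro UU_add) auto
      then show ?thesis using True by (simp add: p_def)
    qed (simp add: p_def)
    then have "(\<Sum>K\<in>Js. UU K (p K)) + (\<Sum>K\<in>Js. if K = J then UU J v else 0) = UU J v"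
      unfolding v_eq sum.distrib[symmetric] by (intro sum.cong) auto
    then have "(\<Sum>K\<in>Js. UU K (p K)) = 0" using J by (simp add: sum.delta)
    then have "p J \<in> AA J" using pp J by (intro UU_sum_zero[of p]) auto
    then have "- p J \<in> AA J" by (rule ideal_uminus[OF ann_ideal])
    then have "v - comb F c J \<in> AA J" by (simp add: p_def)
    moreover have "finite {b. (J, b) \<in> F}"
      using finite_imageI[OF F(1), of snd] by (rule finite_subset[rotated]) force
    moreover have "{b. (J, b) \<in> F} \<subseteq> B J" using F(2) by auto
    ultimately show "\<exists>F c. finite F \<and> F \<subseteq> B J \<and> v - (\<Sum>i\<in>F. pscale (c i) i) \<in> AA J"
      unfolding comb_def by (intro exI[of _ "{b. (J, b) \<in> F}"] exI[of _ "\<lambda>b. c (J, b)"]) auto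
  qed
qed

text \<open>Independence modulo \<open>AA J\<close> makes a combination of \<open>B J\<close> that
  lies in \<open>AA J\<close> zero, which is the assumption on \<open>AA\<close> in
  \<open>SI_single_sum_zero\<close>. For spanning, \<open>SI_single_span\<close> is applied with the
  spans of the \<open>B J\<close> as spaces of representatives.\<close>

lemma cond1_imp_cond3:
  assumes 1: cond1 shows cond3
  unfolding quotient_family_basis_def
proof (intro conjI allI impI ballI)
  show "(\<lambda>(J, b). sing J b) ` (SIGMA J:Js. B J) \<subseteq> superspace n" using B by (auto intro!: superspace_single)
next
  fix F c i assume a: "finite F \<and> F \<subseteq> (SIGMA J:Js. B J) \<and> (\<Sum>i\<in>F. sscale (c i) (case i of (J, b) \<Rightarrow> sing J b)) \<in> SI n"
    and i: "i \<in> F"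
  then have F: "finite F" "F \<subseteq> (SIGMA J:Js. B J)" by auto
  have z: "(\<Sum>J\<in>Js. sing J (comb F c J)) \<in> SI n"
    using a sum_comb[OF B F, of sing c] by (simp add: single_add sing_pscale)
  have 0: "comb F c J = 0" if J: "J \<in> Js" "comb F c J \<in> AA J" for J
    unfolding comb_def using cond1_comb[OF 1 F J] by (intro sum.neutral) auto
  have "comb F c J = 0" if "J \<in> Js" for J
    using SI_single_sum_zero[of "comb F c", OF comb_polys[OF B F(2)] z 0 that] by blast
  moreover obtain J b where "i = (J, b)" "J \<in> Js" using i F by auto
  ultimately show "c i = 0" using cond1_comb[OF 1 F, of J c] i ideal_0[OF ann_ideal] by simp
next
  fix v assume v: "v \<in> superspace n"
  have "\<exists>p. (\<forall>J\<in>Js. p J \<in> P.span (B J)) \<and> v - (\<Sum>J\<in>Js. sing J (p J)) \<in> SI n"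
  proof (rule SI_single_span[OF _ _ _ v, of _ "Suc (\<Sum>{1..n})"])
    fix J assume J: "J \<in> Js"
    show "P.span (B J) \<subseteq> polys n"
      by (rule P.span_minimal[OF B[OF J] ideal_subspace[OF polys_ideal]])
    show "\<exists>r\<in>P.span (B J). v - r \<in> AA J" if "v \<in> polys n" for v
      using cond1_span[OF 1 J that] .
  qed auto
  then obtain p where p: "\<And>J. J \<in> Js \<Longrightarrow> p J \<in> P.span (B J)" "v - (\<Sum>J\<in>Js. sing J (p J)) \<in> SI n" by blast
  have "\<exists>F c. finite F \<and> F \<subseteq> (SIGMA J:Js. B J) \<and> (\<forall>J\<in>Js. comb F c J = p J)"
    by (rule span_comb) (rule p(1))
  then obtain F c where F: "finite F" "F \<subseteq> (SIGMA J:Js. B J)" and Fc: "\<forall>J\<in>Js. comb F c J = p J"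
    by (elim exE conjE)
  have F3: "comb F c J = p J" if "J \<in> Js" for J by (rule bspec[OF Fc that])
  have "(\<Sum>i\<in>F. sscale (c i) (case i of (J, b) \<Rightarrow> sing J b)) = (\<Sum>J\<in>Js. sing J (p J))"
    using sum_comb[OF B F(1,2), of sing c] F3 by (simp add: single_add sing_pscale)
  then show "\<exists>F c. finite F \<and> F \<subseteq> (SIGMA J:Js. B J) \<and> v - (\<Sum>i\<in>F. sscale (c i) (case i of (J, b) \<Rightarrow> sing J b)) \<in> SI n"
    using F p(2) by (intro exI[of _ F] exI[of _ c]) simp
qed

end

end

theorem theorem5p4:
  fixes n :: nat and B :: "nat set \<Rightarrow> cpoly set"
  assumes "\<And>J. J \<subseteq> {1..n} \<Longrightarrow> B J \<subseteq> polys n"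
  shows
    "((\<forall>J. J \<subseteq> {1..n} \<longrightarrow>
        quotient_family_basis pscale (polys n) (colon n (coinv_ideal n) (fJ n J)) (B J) (\<lambda>b. b))
      \<longleftrightarrow>
      family_basis sscale (SH n) (SIGMA J:Pow {1..n}. B J)
        (\<lambda>(J, b). (Poly_Mapping.single J b \<Odot> D_op n J (of_poly (vandermonde n)))
                    \<Odot> D_op n J (of_poly (vandermonde n))))
     \<and>
     ((\<forall>J. J \<subseteq> {1..n} \<longrightarrow>
        quotient_family_basis pscale (polys n) (colon n (coinv_ideal n) (fJ n J)) (B J) (\<lambda>b. b))
      \<or>
      family_basis sscale (SH n) (SIGMA J:Pow {1..n}. B J)
        (\<lambda>(J, b). (Poly_Mapping.single J b \<Odot> D_op n J (of_poly (vandermonde n)))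
                    \<Odot> D_op n J (of_poly (vandermonde n)))
      \<longrightarrow>
      quotient_family_basis sscale (superspace n) (SI n) (SIGMA J:Pow {1..n}. B J)
        (\<lambda>(J, b). Poly_Mapping.single J b))"
proof -
  have B: "B J \<subseteq> polys n" if "J \<in> Pow {1..n}" for J using assms that by blast
  let ?c1 = "\<forall>J. J \<subseteq> {1..n} \<longrightarrow>
        quotient_family_basis pscale (polys n) (colon n (coinv_ideal n) (fJ n J)) (B J) (\<lambda>b. b)"
  let ?c2 = "family_basis sscale (SH n) (SIGMA J:Pow {1..n}. B J)
        (\<lambda>(J, b). (Poly_Mapping.single J b \<Odot> D_op n J (of_poly (vandermonde n)))
                    \<Odot> D_op n J (of_poly (vandermonde n)))"
  have eq: "colon n (coinv_ideal n) (fJ n J) = ann n (hh n J)" if "J \<subseteq> {1..n}" for J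
    by (rule AA_eq) (use that in simp)
  have 1: "?c1 \<longleftrightarrow> (\<forall>J\<in>Pow {1..n}. quotient_family_basis pscale (polys n) (ann n (hh n J)) (B J) (\<lambda>b. b))"
    unfolding Ball_def Pow_iff by (intro all_cong1 imp_cong refl) (simp only: eq)
  have 2: "?c2 \<longleftrightarrow> quotient_family_basis sscale (SH n) {0} (SIGMA J:Pow {1..n}. B J) (\<lambda>(J, b). UU n J b)"
    unfolding family_basis_iff[OF vector_space_sscale SH_subspace] UU_def DD_def ..
  have equivalent: "(P \<longleftrightarrow> Q) \<and> (P \<or> Q \<longrightarrow> R)" if "P \<Longrightarrow> Q" "Q \<Longrightarrow> P" "P \<Longrightarrow> R" for P Q R
    using that by blast
  show ?thesis
    unfolding 1 2
    by (rule equivalent[OF cond1_imp_cond2[OF B] cond2_imp_cond1[OF B] cond1_imp_cond3[OF B]])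
qed

end
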